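(* For every real number $G(0)$, the initial data $$\big(f(0,\cdot),\partial_t f(0,\cdot)\big)=\big(G(0)\,e_0,\,0\big),\qquad e_0(\psi)=\sin\psi,$$ evolve into a time periodic solution of $$-\partial_t^2 f(t,\psi)+\partial_\psi^2 f(t,\psi)=\frac{f^3(t,\psi)}{\sin^2(\psi)},\quad (t,\psi)\in\mathbb{R}\times(0,\pi),\qquad f(t,0)=f(t,\pi)=0,\quad t\in\mathbb{R}.$$ That is, the solution $f$ with these initial data exists for all $t\in\mathbb{R}$ and there is $T>0$ with $f(t+T,\psi)=f(t,\psi)$ for all $t\in\mathbb{R}$, $\psi\in[0,\pi]$.
   Context: Solutions are understood in the energy space: $f$ is continuous in $t$ with values in $\{g\in H^1[0,\pi]:g(0)=g(\pi)=0\}$, $\partial_t f$ is continuous in $t$ with values in $L^2[0,\pi]$, and the equation holds in the sense of distributions on $\mathbb{R}\times(0,\pi)$ (equivalently in Duhamel form). *)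

theory Defs
  imports "HOL-Analysis.Analysis"
begin

text \<open>Test functions. Over a finite-dimensional domain, continuous differentiability to order
  \<open>k + 1\<close> amounts to: differentiable, with all directional derivatives of class \<open>C\<^sup>k\<close>.\<close>

primrec C_k :: "nat \<Rightarrow> ('a::euclidean_space \<Rightarrow> real) \<Rightarrow> bool" where
  "C_k 0 f \<longleftrightarrow> continuous_on UNIV f"
| "C_k (Suc k) f \<longleftrightarrow>
     (\<exists>f'. (\<forall>x. (f has_derivative f' x) (at x)) \<and> (\<forall>v. C_k k (\<lambda>x. f' x v)))"

definition test_function :: "'a::euclidean_space set \<Rightarrow> ('a \<Rightarrow> real) \<Rightarrow> bool" where
  "test_function \<Omega> \<phi> \<longleftrightarrow>
     (\<forall>k. C_k k \<phi>) \<and> compact (closure {x. \<phi> x \<noteq> 0}) \<and> closure {x. \<phi> x \<noteq> 0} \<subseteq> \<Omega>"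

text \<open>Elements of \<open>L\<^sup>2[0,\<pi>]\<close> and \<open>H\<^sup>1[0,\<pi>]\<close> are represented by functions on the reals whose values
  outside \<open>[0,\<pi>]\<close> are irrelevant.\<close>

definition in_L2 :: "(real \<Rightarrow> real) \<Rightarrow> bool" where
  "in_L2 g \<longleftrightarrow> set_borel_measurable lebesgue {0..pi} g \<and>
     set_integrable lebesgue {0..pi} (\<lambda>x. (g x)\<^sup>2)"

definition L2_norm :: "(real \<Rightarrow> real) \<Rightarrow> real" where
  "L2_norm g = sqrt (LINT x:{0..pi}|lebesgue. (g x)\<^sup>2)"

definition has_weak_deriv :: "(real \<Rightarrow> real) \<Rightarrow> (real \<Rightarrow> real) \<Rightarrow> bool" where
  "has_weak_deriv g h \<longleftrightarrow>
     (\<forall>\<phi>. test_function {0<..<pi} \<phi> \<longrightarrow>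
        (LINT x:{0..pi}|lebesgue. g x * deriv \<phi> x) = - (LINT x:{0..pi}|lebesgue. h x * \<phi> x))"

definition in_H1 :: "(real \<Rightarrow> real) \<Rightarrow> bool" where
  "in_H1 g \<longleftrightarrow> in_L2 g \<and> (\<exists>h. in_L2 h \<and> has_weak_deriv g h)"

text \<open>The choice is unique up to null sets in \<open>[0,\<pi>]\<close>, so \<open>H1_norm\<close> below does not depend on it.\<close>

definition weak_deriv :: "(real \<Rightarrow> real) \<Rightarrow> real \<Rightarrow> real" where
  "weak_deriv g = (SOME h. in_L2 h \<and> has_weak_deriv g h)"

definition H1_norm :: "(real \<Rightarrow> real) \<Rightarrow> real" where
  "H1_norm g = sqrt ((L2_norm g)\<^sup>2 + (L2_norm (weak_deriv g))\<^sup>2)"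

text \<open>Boundary values refer to the continuous representative of an \<open>H\<^sup>1\<close> class, which is the one
  used throughout.\<close>

definition in_H1_0 :: "(real \<Rightarrow> real) \<Rightarrow> bool" where
  "in_H1_0 g \<longleftrightarrow> in_H1 g \<and> continuous_on {0..pi} g \<and> g 0 = 0 \<and> g pi = 0"

definition continuous_into_H1_0 :: "(real \<Rightarrow> real \<Rightarrow> real) \<Rightarrow> bool" where
  "continuous_into_H1_0 u \<longleftrightarrow> (\<forall>t. in_H1_0 (u t)) \<and>
     (\<forall>t. ((\<lambda>s. H1_norm (\<lambda>x. u s x - u t x)) \<longlongrightarrow> 0) (at t))"

definition continuous_into_L2 :: "(real \<Rightarrow> real \<Rightarrow> real) \<Rightarrow> bool" where
  "continuous_into_L2 u \<longleftrightarrow> (\<forall>t. in_L2 (u t)) \<and>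
     (\<forall>t. ((\<lambda>s. L2_norm (\<lambda>x. u s x - u t x)) \<longlongrightarrow> 0) (at t))"

definition has_time_deriv_L2 :: "(real \<Rightarrow> real \<Rightarrow> real) \<Rightarrow> (real \<Rightarrow> real \<Rightarrow> real) \<Rightarrow> bool" where
  "has_time_deriv_L2 u v \<longleftrightarrow>
     (\<forall>t. ((\<lambda>s. L2_norm (\<lambda>x. (u s x - u t x) / (s - t) - v t x)) \<longlongrightarrow> 0) (at t))"

definition d_time :: "(real \<times> real \<Rightarrow> real) \<Rightarrow> real \<times> real \<Rightarrow> real" where
  "d_time \<phi> = (\<lambda>(t, x). deriv (\<lambda>s. \<phi> (s, x)) t)"

definition d_space :: "(real \<times> real \<Rightarrow> real) \<Rightarrow> real \<times> real \<Rightarrow> real" where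
  "d_space \<phi> = (\<lambda>(t, x). deriv (\<lambda>y. \<phi> (t, y)) x)"

abbreviation strip :: "(real \<times> real) set" where
  "strip \<equiv> UNIV \<times> {0<..<pi}"

text \<open>For \<open>f\<close> continuous into \<open>H\<^sup>1\<^sub>0\<close>, both integrands below are continuous with compact support in
  the open strip, hence integrable.\<close>

definition distributional_solution :: "(real \<Rightarrow> real \<Rightarrow> real) \<Rightarrow> bool" where
  "distributional_solution f \<longleftrightarrow>
     (\<forall>\<phi>. test_function strip \<phi> \<longrightarrow>
        (LINT z:strip|lebesgue.
           f (fst z) (snd z) * (- d_time (d_time \<phi>) z + d_space (d_space \<phi>) z)) =
        (LINT z:strip|lebesgue.
           (f (fst z) (snd z)) ^ 3 / (sin (snd z))\<^sup>2 * \<phi> z))"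

definition energy_solution ::
  "(real \<Rightarrow> real \<Rightarrow> real) \<Rightarrow> (real \<Rightarrow> real) \<Rightarrow> (real \<Rightarrow> real) \<Rightarrow> bool" where
  "energy_solution f f0 f1 \<longleftrightarrow>
     continuous_into_H1_0 f \<and>
     (\<exists>ft. has_time_deriv_L2 f ft \<and> continuous_into_L2 ft \<and>
           (AE x in lebesgue. x \<in> {0..pi} \<longrightarrow> ft 0 x = f1 x)) \<and>
     distributional_solution f \<and>
     (\<forall>x\<in>{0..pi}. f 0 x = f0 x)"

end

theory Submission
  imports Defs
begin

text \<open>Inserting \<open>f(t, \<psi>) = G(t) sin \<psi>\<close> turns the equation into Duffing's equation
  \<open>G'' + G + G\<^sup>3 = 0\<close>, all of whose solutions with \<open>G'(0) = 0\<close> are periodic; this gives existence.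

  For uniqueness, the difference \<open>w\<close> of two energy solutions satisfies \<open>- w\<^sub>t\<^sub>t + w\<^sub>x\<^sub>x = F\<close> weakly, with
  \<open>\<bar>F\<bar> \<le> C \<bar>w\<bar> / d\<close>, where \<open>d\<close> is the distance to the boundary, because functions in \<open>H\<^sup>1\<^sub>0\<close> are
  \<open>O(\<surd>d)\<close>. Since \<open>w\<close> has vanishing Cauchy data, it may be replaced by \<open>0\<close> for negative times. Testing with
  functions \<open>a(x + t) b(x - t)\<close>, where \<open>a\<close> and \<open>b\<close> approximate indicators of intervals, expresses \<open>w\<close> at the
  top of a characteristic rectangle through its values at the other three corners and the integral of \<open>F\<close>.
  Let the rectangle reach both sides of the strip, where \<open>w = 0\<close>; the lower corner then lies a time \<open>\<pi>\<close> earlier.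
  As \<open>1 / \<surd>d\<close> integrates to \<open>O(\<surd>d(x))\<close> over the time slices of this rectangle, the best constant \<open>A\<close> in
  \<open>\<bar>w(t, x)\<bar> \<le> A exp(\<lambda> t) \<surd>d(x)\<close> is at most half of itself for large \<open>\<lambda>\<close>, hence \<open>A = 0\<close>. No energy
  identity or Hardy inequality is needed.\<close>

section \<open>Smooth functions\<close>

text \<open>The obstacle to uniqueness is the coefficient 1/sin^2. From |u| \<le> B sqrt d and d
  \<le> 2 sin x, the difference of the two cubic terms is at most 12 B^2 |w| / d: two powers of d in
  the denominator become one. In the sup norm 1/d would remain, whose integral up to the boundary is
  infinite; the weight sqrt d, which the energy space supplies, lowers it to 1/sqrt d. The estimate
  must then reproduce the weight at (t, x). It does so because time slices of the rectangle have
  length at most twice the distance of x from the boundary, and the integral of 1/sqrt d over an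
  interval is bounded by the root of its length, wherever the interval lies. The factor one half is
  the sum of two quarters: one from the lower corner, damped by exp(-\<lambda> pi), and one from the
  source, whose time integral gains 1/\<lambda>. Test functions are smooth with support in the open
  strip, so each identity is first obtained with mollified corners slightly inside the strip;
  continuity of w permits the limit.\<close>

abbreviation smooth :: "('a::euclidean_space \<Rightarrow> real) \<Rightarrow> bool" where
  "smooth f \<equiv> \<forall>k. C_k k f"

lemma C_k_Suc_imp_C_k: "C_k (Suc k) f \<Longrightarrow> C_k k f"
proof (induction k arbitrary: f)
  case 0
  then show ?case
    by (auto intro!: continuous_at_imp_continuous_on dest: has_derivative_continuous)
next
  case (Suc k)
  from Suc.prems obtain f' where "\<forall>x. (f has_derivative f' x) (at x)"
    "\<forall>v. C_k (Suc k) (\<lambda>x. f' x v)" by (subst (asm) C_k.simps(2)) blast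
  then show ?case using Suc.IH by (subst C_k.simps(2)) blast
qed

lemma C_k_const: "C_k k (\<lambda>x. c)"
proof (induction k arbitrary: c)
  case (Suc k)
  then show ?case by (auto intro!: exI[of _ "\<lambda>x v. 0"])
qed simp

lemma C_k_add: "C_k k f \<Longrightarrow> C_k k g \<Longrightarrow> C_k k (\<lambda>x. f x + g x)"
proof (induction k arbitrary: f g)
  case 0
  then show ?case by (auto intro: continuous_intros)
next
  case (Suc k)
  from Suc.prems obtain f' g' where
    "\<And>x. (f has_derivative f' x) (at x)" "\<And>v. C_k k (\<lambda>x. f' x v)"
    "\<And>x. (g has_derivative g' x) (at x)" "\<And>v. C_k k (\<lambda>x. g' x v)" by auto
  then show ?case using Suc.IH
    by (auto intro!: exI[of _ "\<lambda>x v. f' x v + g' x v"] derivative_intros)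
qed

lemma C_k_mult: "C_k k f \<Longrightarrow> C_k k g \<Longrightarrow> C_k k (\<lambda>x. f x * g x)"
proof (induction k arbitrary: f g)
  case 0
  then show ?case by (auto intro: continuous_intros)
next
  case (Suc k)
  from Suc.prems obtain f' g' where d:
    "\<And>x. (f has_derivative f' x) (at x)" "\<And>v. C_k k (\<lambda>x. f' x v)"
    "\<And>x. (g has_derivative g' x) (at x)" "\<And>v. C_k k (\<lambda>x. g' x v)" by auto
  have "C_k k f" "C_k k g" using Suc.prems C_k_Suc_imp_C_k by blast+
  then have "C_k k (\<lambda>x. f x * g' x v + f' x v * g x)" for v
    by (intro C_k_add Suc.IH d)
  then show ?case
    using d by (auto intro!: exI[of _ "\<lambda>x v. f x * g' x v + f' x v * g x"] derivative_intros)
qed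

lemma C_k_diff: "C_k k f \<Longrightarrow> C_k k g \<Longrightarrow> C_k k (\<lambda>x. f x - g x)"
  using C_k_add[of k f "\<lambda>x. (-1) * g x"] C_k_mult[OF C_k_const, of k g "-1"] by simp

lemma C_k_compose_affine:
  assumes A: "bounded_linear A" and "C_k k f"
  shows "C_k k (\<lambda>x. f (A x + c))"
  using assms(2)
proof (induction k arbitrary: f)
  case 0
  then show ?case
    by (auto intro!: continuous_on_compose2[of UNIV f] continuous_intros
        linear_continuous_on[OF A])
next
  case (Suc k)
  then obtain f' where f': "\<And>x. (f has_derivative f' x) (at x)" "\<And>v. C_k k (\<lambda>x. f' x v)"
    by auto
  have "((\<lambda>x. f (A x + c)) has_derivative (\<lambda>v. f' (A x + c) (A v))) (at x)" for x
    by (rule has_derivative_compose[OF _ f'(1)])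
      (auto intro!: derivative_eq_intros bounded_linear_imp_has_derivative[OF A])
  then show ?case
    using Suc.IH f'(2) by (auto intro!: exI[of _ "\<lambda>x v. f' (A x + c) (A v)"])
qed

lemma C_k_Suc_real:
  assumes "\<And>x. (f has_real_derivative f' x) (at x)" "C_k k f'"
  shows "C_k (Suc k) f"
proof -
  have "C_k k (\<lambda>x. f' x * v)" for v
    by (intro C_k_mult C_k_const assms)
  then show ?thesis
    using assms(1) by (auto intro!: exI[of _ "\<lambda>x v. f' x * v"] simp: has_field_derivative_def)
qed

text \<open>\<open>C_k\<close> provides a separate derivative for every order; uniqueness of
  derivatives merges them into one, so that smoothness passes to directional derivatives.\<close>

lemma smooth_directional_derivative:
  assumes "smooth f"
  obtains f' where "\<And>x. (f has_derivative f' x) (at x)" "\<And>v. smooth (\<lambda>x. f' x v)"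
proof -
  have "\<exists>f'. (\<forall>x. (f has_derivative f' x) (at x)) \<and> (\<forall>v. C_k k (\<lambda>x. f' x v))" for k
    using assms C_k.simps(2)[of k f] by blast
  then obtain D where D: "\<And>k x. (f has_derivative D k x) (at x)" "\<And>k v. C_k k (\<lambda>x. D k x v)"
    by metis
  have "D k = D 0" for k
    using has_derivative_unique[OF D(1) D(1)] by (rule ext)
  then have "C_k k (\<lambda>x. D 0 x v)" for k v
    using D(2)[of k v] by metis
  then show ?thesis using that D(1) by blast
qed

lemma smooth_continuous_on: "smooth f \<Longrightarrow> continuous_on S f"
  using C_k.simps(1) continuous_on_subset by (metis subset_UNIV)

lemma smooth_deriv:
  fixes f :: "real \<Rightarrow> real"
  assumes "smooth f"
  shows "(f has_real_derivative deriv f x) (at x)" "smooth (deriv f)"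
proof -
  obtain f' where f': "\<And>x. (f has_derivative f' x) (at x)" "\<And>v. smooth (\<lambda>x. f' x v)"
    using smooth_directional_derivative[OF assms] by blast
  have "f' x v = f' x 1 * v" for x v
    using linear_cmul[OF has_derivative_linear[OF f'(1)], of x v 1] by simp
  then have *: "(f has_real_derivative f' x 1) (at x)" for x
    using f'(1)[of x] unfolding has_field_derivative_def by (metis ext)
  then have "deriv f = (\<lambda>x. f' x 1)" using DERIV_imp_deriv by blast
  then show "(f has_real_derivative deriv f x) (at x)" "smooth (deriv f)"
    using * f'(2)[of 1] by simp_all
qed

lemma smooth_d_time:
  assumes "smooth \<phi>"
  shows "((\<lambda>s. \<phi> (s, x)) has_real_derivative d_time \<phi> (t, x)) (at t)" "smooth (d_time \<phi>)"
proof -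
  obtain f' where f': "\<And>x. (\<phi> has_derivative f' x) (at x)" "\<And>v. smooth (\<lambda>x. f' x v)"
    using smooth_directional_derivative[OF assms] by blast
  have *: "((\<lambda>s. \<phi> (s, x)) has_real_derivative f' (t, x) (1, 0)) (at t)" for t x
  proof -
    have "((\<lambda>s. \<phi> (s, x)) has_derivative (\<lambda>v. f' (t, x) (v, 0))) (at t)"
      by (rule has_derivative_compose[OF _ f'(1)]) (auto intro!: derivative_eq_intros)
    moreover have "(\<lambda>v. f' (t, x) (v, 0)) = (*) (f' (t, x) (1, 0))"
    proof
      fix v show "f' (t, x) (v, 0) = f' (t, x) (1, 0) * v"
        using linear_cmul[OF has_derivative_linear[OF f'(1)], of "(t,x)" v "(1,0)"] by simp
    qed
    ultimately show ?thesis unfolding has_field_derivative_def by simp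
  qed
  then have "d_time \<phi> = (\<lambda>z. f' z (1, 0))"
    unfolding d_time_def using DERIV_imp_deriv[OF *] by auto
  then show "((\<lambda>s. \<phi> (s, x)) has_real_derivative d_time \<phi> (t, x)) (at t)" "smooth (d_time \<phi>)"
    using * f'(2) by simp_all
qed

lemma smooth_d_space:
  assumes "smooth \<phi>"
  shows "((\<lambda>y. \<phi> (t, y)) has_real_derivative d_space \<phi> (t, x)) (at x)" "smooth (d_space \<phi>)"
proof -
  obtain f' where f': "\<And>x. (\<phi> has_derivative f' x) (at x)" "\<And>v. smooth (\<lambda>x. f' x v)"
    using smooth_directional_derivative[OF assms] by blast
  have *: "((\<lambda>y. \<phi> (t, y)) has_real_derivative f' (t, x) (0, 1)) (at x)" for t x
  proof -
    have "((\<lambda>y. \<phi> (t, y)) has_derivative (\<lambda>v. f' (t, x) (0, v))) (at x)"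
      by (rule has_derivative_compose[OF _ f'(1)]) (auto intro!: derivative_eq_intros)
    moreover have "(\<lambda>v. f' (t, x) (0, v)) = (*) (f' (t, x) (0, 1))"
    proof
      fix v show "f' (t, x) (0, v) = f' (t, x) (0, 1) * v"
        using linear_cmul[OF has_derivative_linear[OF f'(1)], of "(t,x)" v "(0,1)"] by simp
    qed
    ultimately show ?thesis unfolding has_field_derivative_def by simp
  qed
  then have "d_space \<phi> = (\<lambda>z. f' z (0, 1))"
    unfolding d_space_def using DERIV_imp_deriv[OF *] by auto
  then show "((\<lambda>y. \<phi> (t, y)) has_real_derivative d_space \<phi> (t, x)) (at x)" "smooth (d_space \<phi>)"
    using * f'(2) by simp_all
qed

lemma d_time_eq_0_outside_support:
  assumes "z \<notin> closure {x. \<phi> x \<noteq> 0}"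
  shows "d_time \<phi> z = 0"
proof -
  obtain t x where z: "z = (t, x)" by (cases z)
  let ?U = "- closure {x. \<phi> x \<noteq> 0}"
  have "\<forall>\<^sub>F s in nhds t. (s, x) \<in> ?U"
    using assms unfolding z
    by (intro eventually_compose_filterlim[OF eventually_nhds_in_open[of ?U "(t,x)"]])
      (auto intro!: tendsto_intros tendsto_ident_at simp: filterlim_ident)
  then have "\<forall>\<^sub>F s in nhds t. \<phi> (s, x) = 0"
    by eventually_elim (auto dest: subsetD[OF closure_subset] simp: subset_iff closure_def)
  then have "deriv (\<lambda>s. \<phi> (s, x)) t = deriv (\<lambda>s. 0) t"
    by (intro deriv_cong_ev) auto
  then show ?thesis by (simp add: z d_time_def)
qed

lemma d_space_eq_0_outside_support:
  assumes "z \<notin> closure {x. \<phi> x \<noteq> 0}"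
  shows "d_space \<phi> z = 0"
proof -
  obtain t x where z: "z = (t, x)" by (cases z)
  let ?U = "- closure {x. \<phi> x \<noteq> 0}"
  have "\<forall>\<^sub>F s in nhds x. (t, s) \<in> ?U"
    using assms unfolding z
    by (intro eventually_compose_filterlim[OF eventually_nhds_in_open[of ?U "(t,x)"]])
      (auto intro!: tendsto_intros tendsto_ident_at simp: filterlim_ident)
  then have "\<forall>\<^sub>F s in nhds x. \<phi> (t, s) = 0"
    by eventually_elim (auto dest: subsetD[OF closure_subset] simp: subset_iff closure_def)
  then have "deriv (\<lambda>s. \<phi> (t, s)) x = deriv (\<lambda>s. 0) x"
    by (intro deriv_cong_ev) auto
  then show ?thesis by (simp add: z d_space_def)
qed

section \<open>A smooth monotone step from exp(-1/x)\<close>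

definition exp_recip_poly :: "real poly \<Rightarrow> real \<Rightarrow> real" where
  "exp_recip_poly p x = (if x > 0 then poly p (1 / x) * exp (- (1 / x)) else 0)"

lemma poly_times_exp_minus_tendsto_0: "((\<lambda>y. poly p y * exp (- y)) \<longlongrightarrow> (0::real)) at_top"
proof -
  have *: "((\<lambda>y::real. \<Sum>i\<le>degree p. coeff p i * (y ^ i * exp (- y))) \<longlongrightarrow> (\<Sum>i\<le>degree p. coeff p i * 0)) at_top"
    using tendsto_power_div_exp_0
    by (intro tendsto_intros) (simp add: exp_minus field_simps)
  show ?thesis
    by (rule Lim_transform_eventually[OF tendsto_eq_rhs[OF *]])
      (auto simp: poly_altdef sum_distrib_right mult.assoc)
qed

text \<open>With y = 1/x one has d/dx = - y^2 d/dy, which turns p(y) exp(-y) into y^2 (p - p')(y)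
  exp(-y). The family is therefore closed under differentiation, and smoothness follows by induction
  for all polynomials at once; p = 1 is the classical flat function.\<close>

lemma exp_recip_poly_deriv:
  "(exp_recip_poly p has_real_derivative exp_recip_poly ([:0, 0, 1:] * (p - pderiv p)) x) (at x)"
proof (cases "x = 0")
  case False
  show ?thesis
  proof (cases "x > 0")
    case True
    have "((\<lambda>x. poly p (1 / x) * exp (- (1 / x))) has_real_derivative
        exp_recip_poly ([:0, 0, 1:] * (p - pderiv p)) x) (at x)"
      using True by (auto intro!: derivative_eq_intros poly_DERIV[THEN DERIV_chain2]
          simp: exp_recip_poly_def field_simps power2_eq_square)
    then show ?thesis
      by (rule DERIV_cong_ev[THEN iffD1, rotated -1])
        (use True eventually_nhds_in_open[of "{0<..}" x] in
          \<open>auto simp: exp_recip_poly_def elim: eventually_mono\<close>)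
  next
    case neg: False
    with False have "x < 0" by simp
    have "((\<lambda>x. 0) has_real_derivative 0) (at x)" by simp
    then show ?thesis
      by (rule DERIV_cong_ev[THEN iffD1, rotated -1])
        (use \<open>x < 0\<close> eventually_nhds_in_open[of "{..<0}" x] in
          \<open>auto simp: exp_recip_poly_def elim!: eventually_mono\<close>)
  qed
next
  case True
  have "((\<lambda>y. exp_recip_poly p y / y) \<longlongrightarrow> 0) (at_right 0)"
  proof -
    \<comment> \<open>The difference quotient at 0 carries an extra factor 1/y, which
      \<open>pCons 0 p\<close> absorbs into the polynomial.\<close>
    have "((\<lambda>y. poly (pCons 0 p) (inverse y) * exp (- inverse y)) \<longlongrightarrow> (0::real)) (at_right 0)"
      by (rule filterlim_compose[OF poly_times_exp_minus_tendsto_0 filterlim_inverse_at_top_right])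
    then show ?thesis
      by (rule Lim_transform_eventually)
        (auto simp: exp_recip_poly_def eventually_at_right_field field_simps intro!: exI[of _ 1])
  qed
  moreover have "((\<lambda>y. exp_recip_poly p y / y) \<longlongrightarrow> 0) (at_left 0)"
    by (rule Lim_transform_eventually[of "\<lambda>_. 0"])
      (auto simp: exp_recip_poly_def eventually_at_left_field intro!: exI[of _ "-1"])
  ultimately have "((\<lambda>y. exp_recip_poly p y / y) \<longlongrightarrow> 0) (at 0)"
    by (simp add: filterlim_at_split)
  then show ?thesis
    using True by (simp add: has_field_derivative_iff exp_recip_poly_def)
qed

lemma smooth_exp_recip_poly: "smooth (exp_recip_poly p)"
proof
  fix k show "C_k k (exp_recip_poly p)"
  proof (induction k arbitrary: p)
    case 0
    then show ?case
      using DERIV_isCont[OF exp_recip_poly_deriv] by (simp add: continuous_at_imp_continuous_on)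
  next
    case (Suc k)
    then show ?case by (rule C_k_Suc_real[OF exp_recip_poly_deriv])
  qed
qed

lemma smooth_step_exists:
  "\<exists>S::real \<Rightarrow> real. smooth S \<and> (\<forall>x\<le>0. S x = 0) \<and> (\<forall>x\<ge>1. S x = 1) \<and> mono S"
proof -
  \<comment> \<open>The product vanishes outside (0, 1) and is positive inside; its normalised
    primitive is the step.\<close>
  define \<rho> :: "real \<Rightarrow> real" where "\<rho> x = exp_recip_poly 1 x * exp_recip_poly 1 (1 - x)" for x
  have sm: "smooth \<rho>"
  proof
    fix k
    have "C_k k (\<lambda>x. exp_recip_poly 1 (- x + 1))"
      by (rule C_k_compose_affine)
       (auto simp: smooth_exp_recip_poly intro: bounded_linear_minus bounded_linear_ident)
    then show "C_k k \<rho>"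
      unfolding \<rho>_def using smooth_exp_recip_poly by (auto intro: C_k_mult)
  qed
  have cont: "continuous_on X \<rho>" for X using sm smooth_continuous_on by blast
  have zero: "\<rho> x = 0" if "x \<le> 0 \<or> x \<ge> 1" for x
    using that by (auto simp: \<rho>_def exp_recip_poly_def)
  have nn: "\<rho> x \<ge> 0" for x by (auto simp: \<rho>_def exp_recip_poly_def)
  have int: "\<rho> integrable_on {a..b}" for a b
    using cont integrable_continuous_interval by blast
  \<comment> \<open>Starting the primitive at -1 instead of 0 lets the fundamental theorem give a
    two-sided derivative at 0.\<close>
  define P where "P x = integral {-1..x} \<rho>" for x
  have P0: "P x = 0" if "x \<le> 0" for x
    using that zero unfolding P_def by (subst integral_cong[of _ _ "\<lambda>_. 0"]) auto
  have dP: "(P has_real_derivative \<rho> x) (at x)" for x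
  proof (cases "x > -1")
    case True
    have "(P has_real_derivative \<rho> x) (at x within {-1..x+1})"
      unfolding P_def by (rule integral_has_real_derivative) (use True cont in auto)
    then show ?thesis
      using at_within_Icc_at[of "-1" x "x + 1"] True by simp
  next
    case False
    have "((\<lambda>x. 0) has_real_derivative 0) (at x)" by simp
    then have "((\<lambda>x. 0) has_real_derivative \<rho> x) (at x)" using zero False by simp
    then show ?thesis
      by (rule DERIV_cong_ev[THEN iffD1, rotated -1])
        (use False P0 eventually_nhds_in_open[of "{..<0}" x] in
          \<open>auto elim!: eventually_mono\<close>)
  qed
  have mono: "mono P"
    using DERIV_nonneg_imp_nondecreasing[of _ _ P] dP nn by (intro monoI) blast
  have P1: "P x = P 1" if "x \<ge> 1" for x
  proof -
    have "P x = P 1 + integral {1..x} \<rho>"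
      unfolding P_def using that int by (subst Henstock_Kurzweil_Integration.integral_combine) auto
    moreover have "integral {1..x} \<rho> = 0"
      using zero by (subst integral_cong[of _ _ "\<lambda>_. 0"]) auto
    ultimately show ?thesis by simp
  qed
  have pos: "P 1 > 0"
  proof -
    have "P 1 \<ge> P 0" using mono by (simp add: monoD)
    \<comment> \<open>Otherwise the monotone \<open>P\<close> would be constant on [0, 1], and its
      derivative \<open>\<rho>\<close> would vanish at 1/2.\<close>
    moreover have "P 1 \<noteq> P 0"
    proof
      assume "P 1 = P 0"
      then have c: "P x = 0" if "x \<in> {0..1}" for x
        using monoD[OF mono, of 0 x] monoD[OF mono, of x 1] P0[of 0] that by auto
      have "((\<lambda>x. 0) has_real_derivative \<rho> (1/2)) (at (1/2))"
        by (rule DERIV_cong_ev[THEN iffD1, rotated -1, OF dP])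
          (use c eventually_nhds_in_open[of "{0<..<1}" "1/2::real"] in
            \<open>auto elim!: eventually_mono\<close>)
      then have "\<rho> (1/2) = 0" using DERIV_unique DERIV_const by blast
      then show False by (auto simp: \<rho>_def exp_recip_poly_def)
    qed
    ultimately show ?thesis using P0[of 0] by simp
  qed
  have smP: "smooth P"
  proof
    fix k show "C_k k P"
      by (cases k) (use C_k_Suc_real[OF dP] sm C_k_Suc_imp_C_k in blast)+
  qed
  show ?thesis
  proof (intro exI[of _ "\<lambda>x. (1 / P 1) * P x"] conjI allI impI)
    fix k show "C_k k (\<lambda>x. (1 / P 1) * P x)" using smP by (intro C_k_mult C_k_const) auto
  next
    fix x :: real assume "x \<ge> 1"
    then show "(1 / P 1) * P x = 1" using P1[of x] pos by simp
  next
    show "mono (\<lambda>x. (1 / P 1) * P x)"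
      using pos mono by (intro monoI mult_left_mono) (auto simp: mono_def)
  next
    fix x :: real assume "x \<le> 0"
    then show "(1 / P 1) * P x = 0" using P0[of x] by simp
  qed
qed

section \<open>Square-integrable functions and mollifiers\<close>

lemma Cauchy_Schwarz_integral:
  fixes f g :: "'a \<Rightarrow> real"
  assumes [measurable]: "f \<in> borel_measurable M" "g \<in> borel_measurable M"
    and f2: "integrable M (\<lambda>x. (f x)\<^sup>2)" and g2: "integrable M (\<lambda>x. (g x)\<^sup>2)"
  shows "integrable M (\<lambda>x. f x * g x)"
    and "\<bar>\<integral>x. f x * g x \<partial>M\<bar> \<le> sqrt (\<integral>x. (f x)\<^sup>2 \<partial>M) * sqrt (\<integral>x. (g x)\<^sup>2 \<partial>M)"
proof -
  show int: "integrable M (\<lambda>x. f x * g x)"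
  proof (rule Bochner_Integration.integrable_bound)
    show "integrable M (\<lambda>x. (f x)\<^sup>2 + (g x)\<^sup>2)" using f2 g2 by simp
    have "\<bar>f x * g x\<bar> \<le> (f x)\<^sup>2 + (g x)\<^sup>2" for x
      using sum_squares_bound[of "\<bar>f x\<bar>" "\<bar>g x\<bar>"] mult_nonneg_nonneg[OF abs_ge_zero abs_ge_zero, of "f x" "g x"]
      unfolding abs_mult power2_abs by linarith
    then show "AE x in M. norm (f x * g x) \<le> norm ((f x)\<^sup>2 + (g x)\<^sup>2)" by simp
  qed simp
  define A B C where "A = (\<integral>x. (f x)\<^sup>2 \<partial>M)" and "B = (\<integral>x. f x * g x \<partial>M)" and "C = (\<integral>x. (g x)\<^sup>2 \<partial>M)"
  \<comment> \<open>The integral of (f + l g)^2 is a nonnegative quadratic in l, minimal at l = - B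
    / C. If C = 0 it is affine, and for B \<noteq> 0 its value at - (A + 1) / (2 B) would be
    -1.\<close>
  have q: "A + 2 * l * B + l\<^sup>2 * C \<ge> 0" for l
  proof -
    have "(\<integral>x. (f x + l * g x)\<^sup>2 \<partial>M) = (\<integral>x. (f x)\<^sup>2 + 2 * l * (f x * g x) + l\<^sup>2 * (g x)\<^sup>2 \<partial>M)"
      by (simp add: power2_eq_square algebra_simps)
    also have "\<dots> = A + 2 * l * B + l\<^sup>2 * C"
      using int f2 g2 unfolding A_def B_def C_def by simp
    finally show ?thesis using Bochner_Integration.integral_nonneg[of M "\<lambda>x. (f x + l * g x)\<^sup>2"] by simp
  qed
  have nn: "A \<ge> 0" "C \<ge> 0" unfolding A_def C_def by simp_all
  have "B\<^sup>2 \<le> A * C"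
  proof (cases "C = 0")
    case True
    have "B = 0"
    proof (rule ccontr)
      assume "B \<noteq> 0"
      then show False using q[of "- (A + 1) / (2 * B)"] True by (simp add: field_simps)
    qed
    then show ?thesis using True by simp
  next
    case False
    then have "C > 0" using nn by simp
    moreover have "A + 2 * (- B / C) * B + (- B / C)\<^sup>2 * C = A - B\<^sup>2 / C"
      using False by (simp add: field_simps power2_eq_square)
    ultimately have "0 \<le> A - B\<^sup>2 / C" using q[of "- B / C"] by simp
    then show ?thesis using \<open>C > 0\<close> by (simp add: field_simps)
  qed
  then have "sqrt (B\<^sup>2) \<le> sqrt (A * C)" by (rule real_sqrt_le_mono)
  then show "\<bar>\<integral>x. f x * g x \<partial>M\<bar> \<le> sqrt (\<integral>x. (f x)\<^sup>2 \<partial>M) * sqrt (\<integral>x. (g x)\<^sup>2 \<partial>M)"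
    unfolding A_def[symmetric] B_def[symmetric] C_def[symmetric] by (simp add: real_sqrt_mult)
qed

text \<open>The sets over which \<open>k\<close> integrates to 0 form a Dynkin system:
  \<open>tot0\<close> gives complements, countable additivity gives disjoint unions. Closed
  intervals are stable under intersection and generate the Borel sets.\<close>

lemma AE_eq_0_if_interval_integrals_eq_0:
  fixes k :: "real \<Rightarrow> real"
  assumes k: "integrable lborel k"
    and int0: "\<And>a b. (\<integral>x. indicator {a..b} x * k x \<partial>lborel) = 0"
    and tot0: "(\<integral>x. k x \<partial>lborel) = 0"
  shows "AE x in lborel. k x = 0"
proof (rule sigma_finite_measure.density_zero[OF sigma_finite_lborel k])
  have iA: "integrable lborel (\<lambda>x. indicator A x * k x)" if "A \<in> sets borel" for A
    using integrable_mult_indicator[OF _ k, of A] that by simp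
  fix A :: "real set" assume "A \<in> sets lborel"
  then have A: "A \<in> sigma_sets UNIV (range (\<lambda>(a, b). {a..b::real}))"
    by (simp add: borel_eq_atLeastAtMost)
  have stable: "Int_stable (range (\<lambda>(a, b). {a..b::real}))"
    by (auto simp: Int_stable_def)
  have sub: "range (\<lambda>(a, b). {a..b::real}) \<subseteq> Pow UNIV" by simp
  from A have "(\<integral>x. indicator A x * k x \<partial>lborel) = 0"
  proof (induction rule: sigma_sets_induct_disjoint[OF stable sub, consumes 1, case_names basic empty compl union])
    case (compl A)
    then have "A \<in> sets borel" by (simp add: borel_eq_atLeastAtMost)
    have "(\<integral>x. indicator (UNIV - A) x * k x \<partial>lborel) = (\<integral>x. k x - indicator A x * k x \<partial>lborel)"
      by (intro Bochner_Integration.integral_cong) (auto split: split_indicator)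
    then show ?case using compl iA[OF \<open>A \<in> sets borel\<close>] k tot0 by simp
  next
    case (union A)
    then have A: "A i \<in> sets lborel" for i by (auto simp: borel_eq_atLeastAtMost)
    have "(LINT x:(\<Union>i. A i)|lborel. k x) = (\<Sum>i. LINT x:A i|lborel. k x)"
    proof (rule lebesgue_integral_countable_add)
      show "set_integrable lborel (\<Union>i. A i) k"
        using A iA unfolding set_integrable_def by auto
    qed (use union A in \<open>auto simp: disjoint_family_on_def\<close>)
    then show ?case using union by (simp add: set_lebesgue_integral_def)
  qed (use int0 in auto)
  then show "set_lebesgue_integral lborel A k = 0" by (simp add: set_lebesgue_integral_def)
qed

lemma indicator_square_mult: "(indicat_real A x * c)\<^sup>2 = indicat_real A x * c\<^sup>2"
  by (simp split: split_indicator)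

lemma in_L2_iff:
  "in_L2 g \<longleftrightarrow> (\<lambda>x. indicat_real {0..pi} x * g x) \<in> borel_measurable lebesgue \<and>
     integrable lebesgue (\<lambda>x. (indicat_real {0..pi} x * g x)\<^sup>2)"
  by (simp add: in_L2_def set_borel_measurable_def set_integrable_def indicator_square_mult)

lemma L2_norm_eq:
  "L2_norm g = sqrt (\<integral>x. (indicat_real {0..pi} x * g x)\<^sup>2 \<partial>lebesgue)"
  by (simp add: L2_norm_def set_lebesgue_integral_def indicator_square_mult)

lemma L2_norm_nonneg: "L2_norm g \<ge> 0"
  by (simp add: L2_norm_eq)

lemma L2_inner:
  assumes "in_L2 f" "in_L2 g"
  shows "set_integrable lebesgue {0..pi} (\<lambda>x. f x * g x)"
    and "\<bar>LINT x:{0..pi}|lebesgue. f x * g x\<bar> \<le> L2_norm f * L2_norm g"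
proof -
  have *: "indicat_real {0..pi} x * f x * (indicat_real {0..pi} x * g x) = indicat_real {0..pi} x *\<^sub>R (f x * g x)" for x
    by (simp split: split_indicator)
  show "set_integrable lebesgue {0..pi} (\<lambda>x. f x * g x)"
    "\<bar>LINT x:{0..pi}|lebesgue. f x * g x\<bar> \<le> L2_norm f * L2_norm g"
    using Cauchy_Schwarz_integral[of "\<lambda>x. indicat_real {0..pi} x * f x" lebesgue
        "\<lambda>x. indicat_real {0..pi} x * g x"] assms
    unfolding in_L2_iff L2_norm_eq set_integrable_def set_lebesgue_integral_def * by auto
qed

lemma in_L2_cmult: "in_L2 g \<Longrightarrow> in_L2 (\<lambda>x. c * g x)"
  using integrable_mult_right[of "c\<^sup>2" lebesgue "\<lambda>x. (indicat_real {0..pi} x * g x)\<^sup>2"]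
    borel_measurable_times[of "\<lambda>x. c" lebesgue "\<lambda>x. indicat_real {0..pi} x * g x"]
  by (simp add: in_L2_iff power_mult_distrib mult.left_commute)

lemma L2_norm_cmult: "L2_norm (\<lambda>x. c * g x) = \<bar>c\<bar> * L2_norm g"
proof -
  have "(\<integral>x. (indicat_real {0..pi} x * (c * g x))\<^sup>2 \<partial>lebesgue) =
      (\<integral>x. c\<^sup>2 * (indicat_real {0..pi} x * g x)\<^sup>2 \<partial>lebesgue)"
    by (simp add: power_mult_distrib mult.left_commute)
  then show ?thesis by (simp add: L2_norm_eq real_sqrt_mult)
qed

text \<open>The inequality (a - b)^2 \<le> 2 a^2 + 2 b^2 replaces the triangle inequality; the lost
  constant is harmless, since the bound is applied to norms tending to 0.\<close>

lemma in_L2_diff: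
  assumes "in_L2 f" "in_L2 g"
  shows "in_L2 (\<lambda>x. f x - g x)"
    and "(L2_norm (\<lambda>x. f x - g x))\<^sup>2 \<le> 2 * (L2_norm f)\<^sup>2 + 2 * (L2_norm g)\<^sup>2"
proof -
  let ?f = "\<lambda>x. indicat_real {0..pi} x * f x" and ?g = "\<lambda>x. indicat_real {0..pi} x * g x"
  have eq: "indicat_real {0..pi} x * (f x - g x) = ?f x - ?g x" for x by (simp add: algebra_simps)
  have [measurable]: "?f \<in> borel_measurable lebesgue" "?g \<in> borel_measurable lebesgue"
    and i: "integrable lebesgue (\<lambda>x. (?f x)\<^sup>2)" "integrable lebesgue (\<lambda>x. (?g x)\<^sup>2)"
    using assms by (simp_all add: in_L2_iff)
  have b: "(?f x - ?g x)\<^sup>2 \<le> 2 * (?f x)\<^sup>2 + 2 * (?g x)\<^sup>2" for x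
    using sum_squares_ge_zero[of "?f x + ?g x" 0] by (simp add: power2_eq_square algebra_simps)
  have i2: "integrable lebesgue (\<lambda>x. 2 * (?f x)\<^sup>2 + 2 * (?g x)\<^sup>2)" using i by simp
  have i3: "integrable lebesgue (\<lambda>x. (?f x - ?g x)\<^sup>2)"
    by (rule Bochner_Integration.integrable_bound[OF i2]) (use b in auto)
  then show "in_L2 (\<lambda>x. f x - g x)" by (simp add: in_L2_iff eq)
  have "(\<integral>x. (?f x - ?g x)\<^sup>2 \<partial>lebesgue) \<le> (\<integral>x. 2 * (?f x)\<^sup>2 + 2 * (?g x)\<^sup>2 \<partial>lebesgue)"
    by (rule integral_mono[OF i3 i2 b])
  then show "(L2_norm (\<lambda>x. f x - g x))\<^sup>2 \<le> 2 * (L2_norm f)\<^sup>2 + 2 * (L2_norm g)\<^sup>2"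
    using i by (simp add: L2_norm_eq eq)
qed

lemma in_L2_continuous:
  assumes "continuous_on {0..pi} g"
  shows "in_L2 g"
proof -
  have "set_integrable lborel {0..pi} (\<lambda>x. (g x)\<^sup>2)"
    by (intro borel_integrable_atLeastAtMost' continuous_intros assms)
  moreover have "set_borel_measurable borel {0..pi} g"
    using assms by (intro set_measurable_continuous_on) auto
  ultimately show ?thesis
    unfolding in_L2_def set_borel_measurable_def set_integrable_def
    by (auto intro: measurable_completion simp: integrable_completion)
qed

lemma L2_norm_cong_AE:
  assumes "AE x in lebesgue. x \<in> {0..pi} \<longrightarrow> f x = g x" "in_L2 f" "in_L2 g"
  shows "L2_norm f = L2_norm g"
proof -
  have "AE x in lebesgue. (indicat_real {0..pi} x * f x)\<^sup>2 = (indicat_real {0..pi} x * g x)\<^sup>2"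
    using assms(1) by eventually_elim (auto split: split_indicator)
  then show ?thesis
    using assms(2,3) unfolding L2_norm_eq in_L2_iff
    by (subst integral_cong_AE) auto
qed

section \<open>Mollifiers from the smooth step\<close>

definition smooth_step :: "real \<Rightarrow> real" where
  "smooth_step = (SOME S. smooth S \<and> (\<forall>x\<le>0. S x = 0) \<and> (\<forall>x\<ge>1. S x = 1) \<and> mono S)"

lemma
  shows smooth_smooth_step: "smooth smooth_step"
    and smooth_step_eq_0: "x \<le> 0 \<Longrightarrow> smooth_step x = 0"
    and smooth_step_eq_1: "x \<ge> 1 \<Longrightarrow> smooth_step x = 1"
    and mono_smooth_step: "mono smooth_step"
  using someI_ex[OF smooth_step_exists] unfolding smooth_step_def[symmetric] by blast+

lemma smooth_step_bounds: "0 \<le> smooth_step x" "smooth_step x \<le> 1"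
  using monoD[OF mono_smooth_step, of 0 x] monoD[OF mono_smooth_step, of x 1]
    smooth_step_eq_0[of 0] smooth_step_eq_0[of x] smooth_step_eq_1[of 1] smooth_step_eq_1[of x]
  by (cases "x \<le> 0"; cases "x \<ge> 1"; simp)+

lemma smooth_affine:
  fixes f :: "real \<Rightarrow> real"
  shows "smooth f \<Longrightarrow> smooth (\<lambda>x. f ((x - p) / \<epsilon>))"
  using C_k_compose_affine[OF bounded_linear_divide[of \<epsilon>], of _ f "- p / \<epsilon>"]
  by (simp add: diff_divide_distrib)

text \<open>The derivative of the rescaled step: for \<epsilon> > 0 a one-sided approximate delta of
  mass 1, supported in [p, p + \<epsilon>].\<close>

definition bump :: "real \<Rightarrow> real \<Rightarrow> real \<Rightarrow> real" where
  "bump \<epsilon> p x = deriv smooth_step ((x - p) / \<epsilon>) / \<epsilon>"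

lemma smooth_step_has_deriv_bump:
  assumes "\<epsilon> > 0"
  shows "((\<lambda>x. smooth_step ((x - p) / \<epsilon>)) has_real_derivative bump \<epsilon> p x) (at x)"
proof -
  have "((\<lambda>x. (x - p) / \<epsilon>) has_real_derivative 1 / \<epsilon>) (at x)"
    using assms by (auto intro!: derivative_eq_intros)
  from DERIV_chain2[OF smooth_deriv(1)[OF smooth_smooth_step] this]
  show ?thesis by (simp add: bump_def)
qed

lemma smooth_bump: "smooth (bump \<epsilon> p)"
proof
  fix k
  have "C_k k (\<lambda>x. (1 / \<epsilon>) * deriv smooth_step ((x - p) / \<epsilon>))"
    using smooth_affine[OF smooth_deriv(2)[OF smooth_smooth_step]] by (intro C_k_mult C_k_const) simp
  then show "C_k k (bump \<epsilon> p)" by (simp add: bump_def[abs_def])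
qed

lemma bump_nonneg: "\<epsilon> > 0 \<Longrightarrow> bump \<epsilon> p x \<ge> 0"
  using mono_on_imp_deriv_nonneg[OF mono_imp_mono_on[OF mono_smooth_step, of UNIV]
      smooth_deriv(1)[OF smooth_smooth_step], of "(x - p) / \<epsilon>"]
  by (simp add: bump_def)

lemma bump_eq_0:
  assumes "\<epsilon> > 0" "x < p \<or> x > p + \<epsilon>"
  shows "bump \<epsilon> p x = 0"
proof -
  define y where "y = (x - p) / \<epsilon>"
  have y: "y < 0 \<or> y > 1" using assms by (auto simp: y_def field_simps)
  have "\<exists>c. \<forall>\<^sub>F z in nhds y. smooth_step z = c"
  proof (cases "y < 0")
    case True
    then show ?thesis
      using eventually_nhds_in_open[of "{..<0}" y]
      by (intro exI[of _ 0]) (auto elim!: eventually_mono simp: smooth_step_eq_0)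
  next
    case False
    then show ?thesis
      using eventually_nhds_in_open[of "{1<..}" y] y
      by (intro exI[of _ 1]) (auto elim!: eventually_mono simp: smooth_step_eq_1)
  qed
  then obtain c where "\<forall>\<^sub>F z in nhds y. smooth_step z = c" ..
  then have "deriv smooth_step y = deriv (\<lambda>_. c) y" by (intro deriv_cong_ev) auto
  then show ?thesis by (simp add: bump_def y_def)
qed

lemma bump_has_integral:
  assumes "\<epsilon> > 0"
  shows "has_bochner_integral lborel (bump \<epsilon> p) 1"
proof -
  have "has_bochner_integral lborel (\<lambda>x. bump \<epsilon> p x * indicator {p..p + \<epsilon>} x)
      (smooth_step ((p + \<epsilon> - p) / \<epsilon>) - smooth_step ((p - p) / \<epsilon>))"
    using assms smooth_continuous_on[OF smooth_bump, of UNIV \<epsilon> p]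
    by (intro has_bochner_integral_FTC_Icc_real smooth_step_has_deriv_bump)
      (auto simp: continuous_on_eq_continuous_at)
  moreover have "(\<lambda>x. bump \<epsilon> p x * indicator {p..p + \<epsilon>} x) = bump \<epsilon> p"
    using bump_eq_0[OF assms, of _ p] by (force simp: fun_eq_iff indicator_def)
  ultimately show ?thesis using assms by (simp add: smooth_step_eq_0 smooth_step_eq_1)
qed

section \<open>Weak derivatives\<close>

lemma test_functionI:
  assumes "smooth \<phi>" "compact K" "K \<subseteq> \<Omega>" "\<And>x. x \<notin> K \<Longrightarrow> \<phi> x = 0"
  shows "test_function \<Omega> \<phi>"
proof -
  have "closure {x. \<phi> x \<noteq> 0} \<subseteq> K"
    using assms by (intro closure_minimal compact_imp_closed) auto
  then show ?thesis
    using assms compact_Int_closed[of K "closure {x. \<phi> x \<noteq> 0}"]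
    by (auto simp: test_function_def Int_absorb1)
qed

text \<open>A smoothed indicator of [a, b]. Both ramps, [a, a + \<epsilon>] and [b, b + \<epsilon>],
  extend to the right, so the support reaches b + \<epsilon>. The derivative is a difference of two
  bumps, which localises weak identities at the end points.\<close>

definition plateau :: "real \<Rightarrow> real \<Rightarrow> real \<Rightarrow> real \<Rightarrow> real" where
  "plateau \<epsilon> a b x = smooth_step ((x - a) / \<epsilon>) - smooth_step ((x - b) / \<epsilon>)"

lemma smooth_plateau: "smooth (plateau \<epsilon> a b)"
  unfolding plateau_def[abs_def]
  using smooth_affine[OF smooth_smooth_step] C_k_diff by blast

lemma plateau_has_deriv:
  "\<epsilon> > 0 \<Longrightarrow> (plateau \<epsilon> a b has_real_derivative bump \<epsilon> a x - bump \<epsilon> b x) (at x)"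
  unfolding plateau_def[abs_def] by (intro DERIV_diff smooth_step_has_deriv_bump)

lemma plateau_bounds:
  assumes "\<epsilon> > 0" "a \<le> b"
  shows "0 \<le> plateau \<epsilon> a b x" "plateau \<epsilon> a b x \<le> 1"
proof -
  have "smooth_step ((x - b) / \<epsilon>) \<le> smooth_step ((x - a) / \<epsilon>)"
    using assms by (intro monoD[OF mono_smooth_step] divide_right_mono) auto
  then show "0 \<le> plateau \<epsilon> a b x" "plateau \<epsilon> a b x \<le> 1"
    using smooth_step_bounds(1)[of "(x - b) / \<epsilon>"] smooth_step_bounds(2)[of "(x - a) / \<epsilon>"]
    by (simp_all add: plateau_def)
qed

lemma plateau_eq_0:
  assumes "\<epsilon> > 0" "a \<le> b" "x \<le> a \<or> x \<ge> b + \<epsilon>"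
  shows "plateau \<epsilon> a b x = 0"
  using assms(3)
proof
  assume "x \<le> a"
  then have "(x - a) / \<epsilon> \<le> 0" "(x - b) / \<epsilon> \<le> 0"
    using assms by (auto simp: field_simps)
  then show ?thesis by (simp add: plateau_def smooth_step_eq_0)
next
  assume "x \<ge> b + \<epsilon>"
  then have "(x - a) / \<epsilon> \<ge> 1" "(x - b) / \<epsilon> \<ge> 1"
    using assms by (auto simp: field_simps)
  then show ?thesis by (simp add: plateau_def smooth_step_eq_1)
qed

lemma plateau_eq_1:
  assumes "\<epsilon> > 0" "a + \<epsilon> \<le> x" "x \<le> b"
  shows "plateau \<epsilon> a b x = 1"
proof -
  have "(x - a) / \<epsilon> \<ge> 1" "(x - b) / \<epsilon> \<le> 0"
    using assms by (auto simp: field_simps)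
  then show ?thesis by (simp add: plateau_def smooth_step_eq_0 smooth_step_eq_1)
qed

lemma test_function_plateau:
  assumes "\<epsilon> > 0" "l < a" "a \<le> b" "b + \<epsilon> < r"
  shows "test_function {l<..<r} (plateau \<epsilon> a b)"
proof (rule test_functionI)
  show "compact {a..b + \<epsilon>}" "{a..b + \<epsilon>} \<subseteq> {l<..<r}" using assms by auto
  fix x assume "x \<notin> {a..b + \<epsilon>}"
  then show "plateau \<epsilon> a b x = 0" using plateau_eq_0[of \<epsilon> a b x] assms by force
qed (rule smooth_plateau)

lemma borel_measurable_bump [measurable]: "bump \<epsilon> p \<in> borel_measurable borel"
  by (intro borel_measurable_continuous_onI smooth_continuous_on smooth_bump)

lemma bump_average:
  assumes e: "\<epsilon> > 0" and p: "0 \<le> p" "p + \<epsilon> \<le> pi" and g: "continuous_on {0..pi} g"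
    and close: "\<And>x. p \<le> x \<Longrightarrow> x \<le> p + \<epsilon> \<Longrightarrow> \<bar>g x - c\<bar> \<le> \<eta>"
  shows "\<bar>(LINT x:{0..pi}|lebesgue. g x * bump \<epsilon> p x) - c\<bar> \<le> \<eta>"
proof -
  let ?I = "\<lambda>x. indicator {0..pi} x *\<^sub>R (g x * bump \<epsilon> p x)"
  have int: "integrable lborel ?I"
    by (intro borel_integrable_compact continuous_intros g smooth_continuous_on smooth_bump) auto
  have b: "integrable lborel (bump \<epsilon> p)" "(\<integral>x. bump \<epsilon> p x \<partial>lborel) = 1"
    using bump_has_integral[OF e, of p] by (auto simp: has_bochner_integral_iff)
  have "(LINT x:{0..pi}|lebesgue. g x * bump \<epsilon> p x) = (\<integral>x. ?I x \<partial>lborel)"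
    unfolding set_lebesgue_integral_def using int by (intro integral_completion) auto
  then have eq: "(LINT x:{0..pi}|lebesgue. g x * bump \<epsilon> p x) - c = (\<integral>x. ?I x - c * bump \<epsilon> p x \<partial>lborel)"
    using int b by simp
  have "\<bar>\<integral>x. ?I x - c * bump \<epsilon> p x \<partial>lborel\<bar> \<le> (\<integral>x. \<bar>?I x - c * bump \<epsilon> p x\<bar> \<partial>lborel)"
    by (rule integral_abs_bound)
  also have "\<dots> \<le> (\<integral>x. \<eta> * bump \<epsilon> p x \<partial>lborel)"
  proof (rule integral_mono)
    fix x
    show "\<bar>?I x - c * bump \<epsilon> p x\<bar> \<le> \<eta> * bump \<epsilon> p x"
    proof (cases "p \<le> x \<and> x \<le> p + \<epsilon>")
      case True
      then have "indicat_real {0..pi} x = 1" using p by simp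
      then have "?I x - c * bump \<epsilon> p x = (g x - c) * bump \<epsilon> p x"
        by (simp only: left_diff_distrib) simp
      then show ?thesis
        using True close bump_nonneg[OF e, of p x] by (simp add: abs_mult mult_right_mono)
    next
      case False
      then show ?thesis using bump_eq_0[OF e, of x p] by auto
    qed
  qed (use int b in auto)
  also have "\<dots> = \<eta>" using b by simp
  finally show ?thesis unfolding eq .
qed

lemma lebesgue_indicator_Icc:
  shows "integrable lebesgue (indicat_real {a..b})"
    and "a \<le> b \<Longrightarrow> (\<integral>x. indicat_real {a..b} x \<partial>lebesgue) = b - a"
proof -
  have i: "integrable lborel (indicat_real {a..b})"
    by (rule integrable_real_indicator) (auto simp: emeasure_lborel_Icc_eq)
  show "integrable lebesgue (indicat_real {a..b})"
    using i by (subst integrable_completion) auto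
  show "(\<integral>x. indicat_real {a..b} x \<partial>lebesgue) = b - a" if "a \<le> b"
    using i that by (subst integral_completion) auto
qed

text \<open>Test against a plateau, whose derivative is the difference of two mollifiers.\<close>

lemma weak_deriv_increment:
  assumes wd: "has_weak_deriv g h" and h: "in_L2 h" and g: "continuous_on {0..pi} g"
    and ab: "0 \<le> a" "a \<le> b" "b \<le> pi"
  shows "\<bar>g b - g a\<bar> \<le> sqrt (b - a) * L2_norm h"
proof (cases "a = b")
  case True
  then show ?thesis by (simp add: L2_norm_nonneg)
next
  case False
  then have "a < b" using ab by simp
  show ?thesis
  proof (rule field_le_epsilon)
    fix \<eta> :: real assume "\<eta> > 0"
    then have e2: "\<eta> / 2 > 0" by simp
    obtain d1 where d1: "d1 > 0" "\<And>x. x \<in> {0..pi} \<Longrightarrow> dist x a < d1 \<Longrightarrow> dist (g x) (g a) < \<eta> / 2"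
      using g[unfolded continuous_on_iff] e2 ab by (metis atLeastAtMost_iff order_trans)
    obtain d2 where d2: "d2 > 0" "\<And>x. x \<in> {0..pi} \<Longrightarrow> dist x b < d2 \<Longrightarrow> dist (g x) (g b) < \<eta> / 2"
      using g[unfolded continuous_on_iff] e2 ab by (metis atLeastAtMost_iff order_trans)
    \<comment> \<open>The ramps of the plateau below are [a + \<epsilon>, a + 2\<epsilon>] and
      [b - 2\<epsilon>, b - \<epsilon>]. They lie strictly inside (0, pi) even for a = 0 or b = pi,
      within \<open>d1\<close> and \<open>d2\<close> of the end points, and in the right
      order.\<close>
    define \<epsilon> where "\<epsilon> = min (min d1 d2 / 3) ((b - a) / 4)"
    have e: "\<epsilon> > 0" "3 * \<epsilon> \<le> d1" "3 * \<epsilon> \<le> d2" "4 * \<epsilon> \<le> b - a"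
      using d1 d2 \<open>a < b\<close> by (auto simp: \<epsilon>_def min_def field_simps)
    define p q where "p = a + \<epsilon>" and "q = b - 2 * \<epsilon>"
    let ?\<phi> = "plateau \<epsilon> p q"
    have pq: "0 < p" "p \<le> q" "q + \<epsilon> < pi" using e ab by (auto simp: p_def q_def)
    have t: "test_function {0<..<pi} ?\<phi>" using e pq by (intro test_function_plateau)
    have der: "deriv ?\<phi> x = bump \<epsilon> p x - bump \<epsilon> q x" for x
      using plateau_has_deriv[OF e(1)] by (rule DERIV_imp_deriv)
    have si: "set_integrable lebesgue {0..pi} (\<lambda>x. g x * bump \<epsilon> r x)" for r
      by (intro L2_inner(1)[of g "bump \<epsilon> r"] in_L2_continuous g smooth_continuous_on smooth_bump)
    have L\<phi>: "in_L2 ?\<phi>"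
      by (intro in_L2_continuous smooth_continuous_on smooth_plateau)
    have "(LINT x:{0..pi}|lebesgue. g x * bump \<epsilon> p x) - (LINT x:{0..pi}|lebesgue. g x * bump \<epsilon> q x)
        = - (LINT x:{0..pi}|lebesgue. h x * ?\<phi> x)"
      using wd[unfolded has_weak_deriv_def, rule_format, OF t] set_integral_diff(2)[OF si[of p] si[of q]]
      by (simp add: der right_diff_distrib)
    moreover have "\<bar>LINT x:{0..pi}|lebesgue. h x * ?\<phi> x\<bar> \<le> L2_norm h * L2_norm ?\<phi>"
      by (rule L2_inner(2)[OF h L\<phi>])
    moreover have "L2_norm ?\<phi> \<le> sqrt (b - a)"
    proof -
      have "(\<integral>x. (indicat_real {0..pi} x * ?\<phi> x)\<^sup>2 \<partial>lebesgue) \<le> (\<integral>x. indicat_real {a..b} x \<partial>lebesgue)"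
      proof (rule integral_mono)
        show "integrable lebesgue (\<lambda>x. (indicat_real {0..pi} x * ?\<phi> x)\<^sup>2)"
          using L\<phi> by (simp add: in_L2_iff)
        show "integrable lebesgue (indicat_real {a..b})" by (rule lebesgue_indicator_Icc)
        fix x
        show "(indicat_real {0..pi} x * ?\<phi> x)\<^sup>2 \<le> indicat_real {a..b} x"
          using plateau_bounds[of \<epsilon> p q x] plateau_eq_0[of \<epsilon> p q x] e pq
          by (auto simp: indicator_def p_def q_def abs_square_le_1 not_le)
      qed
      also have "\<dots> = b - a" using \<open>a < b\<close> by (simp only: lebesgue_indicator_Icc(2) less_imp_le)
      finally show ?thesis by (simp add: L2_norm_eq)
    qed
    moreover have "\<bar>(LINT x:{0..pi}|lebesgue. g x * bump \<epsilon> p x) - g a\<bar> \<le> \<eta> / 2"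
    proof (intro bump_average g)
      fix x assume "p \<le> x" "x \<le> p + \<epsilon>"
      then show "\<bar>g x - g a\<bar> \<le> \<eta> / 2"
        using e pq ab d1(2)[of x] by (auto simp: p_def q_def dist_real_def abs_if split: if_splits)
    qed (use e pq in auto)
    moreover have "\<bar>(LINT x:{0..pi}|lebesgue. g x * bump \<epsilon> q x) - g b\<bar> \<le> \<eta> / 2"
    proof (intro bump_average g)
      fix x assume "q \<le> x" "x \<le> q + \<epsilon>"
      then show "\<bar>g x - g b\<bar> \<le> \<eta> / 2"
        using e pq ab d2(2)[of x] by (auto simp: p_def q_def dist_real_def abs_if split: if_splits)
    qed (use e pq in auto)
    moreover have "L2_norm h * L2_norm ?\<phi> \<le> sqrt (b - a) * L2_norm h"
      using \<open>L2_norm ?\<phi> \<le> sqrt (b - a)\<close> L2_norm_nonneg[of h]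
      by (metis mult.commute mult_left_mono)
    ultimately show "\<bar>g b - g a\<bar> \<le> sqrt (b - a) * L2_norm h + \<eta>" by linarith
  qed
qed

text \<open>The fundamental lemma of the calculus of variations: plateaus approximate indicators of
  intervals in L2, so \<open>k\<close> integrates to 0 over every interval. It serves to identify
  \<open>weak_deriv\<close>, an arbitrary choice, up to null sets.\<close>

lemma AE_eq_0_if_orthogonal_to_test_functions:
  assumes k: "in_L2 k"
    and orth: "\<And>\<phi>. test_function {0<..<pi} \<phi> \<Longrightarrow> (LINT x:{0..pi}|lebesgue. k x * \<phi> x) = 0"
  shows "AE x in lebesgue. x \<in> {0..pi} \<longrightarrow> k x = 0"
proof -
  define K where "K x = indicat_real {0..pi} x * k x" for x
  have intK: "integrable lebesgue K"
    using L2_inner(1)[OF k in_L2_continuous[of "\<lambda>x. 1"]]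
    by (simp add: K_def[abs_def] set_integrable_def)
  have int0: "(\<integral>x. indicator {a..b} x * K x \<partial>lebesgue) = 0" if ab: "0 \<le> a" "a < b" "b \<le> pi" for a b
  proof -
    have bnd: "\<bar>\<integral>x. indicator {a..b} x * K x \<partial>lebesgue\<bar> \<le> L2_norm k * sqrt (4 * \<epsilon>)"
      if e: "\<epsilon> > 0" "4 * \<epsilon> \<le> b - a" for \<epsilon>
    proof -
      define \<phi> where "\<phi> = plateau \<epsilon> (a + \<epsilon>) (b - 2 * \<epsilon>)"
      have "test_function {0<..<pi} \<phi>"
        using e ab unfolding \<phi>_def by (intro test_function_plateau) auto
      note 0 = orth[OF this]
      have L\<phi>: "in_L2 \<phi>"
        unfolding \<phi>_def by (intro in_L2_continuous smooth_continuous_on smooth_plateau)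
      have LI: "in_L2 (indicat_real {a..b})"
      proof -
        have *: "indicat_real {0..pi} x * indicat_real {a..b} x = indicat_real {a..b} x" for x
          using ab by (simp split: split_indicator)
        have "(indicat_real {a..b} x)\<^sup>2 = indicat_real {a..b} x" for x
          by (simp split: split_indicator)
        then show ?thesis
          unfolding in_L2_iff * using lebesgue_indicator_Icc(1)[of a b] by auto
      qed
      have eq: "(\<integral>x. indicator {a..b} x * K x \<partial>lebesgue) = (LINT x:{0..pi}|lebesgue. k x * indicat_real {a..b} x)"
        unfolding set_lebesgue_integral_def K_def
        by (intro Bochner_Integration.integral_cong) (auto split: split_indicator)
      also have "\<dots> = (LINT x:{0..pi}|lebesgue. k x * (indicat_real {a..b} x - \<phi> x))"
        using 0 set_integral_diff(2)[OF L2_inner(1)[OF k LI] L2_inner(1)[OF k L\<phi>]]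
        by (simp add: right_diff_distrib)
      finally have eq: "(\<integral>x. indicator {a..b} x * K x \<partial>lebesgue) =
          (LINT x:{0..pi}|lebesgue. k x * (indicat_real {a..b} x - \<phi> x))" .
      have "\<bar>LINT x:{0..pi}|lebesgue. k x * (indicat_real {a..b} x - \<phi> x)\<bar> \<le> L2_norm k * L2_norm (\<lambda>x. indicat_real {a..b} x - \<phi> x)"
        by (rule L2_inner(2)[OF k in_L2_diff(1)[OF LI L\<phi>]])
      also have "L2_norm (\<lambda>x. indicat_real {a..b} x - \<phi> x) \<le> sqrt (4 * \<epsilon>)"
      proof -
        \<comment> \<open>Indicator and plateau agree except on two end pieces of length
          2\<epsilon>, where they differ by at most 1; hence the bound sqrt (4\<epsilon>).\<close>
        let ?J = "\<lambda>x. indicat_real {a..a + 2 * \<epsilon>} x + indicat_real {b - 2 * \<epsilon>..b} x"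
        have "(\<integral>x. (indicat_real {0..pi} x * (indicat_real {a..b} x - \<phi> x))\<^sup>2 \<partial>lebesgue) \<le> (\<integral>x. ?J x \<partial>lebesgue)"
        proof (rule integral_mono)
          show "integrable lebesgue (\<lambda>x. (indicat_real {0..pi} x * (indicat_real {a..b} x - \<phi> x))\<^sup>2)"
            using in_L2_diff(1)[OF LI L\<phi>] by (simp add: in_L2_iff)
          show "integrable lebesgue ?J" by (intro Bochner_Integration.integrable_add lebesgue_indicator_Icc)
          fix x
          have *: "(c - d)\<^sup>2 \<le> 1" if "0 \<le> c" "c \<le> 1" "0 \<le> d" "d \<le> 1" for c d :: real
            using that by (simp add: abs_square_le_1)
          consider "x < a \<or> x > b" | "a + 2 * \<epsilon> \<le> x \<and> x \<le> b - 2 * \<epsilon>" | "x \<in> {a..a + 2 * \<epsilon>} \<union> {b - 2 * \<epsilon>..b}"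
            by fastforce
          then show "(indicat_real {0..pi} x * (indicat_real {a..b} x - \<phi> x))\<^sup>2 \<le> ?J x"
          proof cases
            case 1
            then have "\<phi> x = 0" unfolding \<phi>_def using e by (intro plateau_eq_0) auto
            with 1 show ?thesis by auto
          next
            case 2
            then have "\<phi> x = 1" unfolding \<phi>_def using e by (intro plateau_eq_1) auto
            with 2 e show ?thesis by auto
          next
            case 3
            have "0 \<le> \<phi> x" "\<phi> x \<le> 1"
              using plateau_bounds[of \<epsilon> "a + \<epsilon>" "b - 2 * \<epsilon>" x] e unfolding \<phi>_def by auto
            then have "(indicat_real {a..b} x - \<phi> x)\<^sup>2 \<le> 1" by (intro *) auto
            then have "(indicat_real {0..pi} x * (indicat_real {a..b} x - \<phi> x))\<^sup>2 \<le> 1"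
              by (simp split: split_indicator)
            also have "1 \<le> ?J x" using 3 by (auto simp: indicator_def)
            finally show ?thesis .
          qed
        qed
        also have "\<dots> = (\<integral>x. indicat_real {a..a + 2 * \<epsilon>} x \<partial>lebesgue) + (\<integral>x. indicat_real {b - 2 * \<epsilon>..b} x \<partial>lebesgue)"
          by (intro Bochner_Integration.integral_add lebesgue_indicator_Icc)
        also have "\<dots> = 4 * \<epsilon>"
          using lebesgue_indicator_Icc(2)[of a "a + 2 * \<epsilon>"] lebesgue_indicator_Icc(2)[of "b - 2 * \<epsilon>" b] e
          by simp
        finally show ?thesis by (simp add: L2_norm_eq)
      qed
      finally show ?thesis using L2_norm_nonneg[of k] unfolding eq by (simp add: mult_left_mono)
    qed
    have "((\<lambda>\<epsilon>. L2_norm k * sqrt (4 * \<epsilon>)) \<longlongrightarrow> L2_norm k * sqrt (4 * 0)) (at_right 0)"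
      by (intro tendsto_intros)
    moreover have "\<forall>\<^sub>F \<epsilon> in at_right 0. \<bar>\<integral>x. indicator {a..b} x * K x \<partial>lebesgue\<bar> \<le> L2_norm k * sqrt (4 * \<epsilon>)"
      using bnd ab by (auto simp: eventually_at_right_field intro!: exI[of _ "(b - a) / 4"])
    ultimately have "\<bar>\<integral>x. indicator {a..b} x * K x \<partial>lebesgue\<bar> \<le> L2_norm k * sqrt (4 * 0)"
      by (intro tendsto_lowerbound) auto
    then show ?thesis by simp
  qed
  have int0': "(\<integral>x. indicator {a..b} x * K x \<partial>lebesgue) = 0" for a b
  proof (cases "max 0 a < min pi b")
    case True
    have "(\<integral>x. indicator {a..b} x * K x \<partial>lebesgue) = (\<integral>x. indicator {max 0 a..min pi b} x * K x \<partial>lebesgue)"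
      by (intro Bochner_Integration.integral_cong) (auto simp: K_def split: split_indicator)
    then show ?thesis using int0[of "max 0 a" "min pi b"] True by simp
  next
    case False
    \<comment> \<open>Here {a..b} meets [0, pi] in at most one point.\<close>
    have "AE x in lebesgue. x \<noteq> max 0 a"
      by (intro AE_completion AE_lborel_singleton)
    then have "AE x in lebesgue. indicator {a..b} x * K x = 0"
      by eventually_elim (use False in \<open>auto simp: K_def split: split_indicator\<close>)
    then show ?thesis by (rule integral_eq_zero_AE)
  qed
  \<comment> \<open>\<open>K\<close> is only Lebesgue measurable, while the criterion by intervals
    concerns Borel measure, so a Borel representative takes its place.\<close>
  obtain K' where K' [measurable]: "K' \<in> borel_measurable lborel" and eq: "AE x in lborel. K x = K' x"
    using completion_ex_borel_measurable_real[of K lborel] intK by auto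
  have eqL: "AE x in lebesgue. K x = K' x" using eq by (rule AE_completion)
  have mL: "K' \<in> borel_measurable lebesgue" by (rule measurable_completion[OF K'])
  have "integrable lebesgue K'"
    using intK eqL mL by (subst integrable_cong_AE[symmetric, of K]) auto
  then have iK': "integrable lborel K'" using integrable_completion[OF K'] by simp
  have "AE x in lborel. K' x = 0"
  proof (rule AE_eq_0_if_interval_integrals_eq_0[OF iK'])
    have *: "(\<integral>x. indicator {a..b} x * K' x \<partial>lborel) = 0" for a b
    proof -
      have "(\<integral>x. indicator {a..b} x * K' x \<partial>lborel) = (\<integral>x. indicator {a..b} x * K' x \<partial>lebesgue)"
        by (intro integral_completion[symmetric]) measurable
      also have "\<dots> = (\<integral>x. indicator {a..b} x * K x \<partial>lebesgue)"
        using eqL mL intK borel_measurable_integrable[OF lebesgue_indicator_Icc(1)]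
        by (intro integral_cong_AE borel_measurable_times) auto
      finally show ?thesis using int0' by simp
    qed
    then show "(\<integral>x. indicator {a..b} x * K' x \<partial>lborel) = 0" for a b .
    have "(\<integral>x. K' x \<partial>lborel) = (\<integral>x. indicator {0..pi} x * K' x \<partial>lborel)"
      using eq by (intro integral_cong_AE) (auto simp: K_def split: split_indicator)
    then show "(\<integral>x. K' x \<partial>lborel) = 0" using * by simp
  qed
  then have "AE x in lebesgue. K' x = 0" by (rule AE_completion)
  with eqL show ?thesis by eventually_elim (auto simp: K_def)
qed

section \<open>The energy space and weak solutions of the wave equation\<close>

lemma test_function_real_L2:
  fixes \<phi> :: "real \<Rightarrow> real"
  assumes "test_function \<Omega> \<phi>"
  shows "in_L2 \<phi>" "in_L2 (deriv \<phi>)"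
proof -
  have "smooth \<phi>" using assms by (simp add: test_function_def)
  then show "in_L2 \<phi>" "in_L2 (deriv \<phi>)"
    using smooth_deriv(2) by (blast intro: in_L2_continuous smooth_continuous_on)+
qed

lemma has_weak_deriv_diff:
  assumes "has_weak_deriv g1 h1" "has_weak_deriv g2 h2"
    and L2: "in_L2 g1" "in_L2 h1" "in_L2 g2" "in_L2 h2"
  shows "has_weak_deriv (\<lambda>x. g1 x - g2 x) (\<lambda>x. h1 x - h2 x)"
  unfolding has_weak_deriv_def
proof (intro allI impI)
  fix \<phi> assume t: "test_function {0<..<pi} \<phi>"
  note L = test_function_real_L2[OF t]
  show "(LINT x:{0..pi}|lebesgue. (g1 x - g2 x) * deriv \<phi> x) = - (LINT x:{0..pi}|lebesgue. (h1 x - h2 x) * \<phi> x)"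
    using assms(1,2)[unfolded has_weak_deriv_def, rule_format, OF t]
      set_integral_diff(2)[OF L2_inner(1)[OF L2(1) L(2)] L2_inner(1)[OF L2(3) L(2)]]
      set_integral_diff(2)[OF L2_inner(1)[OF L2(2) L(1)] L2_inner(1)[OF L2(4) L(1)]]
    by (simp add: left_diff_distrib)
qed

lemma weak_deriv:
  assumes "in_H1 g"
  shows "in_L2 (weak_deriv g)" "has_weak_deriv g (weak_deriv g)"
  using assms someI_ex[of "\<lambda>h. in_L2 h \<and> has_weak_deriv g h"]
  unfolding in_H1_def weak_deriv_def by blast+

lemma in_H1_0_diff:
  assumes "in_H1_0 f" "in_H1_0 g"
  shows "in_H1_0 (\<lambda>x. f x - g x)"
proof -
  have "in_H1 (\<lambda>x. f x - g x)"
    using assms weak_deriv[of f] weak_deriv[of g] has_weak_deriv_diff in_L2_diff(1)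
    unfolding in_H1_0_def in_H1_def by metis
  then show ?thesis using assms by (auto simp: in_H1_0_def intro: continuous_intros)
qed

lemma L2_norm_weak_deriv_le_H1_norm: "L2_norm (weak_deriv g) \<le> H1_norm g"
  unfolding H1_norm_def by (rule real_le_rsqrt) simp

lemma H1_norm_nonneg: "H1_norm g \<ge> 0"
  by (simp add: H1_norm_def)

abbreviation bdist :: "real \<Rightarrow> real" where
  "bdist x \<equiv> min x (pi - x)"

lemma in_H1_0_increment:
  assumes "in_H1_0 u" "x \<in> {0..pi}" "y \<in> {0..pi}"
  shows "\<bar>u x - u y\<bar> \<le> sqrt \<bar>x - y\<bar> * H1_norm u"
proof -
  have *: "\<bar>u b - u a\<bar> \<le> sqrt (b - a) * H1_norm u" if "0 \<le> a" "a \<le> b" "b \<le> pi" for a b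
  proof -
    have "\<bar>u b - u a\<bar> \<le> sqrt (b - a) * L2_norm (weak_deriv u)"
      using assms(1) weak_deriv[of u] that by (intro weak_deriv_increment) (auto simp: in_H1_0_def)
    also have "\<dots> \<le> sqrt (b - a) * H1_norm u"
      using that by (intro mult_left_mono L2_norm_weak_deriv_le_H1_norm) simp
    finally show ?thesis .
  qed
  show ?thesis
    using *[of x y] *[of y x] assms by (cases "x \<le> y") (auto simp: abs_minus_commute)
qed

text \<open>The one-dimensional Morrey inequality, applied against each of the two boundary points,
  where u vanishes.\<close>

lemma in_H1_0_bound:
  assumes "in_H1_0 u" "x \<in> {0..pi}"
  shows "\<bar>u x\<bar> \<le> H1_norm u * sqrt (bdist x)"
proof -
  have "u 0 = 0" "u pi = 0" using assms by (auto simp: in_H1_0_def)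
  then have "\<bar>u x\<bar> \<le> sqrt x * H1_norm u" "\<bar>u x\<bar> \<le> sqrt (pi - x) * H1_norm u"
    using in_H1_0_increment[OF assms(1), of x 0] in_H1_0_increment[OF assms(1), of x pi] assms(2)
    by auto
  then show ?thesis by (auto simp: min_def mult.commute)
qed

text \<open>Coarse, but 4 has the exact root 2 for the joint continuity estimate.\<close>

lemma bdist_le_pi: "x \<in> {0..pi} \<Longrightarrow> bdist x \<le> 4"
  using pi_less_4 by (auto simp: min_def)

lemma continuous_into_H1_0_near:
  assumes u: "continuous_into_H1_0 u" and "e > 0"
  shows "\<forall>\<^sub>F s in nhds t. \<forall>x\<in>{0..pi}. \<bar>u s x - u t x\<bar> \<le> e * sqrt (bdist x)"
proof -
  have lim: "((\<lambda>s. H1_norm (\<lambda>x. u s x - u t x)) \<longlongrightarrow> 0) (at t)"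
    using u by (auto simp: continuous_into_H1_0_def)
  have "\<forall>\<^sub>F s in at t. H1_norm (\<lambda>x. u s x - u t x) < e"
    using order_tendstoD(2)[OF lim] \<open>e > 0\<close> by blast
  then have "\<forall>\<^sub>F s in at t. \<forall>x\<in>{0..pi}. \<bar>u s x - u t x\<bar> \<le> e * sqrt (bdist x)"
  proof eventually_elim
    case (elim s)
    show ?case
    proof
      fix x assume x: "x \<in> {0..pi}"
      have "in_H1_0 (\<lambda>x. u s x - u t x)"
        using u in_H1_0_diff by (auto simp: continuous_into_H1_0_def)
      from in_H1_0_bound[OF this x]
      have "\<bar>u s x - u t x\<bar> \<le> H1_norm (\<lambda>x. u s x - u t x) * sqrt (bdist x)" .
      also have "\<dots> \<le> e * sqrt (bdist x)" using elim x by (intro mult_right_mono) auto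
      finally show "\<bar>u s x - u t x\<bar> \<le> e * sqrt (bdist x)" .
    qed
  qed
  then show ?thesis
    using \<open>e > 0\<close> by (subst eventually_nhds_conv_at) auto
qed

text \<open>The modulus in time is uniform in x by the weighted pointwise bound, and each
  \<open>u t\<close> is continuous in x; the triangle inequality joins the two.\<close>

lemma continuous_into_H1_0_jointly:
  assumes u: "continuous_into_H1_0 u"
  shows "continuous_on (UNIV \<times> {0..pi}) (\<lambda>z. u (fst z) (snd z))"
  unfolding continuous_on_iff
proof (intro ballI allI impI)
  fix z :: "real \<times> real" and e :: real assume z: "z \<in> UNIV \<times> {0..pi}" and "e > 0"
  obtain t y where ty: "z = (t, y)" by (cases z)
  obtain d1 where d1: "d1 > 0" "\<And>s x. dist s t < d1 \<Longrightarrow> x \<in> {0..pi} \<Longrightarrow> \<bar>u s x - u t x\<bar> \<le> (e / 6) * sqrt (bdist x)"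
    using continuous_into_H1_0_near[OF u, of "e / 6" t] \<open>e > 0\<close> by (auto simp: eventually_nhds_metric)
  have "continuous_on {0..pi} (u t)" using u by (auto simp: continuous_into_H1_0_def in_H1_0_def)
  then obtain d2 where d2: "d2 > 0" "\<And>x. x \<in> {0..pi} \<Longrightarrow> dist x y < d2 \<Longrightarrow> dist (u t x) (u t y) < e / 2"
    using z \<open>e > 0\<close> unfolding continuous_on_iff ty by (metis mem_Sigma_iff half_gt_zero)
  show "\<exists>d>0. \<forall>z'\<in>UNIV \<times> {0..pi}. dist z' z < d \<longrightarrow> dist (u (fst z') (snd z')) (u (fst z) (snd z)) < e"
  proof (intro exI[of _ "min d1 d2"] conjI ballI impI)
    fix z' :: "real \<times> real" assume z': "z' \<in> UNIV \<times> {0..pi}" "dist z' z < min d1 d2"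
    obtain s x where sx: "z' = (s, x)" by (cases z')
    have "dist s t \<le> dist z' z" "dist x y \<le> dist z' z"
      unfolding sx ty using dist_fst_le[of "(s,x)" "(t,y)"] dist_snd_le[of "(s,x)" "(t,y)"] by simp_all
    then have d: "dist s t < d1" "dist x y < d2" using z' by auto
    have x: "x \<in> {0..pi}" using z' sx by auto
    have "sqrt (bdist x) \<le> sqrt 4" using bdist_le_pi[OF x] by (rule real_sqrt_le_mono)
    then have "(e / 6) * sqrt (bdist x) \<le> (e / 6) * 2" using \<open>e > 0\<close> by (intro mult_left_mono) auto
    then have "\<bar>u s x - u t x\<bar> \<le> e / 3" using d1(2)[OF d(1) x] by simp
    then show "dist (u (fst z') (snd z')) (u (fst z) (snd z)) < e"
      using d2(2)[OF x d(2)] \<open>e > 0\<close> unfolding sx ty dist_real_def fst_conv snd_conv by linarith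
  qed (use d1 d2 in auto)
qed

text \<open>The weighted bound holds near each time, and finitely many neighbourhoods cover {a..b};
  the sum of their constants serves for all of them.\<close>

lemma continuous_into_H1_0_bounded:
  assumes u: "continuous_into_H1_0 u"
  shows "\<exists>B\<ge>0. \<forall>t\<in>{a..b}. \<forall>x\<in>{0..pi}. \<bar>u t x\<bar> \<le> B * sqrt (bdist x)"
proof -
  have "\<exists>U B. open U \<and> t \<in> U \<and> B \<ge> 0 \<and> (\<forall>s\<in>U. \<forall>x\<in>{0..pi}. \<bar>u s x\<bar> \<le> B * sqrt (bdist x))" for t
  proof -
    from continuous_into_H1_0_near[OF u, of 1 t] obtain U where U: "open U" "t \<in> U"
      "\<And>s x. s \<in> U \<Longrightarrow> x \<in> {0..pi} \<Longrightarrow> \<bar>u s x - u t x\<bar> \<le> 1 * sqrt (bdist x)"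
      by (auto simp: eventually_nhds)
    have "\<bar>u s x\<bar> \<le> (1 + H1_norm (u t)) * sqrt (bdist x)" if "s \<in> U" "x \<in> {0..pi}" for s x
      using U(3)[OF that] in_H1_0_bound[of "u t", OF _ that(2)] u
      by (auto simp: continuous_into_H1_0_def algebra_simps)
    then show ?thesis
      using U H1_norm_nonneg[of "u t"] by (intro exI[of _ U] exI[of _ "1 + H1_norm (u t)"]) auto
  qed
  then obtain U B where UB: "\<And>t. open (U t)" "\<And>t. t \<in> U t" "\<And>t. B t \<ge> 0"
    "\<And>t s x. s \<in> U t \<Longrightarrow> x \<in> {0..pi} \<Longrightarrow> \<bar>u s x\<bar> \<le> B t * sqrt (bdist x)"
    by metis
  have "{a..b} \<subseteq> (\<Union>t\<in>{a..b}. U t)" using UB(2) by auto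
  then obtain C where C: "C \<subseteq> {a..b}" "finite C" "{a..b} \<subseteq> (\<Union>t\<in>C. U t)"
    using compactE_image[of "{a..b}" "{a..b}" U] UB(1) by (metis compact_Icc)
  show ?thesis
  proof (intro exI[of _ "\<Sum>t\<in>C. B t"] conjI ballI)
    show "(\<Sum>t\<in>C. B t) \<ge> 0" using UB(3) by (simp add: sum_nonneg)
    fix s x assume "s \<in> {a..b}" and x: "x \<in> {0..pi}"
    then obtain t where t: "t \<in> C" "s \<in> U t" using C by auto
    have "B t \<le> (\<Sum>t\<in>C. B t)" using t C UB(3) by (intro member_le_sum) auto
    then have "B t * sqrt (bdist x) \<le> (\<Sum>t\<in>C. B t) * sqrt (bdist x)"
      using x by (intro mult_right_mono) auto
    then show "\<bar>u s x\<bar> \<le> (\<Sum>t\<in>C. B t) * sqrt (bdist x)"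
      using UB(4)[OF t(2) x] by linarith
  qed
qed

text \<open>The two difference quotients at time 0 have the same initial position subtracted and
  converge to the same velocity, up to null sets, so their difference (u1 - u2) / s tends to 0. This
  o(s) is what the temporal cutoff consumes.\<close>

lemma energy_solutions_diff_small:
  assumes u1: "energy_solution u1 f0 f1" and u2: "energy_solution u2 f0 f1"
  shows "((\<lambda>s. L2_norm (\<lambda>x. u1 s x - u2 s x) / \<bar>s\<bar>) \<longlongrightarrow> 0) (at 0)"
proof -
  from u1 obtain v1 where v1: "has_time_deriv_L2 u1 v1" "continuous_into_L2 v1"
    "AE x in lebesgue. x \<in> {0..pi} \<longrightarrow> v1 0 x = f1 x"
    and c1: "continuous_into_H1_0 u1" and 1: "\<forall>x\<in>{0..pi}. u1 0 x = f0 x"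
    by (auto simp: energy_solution_def)
  from u2 obtain v2 where v2: "has_time_deriv_L2 u2 v2" "continuous_into_L2 v2"
    "AE x in lebesgue. x \<in> {0..pi} \<longrightarrow> v2 0 x = f1 x"
    and c2: "continuous_into_H1_0 u2" and 2: "\<forall>x\<in>{0..pi}. u2 0 x = f0 x"
    by (auto simp: energy_solution_def)
  have L: "in_L2 (u1 s)" "in_L2 (u2 s)" "in_L2 (v1 s)" "in_L2 (v2 s)" for s
    using c1 c2 v1 v2
    by (auto simp: continuous_into_H1_0_def continuous_into_L2_def in_H1_0_def in_H1_def)
  define A B where "A s x = (u1 s x - u1 0 x) / (s - 0) - v1 0 x"
    and "B s x = (u2 s x - u2 0 x) / (s - 0) - v2 0 x" for s x
  have LA: "in_L2 (A s)" for s
    using in_L2_diff(1)[OF in_L2_cmult[OF in_L2_diff(1)[OF L(1)[of s] L(1)[of 0]], of "1 / s"] L(3)[of 0]]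
    by (simp add: A_def[abs_def])
  have LB: "in_L2 (B s)" for s
    using in_L2_diff(1)[OF in_L2_cmult[OF in_L2_diff(1)[OF L(2)[of s] L(2)[of 0]], of "1 / s"] L(4)[of 0]]
    by (simp add: B_def[abs_def])
  have ae: "AE x in lebesgue. x \<in> {0..pi} \<longrightarrow> (1 / s) * (u1 s x - u2 s x) = A s x - B s x" for s
    using v1(3) v2(3) by eventually_elim (use 1 2 in \<open>auto simp: A_def B_def diff_divide_distrib\<close>)
  have "L2_norm (\<lambda>x. (1 / s) * (u1 s x - u2 s x)) = L2_norm (\<lambda>x. A s x - B s x)" for s
    by (intro L2_norm_cong_AE ae in_L2_cmult in_L2_diff(1) L LA LB)
  then have eq: "L2_norm (\<lambda>x. u1 s x - u2 s x) / \<bar>s\<bar> = L2_norm (\<lambda>x. A s x - B s x)" for s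
    unfolding L2_norm_cmult by (simp add: field_simps)
  have "((\<lambda>s. sqrt (2 * (L2_norm (A s))\<^sup>2 + 2 * (L2_norm (B s))\<^sup>2)) \<longlongrightarrow> sqrt (2 * 0\<^sup>2 + 2 * 0\<^sup>2)) (at 0)"
    using v1(1) v2(1) unfolding has_time_deriv_L2_def A_def[abs_def] B_def[abs_def]
    by (intro tendsto_intros) blast+
  then have lim: "((\<lambda>s. sqrt (2 * (L2_norm (A s))\<^sup>2 + 2 * (L2_norm (B s))\<^sup>2)) \<longlongrightarrow> 0) (at 0)" by simp
  have le: "L2_norm (\<lambda>x. A s x - B s x) \<le> sqrt (2 * (L2_norm (A s))\<^sup>2 + 2 * (L2_norm (B s))\<^sup>2)" for s
    by (rule real_le_rsqrt[OF in_L2_diff(2)[OF LA LB]])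
  show ?thesis
    unfolding eq by (rule tendsto_sandwich[OF _ _ tendsto_const lim]) (simp_all add: le L2_norm_nonneg)
qed

section \<open>The weak wave equation as a linear relation over Borel measure\<close>

definition weak_wave :: "(real \<times> real \<Rightarrow> real) \<Rightarrow> (real \<times> real \<Rightarrow> real) \<Rightarrow> bool" where
  "weak_wave w F \<longleftrightarrow>
     (\<forall>\<phi>. test_function strip \<phi> \<longrightarrow>
        (\<integral>z. indicator strip z * (w z * (d_space (d_space \<phi>) z - d_time (d_time \<phi>) z)) \<partial>lborel) =
        (\<integral>z. indicator strip z * (F z * \<phi> z) \<partial>lborel))"

lemma open_strip: "open strip"
  by (intro open_Times) auto

text \<open>\<open>h\<close> may be singular at the boundary of the strip; the support of \<psi> is
  a compact subset of the open strip, on which \<open>h\<close> is bounded.\<close>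

lemma strip_integrable:
  fixes h \<psi> :: "real \<times> real \<Rightarrow> real"
  assumes h: "continuous_on strip h" and \<psi>: "continuous_on UNIV \<psi>"
    and K: "compact K" "K \<subseteq> strip" "\<And>z. z \<notin> K \<Longrightarrow> \<psi> z = 0"
  shows "integrable lborel (\<lambda>z. indicator strip z * (h z * \<psi> z))"
proof -
  have eq: "indicator strip z * (h z * \<psi> z) = indicator K z *\<^sub>R (h z * \<psi> z)" for z
    using K(2,3) by (cases "z \<in> K") (auto simp: indicator_def)
  show ?thesis
    unfolding eq
    by (intro borel_integrable_compact K(1) continuous_on_mult
        continuous_on_subset[OF h K(2)] continuous_on_subset[OF \<psi>]) simp
qed

lemma test_function_integrands:
  assumes t: "test_function strip \<phi>" and h: "continuous_on strip h"
  shows "integrable lborel (\<lambda>z. indicator strip z * (h z * (d_space (d_space \<phi>) z - d_time (d_time \<phi>) z)))"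
    and "integrable lborel (\<lambda>z. indicator strip z * (h z * \<phi> z))"
proof -
  let ?K = "closure {x. \<phi> x \<noteq> 0}"
  have sm: "smooth \<phi>" and K: "compact ?K" "?K \<subseteq> strip" using t by (auto simp: test_function_def)
  have zt: "d_time \<phi> z = 0" "d_space \<phi> z = 0" if "z \<notin> ?K" for z
    using d_time_eq_0_outside_support d_space_eq_0_outside_support that by blast+
  \<comment> \<open>The second derivatives are known to vanish off the closed support of the first
    ones, so that support has to be placed inside \<open>?K\<close>.\<close>
  have sub: "closure {x. d_time \<phi> x \<noteq> 0} \<subseteq> ?K" "closure {x. d_space \<phi> x \<noteq> 0} \<subseteq> ?K"
    by (intro closure_minimal; use zt in blast)+
  have z2: "d_space (d_space \<phi>) z - d_time (d_time \<phi>) z = 0" if "z \<notin> ?K" for z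
  proof -
    have "z \<notin> closure {x. d_time \<phi> x \<noteq> 0}" "z \<notin> closure {x. d_space \<phi> x \<noteq> 0}"
      using that sub by blast+
    then show ?thesis
      by (simp add: d_time_eq_0_outside_support d_space_eq_0_outside_support)
  qed
  have z0: "\<phi> z = 0" if "z \<notin> ?K" for z
    using that closure_subset[of "{x. \<phi> x \<noteq> 0}"] by auto
  have c: "continuous_on UNIV (\<lambda>z. d_space (d_space \<phi>) z - d_time (d_time \<phi>) z)"
    by (intro continuous_on_diff smooth_continuous_on smooth_d_time(2) smooth_d_space(2) sm)
  show "integrable lborel (\<lambda>z. indicator strip z * (h z * (d_space (d_space \<phi>) z - d_time (d_time \<phi>) z)))"
    by (rule strip_integrable[OF h c K z2])
  show "integrable lborel (\<lambda>z. indicator strip z * (h z * \<phi> z))"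
    by (rule strip_integrable[OF h smooth_continuous_on[OF sm] K z0])
qed

text \<open>The integrands are Borel measurable, so both measures give the same integral. With the
  source detached from the unknown, the relation is linear and passes to the difference of two
  solutions of the cubic equation.\<close>

lemma distributional_solution_lborel:
  assumes c: "continuous_on (UNIV \<times> {0..pi}) (\<lambda>z. f (fst z) (snd z))"
  shows "distributional_solution f \<longleftrightarrow>
    weak_wave (\<lambda>z. f (fst z) (snd z)) (\<lambda>z. (f (fst z) (snd z)) ^ 3 / (sin (snd z))\<^sup>2)"
proof -
  have cw: "continuous_on strip (\<lambda>z. f (fst z) (snd z))"
    by (rule continuous_on_subset[OF c]) auto
  have cF: "continuous_on strip (\<lambda>z. (f (fst z) (snd z)) ^ 3 / (sin (snd z))\<^sup>2)"
    by (intro continuous_intros cw) (use sin_gt_zero in force)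
  have 1: "(LINT z:strip|lebesgue. f (fst z) (snd z) * (- d_time (d_time \<phi>) z + d_space (d_space \<phi>) z)) =
      (\<integral>z. indicator strip z * (f (fst z) (snd z) * (d_space (d_space \<phi>) z - d_time (d_time \<phi>) z)) \<partial>lborel)"
    if "test_function strip \<phi>" for \<phi>
    using borel_measurable_integrable[OF test_function_integrands(1)[OF that cw]]
    unfolding set_lebesgue_integral_def by (subst integral_completion[symmetric]) simp_all
  have 2: "(LINT z:strip|lebesgue. (f (fst z) (snd z)) ^ 3 / (sin (snd z))\<^sup>2 * \<phi> z) =
      (\<integral>z. indicator strip z * ((f (fst z) (snd z)) ^ 3 / (sin (snd z))\<^sup>2 * \<phi> z) \<partial>lborel)"
    if "test_function strip \<phi>" for \<phi>
    using borel_measurable_integrable[OF test_function_integrands(2)[OF that cF]]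
    unfolding set_lebesgue_integral_def by (subst integral_completion[symmetric]) simp_all
  show ?thesis
    unfolding distributional_solution_def weak_wave_def using 1 2 by auto
qed

lemma weak_wave_diff:
  assumes w: "weak_wave w1 F1" "weak_wave w2 F2"
    and c: "continuous_on strip w1" "continuous_on strip w2" "continuous_on strip F1" "continuous_on strip F2"
  shows "weak_wave (\<lambda>z. w1 z - w2 z) (\<lambda>z. F1 z - F2 z)"
  unfolding weak_wave_def
proof (intro allI impI)
  fix \<phi> assume t: "test_function strip \<phi>"
  show "(\<integral>z. indicator strip z * ((w1 z - w2 z) * (d_space (d_space \<phi>) z - d_time (d_time \<phi>) z)) \<partial>lborel) =
        (\<integral>z. indicator strip z * ((F1 z - F2 z) * \<phi> z) \<partial>lborel)"
    using w[unfolded weak_wave_def, rule_format, OF t]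
      Bochner_Integration.integral_diff[OF test_function_integrands(1)[OF t c(1)] test_function_integrands(1)[OF t c(2)]]
      Bochner_Integration.integral_diff[OF test_function_integrands(2)[OF t c(3)] test_function_integrands(2)[OF t c(4)]]
    by (simp only: left_diff_distrib right_diff_distrib[of "indicator _ _"])
qed

lemma lborel_reflect_time:
  fixes h :: "real \<times> real \<Rightarrow> real"
  assumes [measurable]: "h \<in> borel_measurable borel"
  shows "(\<integral>z. h (- fst z, snd z) \<partial>lborel) = (\<integral>z. h z \<partial>lborel)"
proof -
  let ?R = "\<lambda>z::real \<times> real. (- fst z, snd z)"
  \<comment> \<open>The diagonal of the reflection: \<open>c\<close> is -1 on the basis vector (1,
    0) and 1 on (0, 1).\<close>
  define c :: "real \<times> real \<Rightarrow> real" where "c j = snd j - fst j" for j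
  have R: "?R = (\<lambda>x. 0 + (\<Sum>j\<in>Basis. (c j * (x \<bullet> j)) *\<^sub>R j))"
    by (auto simp: fun_eq_iff Basis_prod_def c_def sum.union_disjoint[of "(\<lambda>u. (u, 0)) ` Basis" "Pair 0 ` Basis"])
  have "lborel = density (distr lborel borel ?R) (\<lambda>_. (\<Prod>j\<in>Basis. \<bar>c j\<bar>))"
    unfolding R by (rule lborel_affine_euclidean) (auto simp: Basis_prod_def c_def)
  also have "(\<Prod>j\<in>Basis. \<bar>c j\<bar>) = 1"
    by (rule prod.neutral) (auto simp: Basis_prod_def c_def)
  finally have eq: "lborel = distr lborel borel ?R" by (simp add: density_1)
  have "(\<integral>z. h z \<partial>lborel) = (\<integral>z. h z \<partial>distr lborel borel ?R)" by (subst eq) simp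
  also have "\<dots> = (\<integral>z. h (?R z) \<partial>lborel)"
    by (intro integral_distr) (auto intro!: borel_measurable_continuous_onI continuous_intros)
  finally show ?thesis ..
qed

text \<open>The operator contains a second time derivative only, so the two signs cancel, and the
  strip is symmetric in time. Uniqueness at negative times is obtained from positive times in this
  way.\<close>

lemma weak_wave_reflect:
  assumes w: "weak_wave w F" and c: "continuous_on strip w" "continuous_on strip F"
  shows "weak_wave (\<lambda>z. w (- fst z, snd z)) (\<lambda>z. F (- fst z, snd z))"
  unfolding weak_wave_def
proof (intro allI impI)
  let ?R = "\<lambda>z::real \<times> real. (- fst z, snd z)"
  fix \<phi> assume t: "test_function strip \<phi>"
  then have sm: "smooth \<phi>" by (simp add: test_function_def)
  define \<psi> where "\<psi> z = \<phi> (?R z)" for z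
  have bl: "bounded_linear ?R"
    by (intro bounded_linear_Pair bounded_linear_minus bounded_linear_fst bounded_linear_snd)
  have sm': "smooth \<psi>"
    using C_k_compose_affine[OF bl, of _ \<phi> 0] sm by (simp add: \<psi>_def[abs_def])
  let ?K = "closure {x. \<phi> x \<noteq> 0}"
  have t': "test_function strip \<psi>"
  proof (rule test_functionI[OF sm'])
    show "compact (?R ` ?K)"
      using t by (intro compact_continuous_image linear_continuous_on bl) (auto simp: test_function_def)
    show "?R ` ?K \<subseteq> strip" using t by (auto simp: test_function_def)
    fix x assume x: "x \<notin> ?R ` ?K"
    have "?R x \<notin> ?K"
      using x by (metis (no_types, lifting) fst_conv imageI minus_minus prod.collapse snd_conv)
    then show "\<psi> x = 0" using closure_subset[of "{x. \<phi> x \<noteq> 0}"] by (auto simp: \<psi>_def)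
  qed
  have t1: "d_time (\<lambda>z. h (?R z)) z = - d_time h (?R z)" if "smooth h" for h z
  proof -
    have "((\<lambda>s. h (- s, snd z)) has_real_derivative (d_time h (- fst z, snd z) * (- 1))) (at (fst z))"
      by (rule DERIV_chain2[OF smooth_d_time(1)[OF that]]) (auto intro!: derivative_eq_intros)
    from DERIV_imp_deriv[OF this] show ?thesis by (simp add: d_time_def split_beta)
  qed
  have "d_time \<psi> = (\<lambda>z. - d_time \<phi> (?R z))"
    unfolding \<psi>_def[abs_def] by (rule ext) (rule t1[OF sm])
  moreover have "smooth (\<lambda>z. - d_time \<phi> z)"
    using C_k_mult[OF C_k_const[of _ "-1"], of _ "d_time \<phi>"] smooth_d_time(2)[OF sm] by simp
  moreover have "d_time (\<lambda>z. - d_time \<phi> z) z = - d_time (d_time \<phi>) z" for z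
  proof -
    have "((\<lambda>s. - d_time \<phi> (s, snd z)) has_real_derivative - d_time (d_time \<phi>) (fst z, snd z)) (at (fst z))"
      by (intro DERIV_minus smooth_d_time(1) smooth_d_time(2) sm)
    from DERIV_imp_deriv[OF this] show ?thesis by (simp add: d_time_def split_beta)
  qed
  ultimately have tt: "d_time (d_time \<psi>) z = d_time (d_time \<phi>) (?R z)" for z
    using t1[of "\<lambda>z. - d_time \<phi> z"] by simp
  have "d_space \<psi> = (\<lambda>z. d_space \<phi> (?R z))"
    by (simp add: fun_eq_iff d_space_def \<psi>_def[abs_def] split_beta)
  then have xx: "d_space (d_space \<psi>) z = d_space (d_space \<phi>) (?R z)" for z
    by (simp add: d_space_def split_beta)
  have R2: "?R (?R z) = z" "indicator strip (?R z) = indicator strip z" for z :: "real \<times> real"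
    by (cases z; auto simp: indicator_def)+
  have "(\<integral>z. indicator strip z * (w (?R z) * (d_space (d_space \<phi>) z - d_time (d_time \<phi>) z)) \<partial>lborel) =
    (\<integral>z. indicator strip (?R z) * (w (?R z) * (d_space (d_space \<psi>) (?R z) - d_time (d_time \<psi>) (?R z))) \<partial>lborel)"
    by (simp add: tt xx R2)
  also have "\<dots> = (\<integral>z. indicator strip z * (w z * (d_space (d_space \<psi>) z - d_time (d_time \<psi>) z)) \<partial>lborel)"
    using borel_measurable_integrable[OF test_function_integrands(1)[OF t' c(1)]]
    by (intro lborel_reflect_time) simp
  also have "\<dots> = (\<integral>z. indicator strip z * (F z * \<psi> z) \<partial>lborel)"
    using w t' unfolding weak_wave_def by blast
  also have "\<dots> = (\<integral>z. indicator strip (?R z) * (F (?R z) * \<psi> (?R z)) \<partial>lborel)"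
    using borel_measurable_integrable[OF test_function_integrands(2)[OF t' c(2)]]
    by (intro lborel_reflect_time[symmetric]) simp
  also have "\<dots> = (\<integral>z. indicator strip z * (F (?R z) * \<phi> z) \<partial>lborel)"
    by (simp add: R2 \<psi>_def)
  finally show "(\<integral>z. indicator strip z * (w (?R z) * (d_space (d_space \<phi>) z - d_time (d_time \<phi>) z)) \<partial>lborel) =
    (\<integral>z. indicator strip z * (F (?R z) * \<phi> z) \<partial>lborel)" .
qed

section \<open>Truncation at the initial time\<close>

text \<open>The cutoff has first derivative O(1/\<epsilon>) and second derivative O(1/\<epsilon>^2);
  for \<epsilon> \<le> 1 the larger rate covers both, so one constant suffices.\<close>

lemma bump_cutoff_bounds:
  "\<exists>C\<ge>0. \<forall>\<epsilon> t. 0 < \<epsilon> \<and> \<epsilon> \<le> 1 \<longrightarrow> \<bar>bump \<epsilon> 0 t\<bar> \<le> C / \<epsilon>\<^sup>2 * indicator {0..\<epsilon>} t \<and>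
     \<bar>deriv (bump \<epsilon> 0) t\<bar> \<le> C / \<epsilon>\<^sup>2 * indicator {0..\<epsilon>} t"
proof -
  let ?r = "deriv smooth_step"
  have sr: "smooth ?r" using smooth_deriv(2)[OF smooth_smooth_step] .
  have "bounded (?r ` {0..1})" "bounded (deriv ?r ` {0..1})"
    using smooth_continuous_on[OF sr] smooth_continuous_on[OF smooth_deriv(2)[OF sr]]
    by (blast intro: compact_imp_bounded compact_continuous_image compact_Icc)+
  then obtain C1 C2 where C: "\<And>y. y \<in> {0..1} \<Longrightarrow> \<bar>?r y\<bar> \<le> C1" "\<And>y. y \<in> {0..1} \<Longrightarrow> \<bar>deriv ?r y\<bar> \<le> C2"
    unfolding bounded_iff real_norm_def ball_simps by blast
  have C0: "C1 \<ge> 0" "C2 \<ge> 0" using C[of 0] by auto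
  have d: "deriv (bump \<epsilon> 0) t = deriv ?r (t / \<epsilon>) / \<epsilon>\<^sup>2" if "\<epsilon> > 0" for \<epsilon> t
  proof -
    have "((\<lambda>t. ?r (t / \<epsilon>) / \<epsilon>) has_real_derivative (deriv ?r (t / \<epsilon>) * (1 / \<epsilon>)) / \<epsilon>) (at t)"
      by (intro DERIV_cdivide DERIV_chain2[OF smooth_deriv(1)[OF sr]])
        (use that in \<open>auto intro!: derivative_eq_intros\<close>)
    from DERIV_imp_deriv[OF this] show ?thesis
      by (simp add: bump_def[abs_def] power2_eq_square)
  qed
  have z: "deriv (bump \<epsilon> 0) t = 0" if "\<epsilon> > 0" "t < 0 \<or> t > \<epsilon>" for \<epsilon> t
  proof -
    have "\<forall>\<^sub>F s in nhds t. s \<in> {..<0} \<union> {\<epsilon><..}"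
      using that by (intro eventually_nhds_in_open) auto
    then have "\<forall>\<^sub>F s in nhds t. bump \<epsilon> 0 s = 0"
      by eventually_elim (use that bump_eq_0[of \<epsilon> _ 0] in auto)
    then have "deriv (bump \<epsilon> 0) t = deriv (\<lambda>_. 0) t" by (intro deriv_cong_ev) auto
    then show ?thesis by simp
  qed
  show ?thesis
  proof (intro exI[of _ "C1 + C2"] conjI allI impI)
    fix \<epsilon> t :: real assume e: "0 < \<epsilon> \<and> \<epsilon> \<le> 1"
    show "\<bar>bump \<epsilon> 0 t\<bar> \<le> (C1 + C2) / \<epsilon>\<^sup>2 * indicator {0..\<epsilon>} t"
    proof (cases "t \<in> {0..\<epsilon>}")
      case True
      then have "t / \<epsilon> \<in> {0..1}" using e by auto
      have "\<epsilon>\<^sup>2 \<le> \<epsilon>" using e mult_right_mono[of \<epsilon> 1 \<epsilon>] by (simp add: power2_eq_square)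
      have "\<bar>bump \<epsilon> 0 t\<bar> = \<bar>?r (t / \<epsilon>)\<bar> / \<epsilon>" using e by (simp add: bump_def)
      also have "\<dots> \<le> (C1 + C2) / \<epsilon>"
        using C(1)[OF \<open>t / \<epsilon> \<in> {0..1}\<close>] C0 e by (intro divide_right_mono) auto
      also have "\<dots> \<le> (C1 + C2) / \<epsilon>\<^sup>2"
        using C0 e \<open>\<epsilon>\<^sup>2 \<le> \<epsilon>\<close> by (intro divide_left_mono) auto
      finally show ?thesis using True by simp
    qed (use e bump_eq_0[of \<epsilon> t 0] in auto)
    show "\<bar>deriv (bump \<epsilon> 0) t\<bar> \<le> (C1 + C2) / \<epsilon>\<^sup>2 * indicator {0..\<epsilon>} t"
    proof (cases "t \<in> {0..\<epsilon>}")
      case True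
      then have "t / \<epsilon> \<in> {0..1}" using e by auto
      have "\<bar>deriv (bump \<epsilon> 0) t\<bar> = \<bar>deriv ?r (t / \<epsilon>)\<bar> / \<epsilon>\<^sup>2" using e d by simp
      also have "\<dots> \<le> (C1 + C2) / \<epsilon>\<^sup>2"
        using C(2)[OF \<open>t / \<epsilon> \<in> {0..1}\<close>] C0 e by (intro divide_right_mono) auto
      finally show ?thesis using True by simp
    qed (use e z[of \<epsilon> t] in auto)
  qed (use C0 in simp)
qed

lemma smooth_characteristic:
  fixes a :: "real \<Rightarrow> real"
  assumes "smooth a"
  shows "smooth (\<lambda>z::real \<times> real. a (snd z + fst z))" "smooth (\<lambda>z::real \<times> real. a (snd z - fst z))"
    "smooth (\<lambda>z::real \<times> real. a (fst z))"
proof -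
  have bl: "bounded_linear (\<lambda>z::real \<times> real. snd z + fst z)" "bounded_linear (\<lambda>z::real \<times> real. snd z - fst z)"
    by (intro bounded_linear_add bounded_linear_sub bounded_linear_fst bounded_linear_snd)+
  show "smooth (\<lambda>z::real \<times> real. a (snd z + fst z))" "smooth (\<lambda>z::real \<times> real. a (snd z - fst z))"
    "smooth (\<lambda>z::real \<times> real. a (fst z))"
    using C_k_compose_affine[OF bl(1), of _ a 0] C_k_compose_affine[OF bl(2), of _ a 0]
      C_k_compose_affine[OF bounded_linear_fst, of _ a 0] assms by auto
qed

lemma d_time_eqI: "(\<And>t x. ((\<lambda>s. \<phi> (s, x)) has_real_derivative f (t, x)) (at t)) \<Longrightarrow> d_time \<phi> = f"
  by (auto simp: d_time_def fun_eq_iff intro!: DERIV_imp_deriv)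

lemma d_space_eqI: "(\<And>t x. ((\<lambda>y. \<phi> (t, y)) has_real_derivative f (t, x)) (at x)) \<Longrightarrow> d_space \<phi> = f"
  by (auto simp: d_space_def fun_eq_iff intro!: DERIV_imp_deriv)

text \<open>In characteristic coordinates the wave operator is \<open>4 \<partial>\<^sub>\<xi> \<partial>\<^sub>\<eta>\<close>; the remaining terms
  are produced by the temporal cutoff.\<close>

lemma wave_operator_characteristic:
  fixes a b c :: "real \<Rightarrow> real"
  assumes "smooth a" "smooth b" "smooth c"
  defines "\<phi> \<equiv> \<lambda>z. a (snd z + fst z) * b (snd z - fst z) * c (fst z)"
  shows "d_space (d_space \<phi>) z - d_time (d_time \<phi>) z =
    4 * deriv a (snd z + fst z) * deriv b (snd z - fst z) * c (fst z)
    - 2 * (deriv a (snd z + fst z) * b (snd z - fst z) - a (snd z + fst z) * deriv b (snd z - fst z)) * deriv c (fst z)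
    - a (snd z + fst z) * b (snd z - fst z) * deriv (deriv c) (fst z)"
proof -
  note sm = assms(1-3)
  note [derivative_intros] =
    DERIV_chain2[OF smooth_deriv(1)[OF sm(1)]] DERIV_chain2[OF smooth_deriv(1)[OF smooth_deriv(2)[OF sm(1)]]]
    DERIV_chain2[OF smooth_deriv(1)[OF sm(2)]] DERIV_chain2[OF smooth_deriv(1)[OF smooth_deriv(2)[OF sm(2)]]]
    DERIV_chain2[OF smooth_deriv(1)[OF sm(3)]] DERIV_chain2[OF smooth_deriv(1)[OF smooth_deriv(2)[OF sm(3)]]]
  have t1: "d_time \<phi> = (\<lambda>z. (deriv a (snd z + fst z) * b (snd z - fst z) - a (snd z + fst z) * deriv b (snd z - fst z)) * c (fst z)
      + a (snd z + fst z) * b (snd z - fst z) * deriv c (fst z))"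
    unfolding \<phi>_def by (rule d_time_eqI) (auto intro!: derivative_eq_intros simp: algebra_simps)
  have t2: "d_time (d_time \<phi>) = (\<lambda>z.
      (deriv (deriv a) (snd z + fst z) * b (snd z - fst z) - 2 * deriv a (snd z + fst z) * deriv b (snd z - fst z)
        + a (snd z + fst z) * deriv (deriv b) (snd z - fst z)) * c (fst z)
      + 2 * (deriv a (snd z + fst z) * b (snd z - fst z) - a (snd z + fst z) * deriv b (snd z - fst z)) * deriv c (fst z)
      + a (snd z + fst z) * b (snd z - fst z) * deriv (deriv c) (fst z))"
    unfolding t1 by (rule d_time_eqI) (auto intro!: derivative_eq_intros simp: algebra_simps)
  have x1: "d_space \<phi> = (\<lambda>z. (deriv a (snd z + fst z) * b (snd z - fst z) + a (snd z + fst z) * deriv b (snd z - fst z)) * c (fst z))"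
    unfolding \<phi>_def by (rule d_space_eqI) (auto intro!: derivative_eq_intros simp: algebra_simps)
  have x2: "d_space (d_space \<phi>) = (\<lambda>z.
      (deriv (deriv a) (snd z + fst z) * b (snd z - fst z) + 2 * deriv a (snd z + fst z) * deriv b (snd z - fst z)
        + a (snd z + fst z) * deriv (deriv b) (snd z - fst z)) * c (fst z))"
    unfolding x1 by (rule d_space_eqI) (auto intro!: derivative_eq_intros simp: algebra_simps)
  show ?thesis unfolding t2 x2 by (simp add: algebra_simps)
qed

text \<open>The rectangle is the image of a compact box under the inverse of the characteristic
  coordinates. Adding those coordinates gives 2x, which explains the bounds 0 and 2 pi.\<close>

lemma characteristic_rectangle:
  fixes \<alpha>1 \<alpha>2 \<beta>1 \<beta>2 :: real
  assumes "0 < \<alpha>1 + \<beta>1" "\<alpha>2 + \<beta>2 < 2 * pi"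
  defines "K \<equiv> {z :: real \<times> real. snd z + fst z \<in> {\<alpha>1..\<alpha>2} \<and> snd z - fst z \<in> {\<beta>1..\<beta>2}}"
  shows "compact K" "K \<subseteq> strip"
proof -
  have "K = (\<lambda>p. ((fst p - snd p) / 2, (fst p + snd p) / 2)) ` ({\<alpha>1..\<alpha>2} \<times> {\<beta>1..\<beta>2})" (is "_ = ?h ` _")
  proof (intro equalityI subsetI)
    fix z assume "z \<in> K"
    then have "(snd z + fst z, snd z - fst z) \<in> {\<alpha>1..\<alpha>2} \<times> {\<beta>1..\<beta>2}" by (auto simp: K_def)
    moreover have "z = ?h (snd z + fst z, snd z - fst z)" by (cases z) (simp add: field_simps)
    ultimately show "z \<in> ?h ` ({\<alpha>1..\<alpha>2} \<times> {\<beta>1..\<beta>2})" by blast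
  qed (auto simp: K_def field_simps)
  moreover have "compact (?h ` ({\<alpha>1..\<alpha>2} \<times> {\<beta>1..\<beta>2}))"
    by (intro compact_continuous_image continuous_intros compact_Times compact_Icc) auto
  ultimately show "compact K" by simp
  show "K \<subseteq> strip" using assms(1,2) by (auto simp: K_def)
qed

text \<open>By Fubini: each slice contributes at most c s \<le> c \<epsilon>, and there is a length
  \<epsilon> of slices.\<close>

lemma integral_thin_strip_le:
  fixes w :: "real \<times> real \<Rightarrow> real"
  assumes cw: "continuous_on (UNIV \<times> {0..pi}) w" and e: "0 < \<epsilon>" and c: "c \<ge> 0"
    and small: "\<And>s. 0 \<le> s \<Longrightarrow> s \<le> \<epsilon> \<Longrightarrow> (\<integral>x. indicator {0..pi} x * \<bar>w (s, x)\<bar> \<partial>lborel) \<le> c * s"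
  shows "integrable lborel (\<lambda>z. indicator ({0..\<epsilon>} \<times> {0..pi}) z * \<bar>w z\<bar>)"
    and "(\<integral>z. indicator ({0..\<epsilon>} \<times> {0..pi}) z * \<bar>w z\<bar> \<partial>lborel) \<le> c * \<epsilon>\<^sup>2"
proof -
  let ?f = "\<lambda>z. indicator ({0..\<epsilon>} \<times> {0..pi}) z * \<bar>w z\<bar>"
  have "integrable lborel (\<lambda>z. indicator ({0..\<epsilon>} \<times> {0..pi}) z *\<^sub>R \<bar>w z\<bar>)"
    by (intro borel_integrable_compact compact_Times compact_Icc continuous_on_rabs
        continuous_on_subset[OF cw]) auto
  then show int: "integrable lborel ?f" by simp
  then have int': "integrable (lborel \<Otimes>\<^sub>M lborel) ?f" by (simp add: lborel_prod)
  have "(\<integral>z. ?f z \<partial>lborel) = (\<integral>t. \<integral>x. ?f (t, x) \<partial>lborel \<partial>lborel)"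
    using lborel_pair.integral_fst'[OF int'] by (simp add: lborel_prod)
  also have "\<dots> \<le> (\<integral>t. c * \<epsilon> * indicator {0..\<epsilon>} t \<partial>lborel)"
  proof (rule integral_mono)
    show "integrable lborel (\<lambda>t. \<integral>x. ?f (t, x) \<partial>lborel)"
      by (rule lborel_pair.integrable_fst'[OF int'])
    show "integrable lborel (\<lambda>t. c * \<epsilon> * indicat_real {0..\<epsilon>} t)"
      using e by (intro integrable_mult_right integrable_real_indicator) auto
    fix t
    have "(\<integral>x. ?f (t, x) \<partial>lborel) = indicator {0..\<epsilon>} t * (\<integral>x. indicator {0..pi} x * \<bar>w (t, x)\<bar> \<partial>lborel)"
      by (simp add: indicator_times mult.assoc)
    also have "\<dots> \<le> c * \<epsilon> * indicator {0..\<epsilon>} t"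
    proof (cases "t \<in> {0..\<epsilon>}")
      case True
      then have "c * t \<le> c * \<epsilon>" using c by (intro mult_left_mono) auto
      then show ?thesis using True small[of t] by simp
    qed simp
    finally show "(\<integral>x. ?f (t, x) \<partial>lborel) \<le> c * \<epsilon> * indicator {0..\<epsilon>} t" .
  qed
  also have "\<dots> = c * \<epsilon>\<^sup>2" using e by (simp add: power2_eq_square)
  finally show "(\<integral>z. ?f z \<partial>lborel) \<le> c * \<epsilon>\<^sup>2" .
qed

text \<open>A cutoff in \<open>[0, \<epsilon>]\<close> costs derivatives of size \<open>\<epsilon>\<^sup>-\<^sup>2\<close>, but \<open>w\<close> integrates to
  \<open>o(\<epsilon>\<^sup>2)\<close> there because its Cauchy data vanish.\<close>

lemma weak_wave_half_space:
  fixes w F :: "real \<times> real \<Rightarrow> real"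
  assumes ww: "weak_wave w F" and cw: "continuous_on (UNIV \<times> {0..pi}) w" and cF: "continuous_on strip F"
    and small: "\<And>c. c > 0 \<Longrightarrow> \<exists>\<delta>>0. \<forall>s. 0 \<le> s \<and> s < \<delta> \<longrightarrow>
        (\<integral>x. indicator {0..pi} x * \<bar>w (s, x)\<bar> \<partial>lborel) \<le> c * s"
    and sa: "smooth a" and sb: "smooth b"
    and a0: "\<And>x. x \<notin> {\<alpha>1..\<alpha>2} \<Longrightarrow> a x = 0" and b0: "\<And>x. x \<notin> {\<beta>1..\<beta>2} \<Longrightarrow> b x = 0"
    and da0: "\<And>x. x \<notin> {\<alpha>1..\<alpha>2} \<Longrightarrow> deriv a x = 0" and db0: "\<And>x. x \<notin> {\<beta>1..\<beta>2} \<Longrightarrow> deriv b x = 0"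
    and rect: "0 < \<alpha>1 + \<beta>1" "\<alpha>2 + \<beta>2 < 2 * pi"
  shows "(\<integral>z. indicator strip z * (w z * (4 * deriv a (snd z + fst z) * deriv b (snd z - fst z))) * indicator {0<..} (fst z) \<partial>lborel) =
    (\<integral>z. indicator strip z * (F z * (a (snd z + fst z) * b (snd z - fst z))) * indicator {0<..} (fst z) \<partial>lborel)"
proof -
  have cw': "continuous_on strip w" by (rule continuous_on_subset[OF cw]) auto
  define K where "K = {z :: real \<times> real. snd z + fst z \<in> {\<alpha>1..\<alpha>2} \<and> snd z - fst z \<in> {\<beta>1..\<beta>2}}"
  have K: "compact K" "K \<subseteq> strip" unfolding K_def by (rule characteristic_rectangle[OF rect])+
  define f where "f z = w z * (4 * deriv a (snd z + fst z) * deriv b (snd z - fst z))" for z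
  define g where "g z = F z * (a (snd z + fst z) * b (snd z - fst z))" for z
  define p where "p z = deriv a (snd z + fst z) * b (snd z - fst z) - a (snd z + fst z) * deriv b (snd z - fst z)" for z
  define q where "q z = a (snd z + fst z) * b (snd z - fst z)" for z
  note sm = smooth_characteristic
  have sq: "smooth q" unfolding q_def[abs_def] using sm(1)[OF sa] sm(2)[OF sb] C_k_mult by blast
  have cont: "continuous_on UNIV p" "continuous_on UNIV q"
    "continuous_on UNIV (\<lambda>z::real\<times>real. 4 * deriv a (snd z + fst z) * deriv b (snd z - fst z))"
    unfolding p_def[abs_def] q_def[abs_def]
    by (intro continuous_intros smooth_continuous_on sm sa sb smooth_deriv(2))+
  have zero: "p z = 0" "q z = 0" "4 * deriv a (snd z + fst z) * deriv b (snd z - fst z) = 0" if "z \<notin> K" for z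
    using that a0 b0 da0 db0 by (auto simp: K_def p_def q_def)
  have intf: "integrable lborel (\<lambda>z. indicator strip z * f z)"
    unfolding f_def by (rule strip_integrable[OF cw' cont(3) K zero(3)])
  have intg: "integrable lborel (\<lambda>z. indicator strip z * g z)"
    using strip_integrable[OF cF cont(2) K zero(2)] by (simp add: g_def q_def)
  obtain M where M: "M \<ge> 0" "\<And>z. \<bar>p z\<bar> \<le> M" "\<And>z. \<bar>q z\<bar> \<le> M"
  proof -
    have "bounded (p ` K)" "bounded (q ` K)"
      using K(1) cont by (blast intro: compact_imp_bounded compact_continuous_image continuous_on_subset)+
    then obtain M1 M2 where b: "\<And>z. z \<in> K \<Longrightarrow> \<bar>p z\<bar> \<le> M1" "\<And>z. z \<in> K \<Longrightarrow> \<bar>q z\<bar> \<le> M2"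
      unfolding bounded_iff real_norm_def ball_simps by blast
    have "\<bar>p z\<bar> \<le> \<bar>M1\<bar> + \<bar>M2\<bar>" for z
      using b(1)[of z] zero(1)[of z] by (cases "z \<in> K") auto
    moreover have "\<bar>q z\<bar> \<le> \<bar>M1\<bar> + \<bar>M2\<bar>" for z
      using b(2)[of z] zero(2)[of z] by (cases "z \<in> K") auto
    ultimately show ?thesis using that[of "\<bar>M1\<bar> + \<bar>M2\<bar>"] by auto
  qed
  obtain C where C: "C \<ge> 0"
    "\<And>\<epsilon> t. 0 < \<epsilon> \<Longrightarrow> \<epsilon> \<le> 1 \<Longrightarrow> \<bar>bump \<epsilon> 0 t\<bar> \<le> C / \<epsilon>\<^sup>2 * indicator {0..\<epsilon>} t"
    "\<And>\<epsilon> t. 0 < \<epsilon> \<Longrightarrow> \<epsilon> \<le> 1 \<Longrightarrow> \<bar>deriv (bump \<epsilon> 0) t\<bar> \<le> C / \<epsilon>\<^sup>2 * indicator {0..\<epsilon>} t"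
    using bump_cutoff_bounds by blast
  define cut where "cut \<epsilon> z = smooth_step (fst z / \<epsilon>)" for \<epsilon> and z :: "real \<times> real"
  have chi: "0 \<le> cut \<epsilon> z" "cut \<epsilon> z \<le> 1" for \<epsilon> z by (simp_all add: cut_def smooth_step_bounds)
  have chi_meas [measurable]: "cut \<epsilon> \<in> borel_measurable borel" for \<epsilon>
    using smooth_continuous_on[OF sm(3)[OF smooth_affine[OF smooth_smooth_step, of 0 \<epsilon>]]]
    unfolding cut_def[abs_def] by (intro borel_measurable_continuous_onI) simp
  have intchi: "integrable lborel (\<lambda>z. indicator strip z * h z * cut \<epsilon> z)"
    if "integrable lborel (\<lambda>z. indicator strip z * h z)" for h \<epsilon>
  proof (rule Bochner_Integration.integrable_bound[OF that])
    show "AE z in lborel. norm (indicator strip z * h z * cut \<epsilon> z) \<le> norm (indicator strip z * h z)"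
      using chi by (auto simp: abs_mult intro!: mult_left_le)
  qed (use borel_measurable_integrable[OF that] in measurable)
  \<comment> \<open>The defect of the desired identity when the sharp restriction to positive times
    is smoothed.\<close>
  define E where "E \<epsilon> = (\<integral>z. indicator strip z * f z * cut \<epsilon> z \<partial>lborel) - (\<integral>z. indicator strip z * g z * cut \<epsilon> z \<partial>lborel)" for \<epsilon>
  have E: "\<bar>E \<epsilon>\<bar> \<le> 3 * M * C * c"
    if e: "0 < \<epsilon>" "\<epsilon> \<le> 1" "c \<ge> 0" and sm_e: "\<And>s. 0 \<le> s \<Longrightarrow> s \<le> \<epsilon> \<Longrightarrow>
        (\<integral>x. indicator {0..pi} x * \<bar>w (s, x)\<bar> \<partial>lborel) \<le> c * s" for \<epsilon> c
  proof -
    have sc: "smooth (\<lambda>t. smooth_step (t / \<epsilon>))"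
      using smooth_affine[OF smooth_smooth_step, of 0 \<epsilon>] by simp
    have dc: "deriv (\<lambda>t. smooth_step (t / \<epsilon>)) = bump \<epsilon> 0"
      using smooth_step_has_deriv_bump[OF e(1), of 0] by (auto intro!: DERIV_imp_deriv)
    define \<phi> where "\<phi> z = a (snd z + fst z) * b (snd z - fst z) * smooth_step (fst z / \<epsilon>)" for z
    have "test_function strip \<phi>"
    proof (rule test_functionI[OF _ K])
      show "smooth \<phi>"
        unfolding \<phi>_def
        by (intro allI C_k_mult sm(1)[OF sa, rule_format] sm(2)[OF sb, rule_format] sm(3)[OF sc, rule_format])
      fix z assume "z \<notin> K"
      then show "\<phi> z = 0" using zero(2)[of z] by (simp add: \<phi>_def q_def)
    qed
    note t = this
    \<comment> \<open>The terms in which a time derivative falls on the cutoff, whose first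
      derivative is \<open>bump \<epsilon> 0\<close>.\<close>
    define r where "r z = w z * (2 * p z * bump \<epsilon> 0 (fst z) + q z * deriv (bump \<epsilon> 0) (fst z))" for z
    have op: "indicator strip z * (w z * (d_space (d_space \<phi>) z - d_time (d_time \<phi>) z)) =
        indicator strip z * f z * cut \<epsilon> z - indicator strip z * r z" for z
      unfolding \<phi>_def wave_operator_characteristic[OF sa sb sc] dc
      by (simp add: f_def r_def p_def q_def cut_def algebra_simps)
    have i1: "integrable lborel (\<lambda>z. indicator strip z * f z * cut \<epsilon> z - indicator strip z * r z)"
      using test_function_integrands(1)[OF t cw'] unfolding op .
    have intr: "integrable lborel (\<lambda>z. indicator strip z * r z)"
      using Bochner_Integration.integrable_diff[OF intchi[OF intf, of \<epsilon>] i1] by simp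
    have "(\<integral>z. indicator strip z * f z * cut \<epsilon> z - indicator strip z * r z \<partial>lborel) =
        (\<integral>z. indicator strip z * g z * cut \<epsilon> z \<partial>lborel)"
      using ww[unfolded weak_wave_def, rule_format, OF t] unfolding op
      by (simp add: g_def \<phi>_def cut_def mult.assoc)
    then have Er: "E \<epsilon> = (\<integral>z. indicator strip z * r z \<partial>lborel)"
      using Bochner_Integration.integral_diff[OF intchi[OF intf, of \<epsilon>] intr] by (simp add: E_def)
    note thin = integral_thin_strip_le[OF cw e(1) e(3) sm_e]
    have "\<bar>\<integral>z. indicator strip z * r z \<partial>lborel\<bar> \<le> (\<integral>z. \<bar>indicator strip z * r z\<bar> \<partial>lborel)"
      by (rule integral_abs_bound)
    also have "\<dots> \<le> (\<integral>z. (3 * M * C / \<epsilon>\<^sup>2) * (indicator ({0..\<epsilon>} \<times> {0..pi}) z * \<bar>w z\<bar>) \<partial>lborel)"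
    proof (rule integral_mono)
      fix z :: "real \<times> real"
      let ?i = "C / \<epsilon>\<^sup>2 * indicator {0..\<epsilon>} (fst z)"
      have nn: "?i \<ge> 0" using C(1) by simp
      have "\<bar>2 * p z * bump \<epsilon> 0 (fst z)\<bar> \<le> 2 * (M * ?i)"
        using mult_mono[OF M(2)[of z] C(2)[OF e(1,2), of "fst z"] M(1)] by (simp add: abs_mult)
      moreover have "\<bar>q z * deriv (bump \<epsilon> 0) (fst z)\<bar> \<le> M * ?i"
        using mult_mono[OF M(3)[of z] C(3)[OF e(1,2), of "fst z"] M(1)] by (simp add: abs_mult)
      ultimately have "\<bar>2 * p z * bump \<epsilon> 0 (fst z) + q z * deriv (bump \<epsilon> 0) (fst z)\<bar> \<le> 3 * (M * ?i)"
        by linarith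
      then have "\<bar>r z\<bar> \<le> \<bar>w z\<bar> * (3 * (M * ?i))"
        unfolding r_def abs_mult[of "w z"] by (rule mult_left_mono) simp
      then show "\<bar>indicator strip z * r z\<bar> \<le> (3 * M * C / \<epsilon>\<^sup>2) * (indicator ({0..\<epsilon>} \<times> {0..pi}) z * \<bar>w z\<bar>)"
        using M(1) C(1) by (cases z) (auto simp: indicator_def abs_mult algebra_simps)
    qed (use intr thin(1) in \<open>auto intro: integrable_mult_right\<close>)
    also have "\<dots> = (3 * M * C / \<epsilon>\<^sup>2) * (\<integral>z. indicator ({0..\<epsilon>} \<times> {0..pi}) z * \<bar>w z\<bar> \<partial>lborel)"
      by simp
    also have "\<dots> \<le> (3 * M * C / \<epsilon>\<^sup>2) * (c * \<epsilon>\<^sup>2)"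
      using thin(2) M(1) C(1) by (intro mult_left_mono) auto
    also have "\<dots> = 3 * M * C * c" using e by simp
    finally show ?thesis by (simp add: Er)
  qed
  define eps where "eps n = inverse (real (Suc n))" for n
  have eps: "0 < eps n" "eps n \<le> 1" for n by (auto simp: eps_def field_simps)
  have eps0: "eps \<longlonglongrightarrow> 0" unfolding eps_def by (rule LIMSEQ_inverse_real_of_nat)
  \<comment> \<open>The step vanishes at 0, so the limit is the indicator of the open
    half-line.\<close>
  have chilim: "(\<lambda>n. cut (eps n) z) \<longlonglongrightarrow> indicator {0<..} (fst z)" for z
  proof (cases "fst z > 0")
    case True
    then have "\<forall>\<^sub>F n in sequentially. eps n < fst z" using order_tendstoD(2)[OF eps0] by blast
    then have "\<forall>\<^sub>F n in sequentially. cut (eps n) z = indicator {0<..} (fst z)"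
      by eventually_elim (use eps True in \<open>auto simp: cut_def field_simps intro!: smooth_step_eq_1\<close>)
    then show ?thesis by (rule tendsto_eventually)
  next
    case False
    then have "cut (eps n) z = 0" for n
      using eps[of n] by (auto simp: cut_def field_simps intro!: smooth_step_eq_0)
    then show ?thesis using False by simp
  qed
  have lim: "(\<lambda>n. \<integral>z. indicator strip z * h z * cut (eps n) z \<partial>lborel) \<longlonglongrightarrow>
      (\<integral>z. indicator strip z * h z * indicator {0<..} (fst z) \<partial>lborel)"
    if h: "integrable lborel (\<lambda>z. indicator strip z * h z)" for h
  proof (rule integral_dominated_convergence[where w="\<lambda>z. \<bar>indicator strip z * h z\<bar>"])
    show "AE z in lborel. (\<lambda>n. indicator strip z * h z * cut (eps n) z) \<longlonglongrightarrow> indicator strip z * h z * indicator {0<..} (fst z)"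
      by (intro AE_I2 tendsto_mult_left chilim)
    show "AE z in lborel. norm (indicator strip z * h z * cut (eps n) z) \<le> \<bar>indicator strip z * h z\<bar>" for n
      using chi by (auto simp: abs_mult intro!: mult_left_le)
    have "(\<lambda>z::real \<times> real. indicat_real {0<..} (fst z)) \<in> borel_measurable borel"
      unfolding borel_prod[symmetric] by measurable
    then show "(\<lambda>z. indicator strip z * h z * indicator {0<..} (fst z)) \<in> borel_measurable lborel"
      using borel_measurable_integrable[OF h] by (auto dest: borel_measurable_times)
    show "(\<lambda>z. indicator strip z * h z * cut (eps n) z) \<in> borel_measurable lborel" for n
      using borel_measurable_integrable[OF h] by measurable
  qed (use h in simp)
  have "(\<lambda>n. E (eps n)) \<longlonglongrightarrow> (\<integral>z. indicator strip z * f z * indicator {0<..} (fst z) \<partial>lborel)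
      - (\<integral>z. indicator strip z * g z * indicator {0<..} (fst z) \<partial>lborel)"
    unfolding E_def by (intro tendsto_diff lim intf intg)
  moreover have "(\<lambda>n. E (eps n)) \<longlonglongrightarrow> 0"
  proof (rule LIMSEQ_I)
    fix \<eta> :: real assume "\<eta> > 0"
    \<comment> \<open>The added 1 keeps the denominator positive when M C = 0.\<close>
    define c where "c = \<eta> / (3 * M * C + 1)"
    have pos: "3 * M * C + 1 > 0" using M(1) C(1) by (intro add_nonneg_pos mult_nonneg_nonneg) auto
    have c: "c > 0" "3 * M * C * c < \<eta>"
      using \<open>\<eta> > 0\<close> pos by (auto simp: c_def field_simps)
    from small[OF c(1)] obtain \<delta> where \<delta>: "\<delta> > 0" "\<And>s. 0 \<le> s \<Longrightarrow> s < \<delta> \<Longrightarrow>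
        (\<integral>x. indicator {0..pi} x * \<bar>w (s, x)\<bar> \<partial>lborel) \<le> c * s" by blast
    obtain N where N: "\<And>n. n \<ge> N \<Longrightarrow> eps n < \<delta>"
      using order_tendstoD(2)[OF eps0 \<delta>(1)] by (auto simp: eventually_sequentially)
    have "norm (E (eps n) - 0) < \<eta>" if "n \<ge> N" for n
    proof -
      have "\<bar>E (eps n)\<bar> \<le> 3 * M * C * c"
        using eps[of n] c N[OF that] by (intro E \<delta>(2)) auto
      then show ?thesis using c(2) by simp
    qed
    then show "\<exists>no. \<forall>n\<ge>no. norm (E (eps n) - 0) < \<eta>" by blast
  qed
  ultimately show ?thesis
    using LIMSEQ_unique unfolding f_def g_def by fastforce
qed

section \<open>Corner averages and integrals over characteristic rectangles\<close>

lemma bump_product_has_integral: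
  assumes e: "\<epsilon> > 0"
  shows "has_bochner_integral lborel
    (\<lambda>z. bump \<epsilon> p (snd z + fst z) * bump \<epsilon> q (snd z - fst z)) (1 / 2)"
\<comment> \<open>The value 1/2 is the inverse of the Jacobian 2 of (t, x) -> (x + t, x - t). For
  fixed t a shift by t makes the arguments x and x - 2t; Tonelli then integrates over t first, where
  the factor 2 appears.\<close>
proof (rule has_bochner_integral_nn_integral)
  let ?f = "\<lambda>z. bump \<epsilon> p (snd z + fst z) * bump \<epsilon> q (snd z - fst z)"
  show m: "?f \<in> borel_measurable lborel"
    using smooth_continuous_on[OF smooth_characteristic(1)[OF smooth_bump]]
      smooth_continuous_on[OF smooth_characteristic(2)[OF smooth_bump]]
    by (auto intro!: borel_measurable_continuous_onI continuous_on_mult)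
  show "AE z in lborel. 0 \<le> ?f z" using bump_nonneg[OF e] by simp
  have nn1: "(\<integral>\<^sup>+x. ennreal (bump \<epsilon> r x) \<partial>lborel) = 1" for r
  proof -
    have "(\<integral>\<^sup>+x. ennreal (bump \<epsilon> r x) \<partial>lborel) = ennreal (\<integral>x. bump \<epsilon> r x \<partial>lborel)"
      using bump_has_integral[OF e, of r] bump_nonneg[OF e]
      by (intro nn_integral_eq_integral) (auto simp: has_bochner_integral_iff)
    then show ?thesis using bump_has_integral[OF e, of r] by (simp add: has_bochner_integral_iff)
  qed
  have inner: "(\<integral>\<^sup>+t. ennreal (bump \<epsilon> q (x - 2 * t)) \<partial>lborel) = ennreal (1 / 2)" for x
  proof -
    have "(\<integral>\<^sup>+y. ennreal (bump \<epsilon> q y) \<partial>lborel) = ennreal \<bar>-2\<bar> * (\<integral>\<^sup>+t. ennreal (bump \<epsilon> q (x + (-2) * t)) \<partial>lborel)"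
      by (rule nn_integral_real_affine) auto
    then have eq: "1 = ennreal 2 * (\<integral>\<^sup>+t. ennreal (bump \<epsilon> q (x - 2 * t)) \<partial>lborel)" by (simp add: nn1)
    have "ennreal (1 / 2) = ennreal (1 / 2) * (ennreal 2 * (\<integral>\<^sup>+t. ennreal (bump \<epsilon> q (x - 2 * t)) \<partial>lborel))"
      by (subst eq[symmetric]) simp
    also have "\<dots> = (\<integral>\<^sup>+t. ennreal (bump \<epsilon> q (x - 2 * t)) \<partial>lborel)"
    proof -
      have "ennreal (1 / 2) * ennreal 2 = 1" by (subst ennreal_mult[symmetric]) auto
      then show ?thesis by (simp only: mult.assoc[symmetric] mult_1)
    qed
    finally show ?thesis ..
  qed
  have "(\<integral>\<^sup>+z. ennreal (?f z) \<partial>lborel) = (\<integral>\<^sup>+t. \<integral>\<^sup>+x. ennreal (?f (t, x)) \<partial>lborel \<partial>lborel)"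
    using lborel.nn_integral_fst[of "\<lambda>z. ennreal (?f z)" lborel] m by (simp add: lborel_prod)
  also have "\<dots> = (\<integral>\<^sup>+t. \<integral>\<^sup>+x. ennreal (bump \<epsilon> p x) * ennreal (bump \<epsilon> q (x - 2 * t)) \<partial>lborel \<partial>lborel)"
  proof (rule nn_integral_cong)
    fix t :: real
    have "(\<integral>\<^sup>+x. ennreal (?f (t, x)) \<partial>lborel) = ennreal \<bar>1\<bar> * (\<integral>\<^sup>+x. ennreal (?f (t, - t + 1 * x)) \<partial>lborel)"
      by (rule nn_integral_real_affine) auto
    then show "(\<integral>\<^sup>+x. ennreal (?f (t, x)) \<partial>lborel) = (\<integral>\<^sup>+x. ennreal (bump \<epsilon> p x) * ennreal (bump \<epsilon> q (x - 2 * t)) \<partial>lborel)"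
      by (simp add: ennreal_mult bump_nonneg[OF e] algebra_simps)
  qed
  also have "\<dots> = (\<integral>\<^sup>+x. \<integral>\<^sup>+t. ennreal (bump \<epsilon> p x) * ennreal (bump \<epsilon> q (x - 2 * t)) \<partial>lborel \<partial>lborel)"
    by (rule lborel_pair.Fubini') measurable
  also have "\<dots> = (\<integral>\<^sup>+x. ennreal (bump \<epsilon> p x) * ennreal (1 / 2) \<partial>lborel)"
    by (simp add: nn_integral_cmult inner)
  also have "\<dots> = ennreal (1 / 2)" by (simp add: nn_integral_multc nn1)
  finally show "(\<integral>\<^sup>+z. ennreal (?f z) \<partial>lborel) = ennreal (1 / 2)" .
qed simp

text \<open>The 1/2 is the mass of the product of bumps. \<open>W\<close> is controlled only where
  this product lives; integrability follows by comparing W times the product with c times the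
  product.\<close>

lemma corner_average:
  fixes W :: "real \<times> real \<Rightarrow> real"
  assumes e: "\<epsilon> > 0" and [measurable]: "W \<in> borel_measurable borel"
    and close: "\<And>s y. y + s \<in> {p..p + \<epsilon>} \<Longrightarrow> y - s \<in> {q..q + \<epsilon>} \<Longrightarrow> \<bar>W (s, y) - c\<bar> \<le> \<eta>"
  shows "integrable lborel (\<lambda>z. W z * (bump \<epsilon> p (snd z + fst z) * bump \<epsilon> q (snd z - fst z)))" (is ?int)
    and "\<bar>(\<integral>z. W z * (bump \<epsilon> p (snd z + fst z) * bump \<epsilon> q (snd z - fst z)) \<partial>lborel) - c / 2\<bar> \<le> \<eta> / 2"
proof -
  let ?b = "\<lambda>z. bump \<epsilon> p (snd z + fst z) * bump \<epsilon> q (snd z - fst z)"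
  have b: "integrable lborel ?b" "(\<integral>z. ?b z \<partial>lborel) = 1 / 2"
    using bump_product_has_integral[OF e, of p q] by (auto simp: has_bochner_integral_iff)
  have b0: "?b z \<ge> 0" for z using bump_nonneg[OF e] by simp
  have le: "\<bar>W z * ?b z - c * ?b z\<bar> \<le> \<eta> * ?b z" for z
  proof (cases "snd z + fst z \<in> {p..p + \<epsilon>} \<and> snd z - fst z \<in> {q..q + \<epsilon>}")
    case True
    then have "\<bar>W z - c\<bar> \<le> \<eta>" using close[of "snd z" "fst z"] by simp
    then have "\<bar>W z - c\<bar> * ?b z \<le> \<eta> * ?b z" using b0 by (rule mult_right_mono)
    then show ?thesis using b0[of z]
      by (simp only: left_diff_distrib[symmetric] abs_mult[of "W z - c"] abs_of_nonneg)
  next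
    case False
    then have "?b z = 0" using bump_eq_0[OF e, of "snd z + fst z" p] bump_eq_0[OF e, of "snd z - fst z" q] by force
    then show ?thesis by auto
  qed
  have d: "integrable lborel (\<lambda>z. W z * ?b z - c * ?b z)"
  proof (rule Bochner_Integration.integrable_bound)
    show "integrable lborel (\<lambda>z. \<eta> * ?b z)" using b(1) by simp
    show "AE z in lborel. norm (W z * ?b z - c * ?b z) \<le> norm (\<eta> * ?b z)"
    proof (intro AE_I2)
      fix z show "norm (W z * ?b z - c * ?b z) \<le> norm (\<eta> * ?b z)"
        using le[of z] unfolding real_norm_def by linarith
    qed
  qed (use borel_measurable_integrable[OF b(1)] in measurable)
  have "integrable lborel (\<lambda>z. (W z * ?b z - c * ?b z) + c * ?b z)"
    by (intro Bochner_Integration.integrable_add d integrable_mult_right b)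
  then show int: ?int by simp
  have "(\<integral>z. W z * ?b z \<partial>lborel) - c / 2 = (\<integral>z. W z * ?b z - c * ?b z \<partial>lborel)"
    using Bochner_Integration.integral_diff[OF int integrable_mult_right[OF b(1), of c]] b(2) by simp
  moreover have "\<bar>\<integral>z. W z * ?b z - c * ?b z \<partial>lborel\<bar> \<le> (\<integral>z. \<bar>W z * ?b z - c * ?b z\<bar> \<partial>lborel)"
    by (rule integral_abs_bound)
  moreover have "(\<integral>z. \<bar>W z * ?b z - c * ?b z\<bar> \<partial>lborel) \<le> (\<integral>z. \<eta> * ?b z \<partial>lborel)"
    by (rule integral_mono) (use d b le in auto)
  moreover have "(\<integral>z. \<eta> * ?b z \<partial>lborel) = \<eta> / 2" using b(2) by simp
  ultimately show "\<bar>(\<integral>z. W z * ?b z \<partial>lborel) - c / 2\<bar> \<le> \<eta> / 2" by linarith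
qed

text \<open>Among intervals of given length the one starting at 0 is the worst, since sqrt d' - sqrt
  c' \<le> sqrt (d' - c'). The bound thus depends on the length and not on the position.\<close>

lemma nn_integral_inverse_sqrt_le:
  assumes "c \<le> d"
  shows "(\<integral>\<^sup>+y. ennreal (indicator {c..d} y * indicator {0<..} y * (1 / sqrt y)) \<partial>lborel) \<le> ennreal (2 * sqrt (d - c))"
proof -
  define c' d' where "c' = max c 0" and "d' = max d 0"
  have cd: "0 \<le> c'" "c' \<le> d'" "d' - c' \<le> d - c" using assms by (auto simp: c'_def d'_def)
  have "((\<lambda>y. 1 / sqrt y) has_integral (2 * sqrt d' - 2 * sqrt c')) {c'..d'}"
  proof (rule fundamental_theorem_of_calculus_interior)
    fix y assume "y \<in> {c'<..<d'}"
    then have "y > 0" using cd by simp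
    then have "((\<lambda>y. 2 * sqrt y) has_real_derivative 1 / sqrt y) (at y)"
      by (auto intro!: derivative_eq_intros simp: field_simps)
    then show "((\<lambda>y. 2 * sqrt y) has_vector_derivative 1 / sqrt y) (at y)"
      by (simp add: has_real_derivative_iff_has_vector_derivative)
  qed (use cd in \<open>auto intro!: continuous_intros\<close>)
  then have "((\<lambda>y. if y \<in> {c'..d'} then 1 / sqrt y else 0) has_integral (2 * sqrt d' - 2 * sqrt c')) UNIV"
    by (subst has_integral_restrict_UNIV)
  then have "((\<lambda>y. indicator {c'..d'} y * (1 / sqrt y)) has_integral (2 * sqrt d' - 2 * sqrt c')) UNIV"
    by (rule has_integral_eq[rotated]) auto
  then have eq: "(\<integral>\<^sup>+y. ennreal (indicator {c'..d'} y * (1 / sqrt y)) \<partial>lborel) = ennreal (2 * sqrt d' - 2 * sqrt c')"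
    using cd by (intro nn_integral_has_integral_lborel) (auto split: split_indicator)
  have "(\<integral>\<^sup>+y. ennreal (indicator {c..d} y * indicator {0<..} y * (1 / sqrt y)) \<partial>lborel)
      \<le> (\<integral>\<^sup>+y. ennreal (indicator {c'..d'} y * (1 / sqrt y)) \<partial>lborel)"
    by (intro nn_integral_mono ennreal_leI) (auto simp: c'_def d'_def split: split_indicator)
  also have "\<dots> \<le> ennreal (2 * sqrt (d - c))"
  proof -
    have "sqrt d' \<le> sqrt c' + sqrt (d' - c')" using sqrt_add_le_add_sqrt[of c' "d' - c'"] cd by simp
    moreover have "sqrt (d' - c') \<le> sqrt (d - c)" using cd by simp
    ultimately show ?thesis unfolding eq by (intro ennreal_leI) linarith
  qed
  finally show ?thesis .
qed

text \<open>The weight is at most the sum of the weights for the two boundary points; reflection in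
  pi/2 reduces the second to the first, hence 4 = 2 + 2.\<close>

lemma nn_integral_inverse_sqrt_bdist_le:
  assumes "c \<le> d"
  shows "(\<integral>\<^sup>+y. ennreal (indicator {c..d} y * indicator {0<..<pi} y * (1 / sqrt (bdist y))) \<partial>lborel) \<le> ennreal (4 * sqrt (d - c))"
proof -
  let ?f = "\<lambda>y. indicator {c..d} y * indicator {0<..} y * (1 / sqrt y) :: real"
  let ?g = "\<lambda>y. indicator {pi - d..pi - c} (pi - y) * indicator {0<..} (pi - y) * (1 / sqrt (pi - y)) :: real"
  have "(\<integral>\<^sup>+y. ennreal (indicator {c..d} y * indicator {0<..<pi} y * (1 / sqrt (bdist y))) \<partial>lborel)
      \<le> (\<integral>\<^sup>+y. ennreal (?f y) + ennreal (?g y) \<partial>lborel)"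
  proof (rule nn_integral_mono)
    fix y
    have "ennreal (indicator {c..d} y * indicator {0<..<pi} y * (1 / sqrt (bdist y))) \<le> ennreal (?f y + ?g y)"
      by (intro ennreal_leI) (auto simp: min_def split: split_indicator)
    also have "\<dots> = ennreal (?f y) + ennreal (?g y)"
      by (intro ennreal_plus) (auto split: split_indicator)
    finally show "ennreal (indicator {c..d} y * indicator {0<..<pi} y * (1 / sqrt (bdist y))) \<le> ennreal (?f y) + ennreal (?g y)" .
  qed
  also have "\<dots> = (\<integral>\<^sup>+y. ennreal (?f y) \<partial>lborel) + (\<integral>\<^sup>+y. ennreal (?g y) \<partial>lborel)"
    by (rule nn_integral_add) auto
  also have "(\<integral>\<^sup>+y. ennreal (?g y) \<partial>lborel) =
      (\<integral>\<^sup>+y. ennreal (indicator {pi - d..pi - c} y * indicator {0<..} y * (1 / sqrt y)) \<partial>lborel)"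
    using nn_integral_real_affine[of "\<lambda>y. ennreal (indicator {pi - d..pi - c} y * indicator {0<..} y * (1 / sqrt y))" "-1" pi]
    by simp
  also have "(\<integral>\<^sup>+y. ennreal (?f y) \<partial>lborel) + \<dots> \<le> ennreal (2 * sqrt (d - c)) + ennreal (2 * sqrt ((pi - c) - (pi - d)))"
    using assms by (intro add_mono nn_integral_inverse_sqrt_le) auto
  also have "\<dots> = ennreal (4 * sqrt (d - c))"
    using assms by (simp add: ennreal_plus[symmetric] del: ennreal_plus)
  finally show ?thesis .
qed

text \<open>The factor 1 / l is the gain that makes the contribution of the source small for large
  l.\<close>

lemma nn_integral_exp_le:
  assumes "l > 0"
  shows "(\<integral>\<^sup>+s. ennreal (indicator {0<..\<tau>} s * exp (l * s)) \<partial>lborel) \<le> ennreal (exp (l * \<tau>) / l)"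
proof (cases "\<tau> \<ge> 0")
  case True
  have "(\<integral>\<^sup>+s. ennreal (indicator {0<..\<tau>} s * exp (l * s)) \<partial>lborel) \<le>
      (\<integral>\<^sup>+s. ennreal (exp (l * s)) * indicator {0..\<tau>} s \<partial>lborel)"
    by (intro nn_integral_mono) (auto split: split_indicator)
  also have "\<dots> = ennreal (exp (l * \<tau>) / l - exp (l * 0) / l)"
    using assms True
    by (intro nn_integral_FTC_Icc) (auto intro!: derivative_eq_intros)
  also have "\<dots> \<le> ennreal (exp (l * \<tau>) / l)" using assms by (intro ennreal_leI) simp
  finally show ?thesis .
next
  case False
  then show ?thesis by (simp add: indicator_def)
qed

text \<open>The slice at time s lies both in {\<xi>1 - s..\<xi>2 - s} and in {\<eta>1 + s..\<eta>2 +
  s}, so the shorter length bounds its integral uniformly in s. The exponential is integrated up to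
  (\<xi>2 - \<eta>1) / 2, the time of the top corner.\<close>

lemma nn_integral_majorant_le:
  fixes \<xi>1 \<xi>2 \<eta>1 \<eta>2 :: real
  assumes "\<xi>1 \<le> \<xi>2" "\<eta>1 \<le> \<eta>2" and l: "l > 0"
  defines "R \<equiv> {z :: real \<times> real. snd z + fst z \<in> {\<xi>1..\<xi>2} \<and> snd z - fst z \<in> {\<eta>1..\<eta>2}}"
  shows "(\<integral>\<^sup>+z. ennreal (indicator R z * indicator strip z * indicator {0<..} (fst z) * (exp (l * fst z) / sqrt (bdist (snd z)))) \<partial>lborel)
    \<le> ennreal (exp (l * ((\<xi>2 - \<eta>1) / 2)) / l * (4 * sqrt (min (\<xi>2 - \<xi>1) (\<eta>2 - \<eta>1))))"
proof -
  define h where "h z = indicator R z * indicator strip z * indicator {0<..} (fst z) * (exp (l * fst z) / sqrt (bdist (snd z)))" for z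
  define m where "m = min (\<xi>2 - \<xi>1) (\<eta>2 - \<eta>1)"
  have m0: "m \<ge> 0" using assms by (simp add: m_def)
  let ?\<tau> = "(\<xi>2 - \<eta>1) / 2"
  have closedR: "closed R"
    unfolding R_def by (intro closed_Collect_conj closed_Collect_le continuous_intros)
      (auto simp: atLeastAtMost_iff intro!: closed_Collect_conj closed_Collect_le continuous_intros)
  have meas: "(\<lambda>z. ennreal (h z)) \<in> borel_measurable (lborel \<Otimes>\<^sub>M lborel)"
  proof -
    have [measurable]: "R \<in> sets borel" "strip \<in> sets borel"
      using closedR open_strip by auto
    have [measurable]: "(\<lambda>z::real \<times> real. indicat_real {0<..} (fst z)) \<in> borel_measurable borel"
      "(\<lambda>z::real \<times> real. exp (l * fst z) / sqrt (bdist (snd z))) \<in> borel_measurable borel"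
      unfolding borel_prod[symmetric] by measurable
    have "h \<in> borel_measurable borel" unfolding h_def[abs_def] by measurable
    then show ?thesis by (simp add: lborel_prod)
  qed
  have slice: "(\<integral>\<^sup>+y. ennreal (h (s, y)) \<partial>lborel) \<le> ennreal (indicator {0<..?\<tau>} s * exp (l * s)) * ennreal (4 * sqrt m)" for s
  proof -
    obtain c where c: "\<And>y. (s, y) \<in> R \<Longrightarrow> y \<in> {c..c + m}"
    proof (cases "\<xi>2 - \<xi>1 \<le> \<eta>2 - \<eta>1")
      case True
      then show ?thesis by (intro that[of "\<xi>1 - s"]) (auto simp: R_def m_def)
    next
      case False
      then show ?thesis by (intro that[of "\<eta>1 + s"]) (auto simp: R_def m_def)
    qed
    have s: "s \<le> ?\<tau>" if "(s, y) \<in> R" for y using that by (auto simp: R_def)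
    have "ennreal (h (s, y)) \<le> ennreal (indicator {0<..?\<tau>} s * exp (l * s)) *
        ennreal (indicator {c..c + m} y * indicator {0<..<pi} y * (1 / sqrt (bdist y)))" for y
    proof -
      have "h (s, y) \<le> (indicator {0<..?\<tau>} s * exp (l * s)) * (indicator {c..c + m} y * indicator {0<..<pi} y * (1 / sqrt (bdist y)))"
        using c[of y] s[of y] by (auto simp: h_def indicator_def)
      then show ?thesis
        by (subst ennreal_mult[symmetric]) (auto intro!: ennreal_leI simp: indicator_def)
    qed
    then have "(\<integral>\<^sup>+y. ennreal (h (s, y)) \<partial>lborel) \<le> (\<integral>\<^sup>+y. ennreal (indicator {0<..?\<tau>} s * exp (l * s)) *
        ennreal (indicator {c..c + m} y * indicator {0<..<pi} y * (1 / sqrt (bdist y))) \<partial>lborel)"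
      by (intro nn_integral_mono)
    also have "\<dots> = ennreal (indicator {0<..?\<tau>} s * exp (l * s)) *
        (\<integral>\<^sup>+y. ennreal (indicator {c..c + m} y * indicator {0<..<pi} y * (1 / sqrt (bdist y))) \<partial>lborel)"
      by (rule nn_integral_cmult) measurable
    also have "\<dots> \<le> ennreal (indicator {0<..?\<tau>} s * exp (l * s)) * ennreal (4 * sqrt m)"
      using nn_integral_inverse_sqrt_bdist_le[of c "c + m"] m0 by (intro mult_left_mono) auto
    finally show ?thesis .
  qed
  have "(\<integral>\<^sup>+z. ennreal (h z) \<partial>lborel) = (\<integral>\<^sup>+s. \<integral>\<^sup>+y. ennreal (h (s, y)) \<partial>lborel \<partial>lborel)"
    using lborel.nn_integral_fst[OF meas] by (simp add: lborel_prod)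
  also have "\<dots> \<le> (\<integral>\<^sup>+s. ennreal (indicator {0<..?\<tau>} s * exp (l * s)) * ennreal (4 * sqrt m) \<partial>lborel)"
    by (intro nn_integral_mono slice)
  also have "\<dots> = (\<integral>\<^sup>+s. ennreal (indicator {0<..?\<tau>} s * exp (l * s)) \<partial>lborel) * ennreal (4 * sqrt m)"
    by (rule nn_integral_multc) measurable
  also have "\<dots> \<le> ennreal (exp (l * ?\<tau>) / l) * ennreal (4 * sqrt m)"
    by (intro mult_right_mono nn_integral_exp_le l) simp
  also have "\<dots> = ennreal (exp (l * ?\<tau>) / l * (4 * sqrt m))"
    using l m0 by (intro ennreal_mult[symmetric]) auto
  finally show ?thesis unfolding h_def m_def .
qed

section \<open>Vanishing of solutions with zero data\<close>

text \<open>2 sin x - x increases up to pi/3, where its derivative 2 cos x - 1 vanishes; from there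
  to pi/2 one has 2 sin x \<ge> sqrt 3 \<ge> 1.6 \<ge> pi/2. The symmetry about pi/2 does the
  rest.\<close>

lemma bdist_le_two_sin:
  assumes "0 \<le> x" "x \<le> pi"
  shows "bdist x \<le> 2 * sin x"
proof -
  have *: "x \<le> 2 * sin x" if x: "0 \<le> x" "x \<le> pi / 2" for x :: real
  proof (cases "x \<le> pi / 3")
    case True
    have "2 * sin 0 - 0 \<le> 2 * sin x - x"
    proof (rule DERIV_nonneg_imp_nondecreasing[OF x(1)])
      fix y assume y: "0 \<le> y" "y \<le> x"
      have "cos y \<ge> cos (pi / 3)" using y True by (intro cos_monotone_0_pi_le) auto
      then have "2 * cos y - 1 \<ge> 0" by (simp add: cos_60)
      moreover have "((\<lambda>x. 2 * sin x - x) has_real_derivative 2 * cos y - 1) (at y)"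
        by (auto intro!: derivative_eq_intros)
      ultimately show "\<exists>z. ((\<lambda>x. 2 * sin x - x) has_real_derivative z) (at y) \<and> 0 \<le> z" by blast
    qed
    then show ?thesis by simp
  next
    case False
    then have "sin (pi / 3) \<le> sin x" using x by (intro sin_monotone_2pi_le) auto
    then have "sqrt 3 \<le> 2 * sin x" by (simp add: sin_60)
    moreover have "1.6 \<le> sqrt 3" by (intro real_le_rsqrt) (simp add: power2_eq_square)
    moreover have "pi / 2 \<le> 1.6" using pi_approx by simp
    ultimately show ?thesis using x by linarith
  qed
  show ?thesis
  proof (cases "x \<le> pi / 2")
    case True
    then show ?thesis using *[of x] assms by simp
  next
    case False
    then show ?thesis using *[of "pi - x"] assms by simp
  qed
qed

text \<open>The letters w, s, n, e name the west, south, north and east corner values; a, b, c, d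
  are their mollified averages, with the factor 1/2 from the Jacobian.\<close>

lemma four_corners_bound:
  fixes a b c d :: real
  assumes "\<bar>4 * (a - b - c + d)\<bar> \<le> K"
    and "\<bar>a - w / 2\<bar> \<le> h" "\<bar>b - s / 2\<bar> \<le> h" "\<bar>c - n / 2\<bar> \<le> h" "\<bar>d - e / 2\<bar> \<le> h"
  shows "\<bar>n\<bar> \<le> \<bar>w\<bar> + \<bar>e\<bar> + \<bar>s\<bar> + 8 * h + K / 2"
proof (rule abs_leI)
  have *: "w \<le> \<bar>w\<bar>" "- w \<le> \<bar>w\<bar>" "e \<le> \<bar>e\<bar>" "- e \<le> \<bar>e\<bar>" "s \<le> \<bar>s\<bar>" "- s \<le> \<bar>s\<bar>" by auto
  show "n \<le> \<bar>w\<bar> + \<bar>e\<bar> + \<bar>s\<bar> + 8 * h + K / 2" "- n \<le> \<bar>w\<bar> + \<bar>e\<bar> + \<bar>s\<bar> + 8 * h + K / 2"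
    using assms[unfolded abs_le_iff] * by argo+
qed

text \<open>Isolated because it is instantiated twice, with the difference of two solutions and with
  its time reflection; this is why \<open>small\<close> looks only at s \<ge> 0.\<close>

locale vanishing_data_wave =
  fixes w F :: "real \<times> real \<Rightarrow> real"
  assumes weak: "weak_wave w F"
    and cw: "continuous_on (UNIV \<times> {0..pi}) w" and cF: "continuous_on strip F"
    and boundary: "w (t, 0) = 0" "w (t, pi) = 0"
    and initial: "x \<in> {0..pi} \<Longrightarrow> w (0, x) = 0"
    and small: "c > 0 \<Longrightarrow> \<exists>\<delta>>0. \<forall>s. 0 \<le> s \<and> s < \<delta> \<longrightarrow>
        (\<integral>x. indicator {0..pi} x * \<bar>w (s, x)\<bar> \<partial>lborel) \<le> c * s"
begin

text \<open>Extension by zero to the past, continuous across t = 0 inside the strip because w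
  vanishes there. Rectangles may then reach below time 0, where their corners contribute
  nothing.\<close>

definition W :: "real \<times> real \<Rightarrow> real" where
  "W z = indicator strip z * (if fst z \<le> 0 then 0 else w z)"

lemma W_eq_0: "s \<le> 0 \<Longrightarrow> W (s, y) = 0"
  by (simp add: W_def)

lemma W_eq: "s > 0 \<Longrightarrow> y \<in> {0<..<pi} \<Longrightarrow> W (s, y) = w (s, y)"
  by (simp add: W_def)

lemma continuous_on_W: "continuous_on strip (\<lambda>z. if fst z \<le> 0 then 0 else w z)"
proof (rule continuous_on_cases_le)
  show "continuous_on {z \<in> strip. 0 \<le> fst z} w"
    by (rule continuous_on_subset[OF cw]) auto
qed (auto intro!: continuous_intros simp: initial split: prod.splits)

lemma isCont_W:
  assumes "z \<in> strip"
  shows "isCont W z"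
proof -
  have "continuous_on strip W"
    by (rule continuous_on_eq[OF continuous_on_W]) (simp add: W_def)
  then show ?thesis using assms continuous_on_eq_continuous_at[OF open_strip] by blast
qed

lemma borel_measurable_W: "W \<in> borel_measurable borel"
  using borel_measurable_continuous_on_indicator[OF _ continuous_on_W] open_strip
  by (simp add: W_def[abs_def])

lemma W_near:
  assumes x: "x \<in> {0<..<pi}" and "\<eta> > 0"
  shows "\<forall>\<^sub>F \<epsilon> in at_right 0. \<forall>s y. y + s \<in> {x + t..x + t + \<epsilon>} \<longrightarrow> y - s \<in> {x - t..x - t + \<epsilon>} \<longrightarrow>
    \<bar>W (s, y) - W (t, x)\<bar> \<le> \<eta>"
proof -
  have "isCont W (t, x)" using x by (intro isCont_W) auto
  then obtain d where d: "d > 0" "\<And>z. dist z (t, x) < d \<Longrightarrow> dist (W z) (W (t, x)) < \<eta>"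
    unfolding continuous_at_eps_delta using \<open>\<eta> > 0\<close> by blast
  show ?thesis
    unfolding eventually_at_right_field
  proof (intro exI[of _ "d / 2"] conjI allI impI)
    fix \<epsilon> s y assume e: "0 < \<epsilon>" "\<epsilon> < d / 2"
      and sy: "y + s \<in> {x + t..x + t + \<epsilon>}" "y - s \<in> {x - t..x - t + \<epsilon>}"
    have "\<bar>s - t\<bar> \<le> \<epsilon>" "\<bar>y - x\<bar> \<le> \<epsilon>" using sy by (auto simp: abs_le_iff)
    then have "dist (s, y) (t, x) < d"
      using e dist_Pair_Pair[of s y t x] sqrt_sum_squares_le_sum_abs[of "s - t" "y - x"]
      by (simp add: dist_real_def)
    then show "\<bar>W (s, y) - W (t, x)\<bar> \<le> \<eta>" using d(2)[of "(s, y)"] by (simp add: dist_real_def)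
  qed (use d in auto)
qed

text \<open>Testing with the product of two plateaus in the characteristic variables concentrates the
  left-hand side of the weak equation at the four corners of a characteristic rectangle.\<close>

lemma characteristic_rectangle_inequality:
  assumes \<alpha>: "0 < \<alpha>" "\<alpha> < x" and \<beta>: "0 < \<beta>" "x + \<beta> < pi" and t: "t < T" and L: "L \<ge> 0" "l > 0"
    and F: "\<And>s y. 0 < s \<Longrightarrow> s < T \<Longrightarrow> y \<in> {0<..<pi} \<Longrightarrow> \<bar>F (s, y)\<bar> \<le> L * (exp (l * s) / sqrt (bdist y))"
  shows "\<bar>W (t, x)\<bar> \<le> \<bar>W (t - \<alpha>, x - \<alpha>)\<bar> + \<bar>W (t - \<beta>, x + \<beta>)\<bar> + \<bar>W (t - \<alpha> - \<beta>, x - \<alpha> + \<beta>)\<bar>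
      + 2 * L * (exp (l * t) / l) * sqrt (2 * min \<alpha> \<beta>)"
    (is "_ \<le> ?S + _")
proof (rule field_le_epsilon)
  fix e :: real assume "e > 0"
  \<comment> \<open>Each of the four corners contributes an error \<eta> to the bound for W (t,
    x).\<close>
  define \<eta> where "\<eta> = e / 4"
  have \<eta>: "\<eta> > 0" using \<open>e > 0\<close> by (simp add: \<eta>_def)
  \<comment> \<open>The majorant integral over the rectangle enlarged by the ramps of length
    \<epsilon>.\<close>
  define M where "M \<epsilon> = exp (l * (t + \<epsilon> / 2)) / l * (4 * sqrt (min (2 * \<alpha> + \<epsilon>) (2 * \<beta> + \<epsilon>)))" for \<epsilon>
  \<comment> \<open>The condition \<epsilon> < pi - x - \<beta> keeps the enlarged rectangle inside
    the strip, and \<epsilon> < 2 (T - t) keeps its top below time T, where \<open>F\<close> is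
    controlled.\<close>
  have key: "\<bar>W (t, x)\<bar> \<le> ?S + 4 * \<eta> + L * M \<epsilon> / 2"
    if e: "0 < \<epsilon>" "\<epsilon> < pi - x - \<beta>" "\<epsilon> < 2 * (T - t)" "\<epsilon> < 2 * \<alpha>" "\<epsilon> < 2 * \<beta>"
      and nN: "\<And>s y. y + s \<in> {x + t..x + t + \<epsilon>} \<Longrightarrow> y - s \<in> {x - t..x - t + \<epsilon>} \<Longrightarrow> \<bar>W (s, y) - W (t, x)\<bar> \<le> \<eta>"
      and nW: "\<And>s y. y + s \<in> {(x - \<alpha>) + (t - \<alpha>)..(x - \<alpha>) + (t - \<alpha>) + \<epsilon>} \<Longrightarrow>
        y - s \<in> {(x - \<alpha>) - (t - \<alpha>)..(x - \<alpha>) - (t - \<alpha>) + \<epsilon>} \<Longrightarrow> \<bar>W (s, y) - W (t - \<alpha>, x - \<alpha>)\<bar> \<le> \<eta>"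
      and nE: "\<And>s y. y + s \<in> {(x + \<beta>) + (t - \<beta>)..(x + \<beta>) + (t - \<beta>) + \<epsilon>} \<Longrightarrow>
        y - s \<in> {(x + \<beta>) - (t - \<beta>)..(x + \<beta>) - (t - \<beta>) + \<epsilon>} \<Longrightarrow> \<bar>W (s, y) - W (t - \<beta>, x + \<beta>)\<bar> \<le> \<eta>"
      and nS: "\<And>s y. y + s \<in> {(x - \<alpha> + \<beta>) + (t - \<alpha> - \<beta>)..(x - \<alpha> + \<beta>) + (t - \<alpha> - \<beta>) + \<epsilon>} \<Longrightarrow>
        y - s \<in> {(x - \<alpha> + \<beta>) - (t - \<alpha> - \<beta>)..(x - \<alpha> + \<beta>) - (t - \<alpha> - \<beta>) + \<epsilon>} \<Longrightarrow>
        \<bar>W (s, y) - W (t - \<alpha> - \<beta>, x - \<alpha> + \<beta>)\<bar> \<le> \<eta>" for \<epsilon>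
  proof -
    \<comment> \<open>In these coordinates (t, x) is the corner with largest x + t and smallest x -
      t, so the other three lie at earlier times.\<close>
    define \<xi>1 \<xi>2 \<eta>1 \<eta>2 where "\<xi>1 = x + t - 2 * \<alpha>" and "\<xi>2 = x + t" and "\<eta>1 = x - t" and "\<eta>2 = x - t + 2 * \<beta>"
    note defs = \<xi>1_def \<xi>2_def \<eta>1_def \<eta>2_def
    let ?a = "plateau \<epsilon> \<xi>1 \<xi>2" and ?b = "plateau \<epsilon> \<eta>1 \<eta>2"
    have da: "deriv ?a y = bump \<epsilon> \<xi>1 y - bump \<epsilon> \<xi>2 y" "deriv ?b y = bump \<epsilon> \<eta>1 y - bump \<epsilon> \<eta>2 y" for y
      using plateau_has_deriv[OF e(1)] by (auto intro!: DERIV_imp_deriv)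
    define J where "J p q = (\<integral>z. W z * (bump \<epsilon> p (snd z + fst z) * bump \<epsilon> q (snd z - fst z)) \<partial>lborel)" for p q
    define f where "f z = indicator strip z * (F z * (?a (snd z + fst z) * ?b (snd z - fst z))) * indicator {0<..} (fst z)" for z
    have id: "(\<integral>z. indicator strip z * (w z * (4 * deriv ?a (snd z + fst z) * deriv ?b (snd z - fst z))) * indicator {0<..} (fst z) \<partial>lborel)
        = (\<integral>z. f z \<partial>lborel)"
      unfolding f_def
    proof (rule weak_wave_half_space[OF weak cw cF small smooth_plateau smooth_plateau])
      show "?a y = 0" "deriv ?a y = 0" if "y \<notin> {\<xi>1..\<xi>2 + \<epsilon>}" for y
      proof -
        have "y < \<xi>1 \<or> y > \<xi>2 + \<epsilon>" "\<xi>1 \<le> \<xi>2" using that \<alpha> by (auto simp: defs)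
        then show "?a y = 0" "deriv ?a y = 0"
          using plateau_eq_0[OF e(1), of \<xi>1 \<xi>2 y] bump_eq_0[OF e(1), of y \<xi>1] bump_eq_0[OF e(1), of y \<xi>2] e(1)
          unfolding da by auto
      qed
      show "?b y = 0" "deriv ?b y = 0" if "y \<notin> {\<eta>1..\<eta>2 + \<epsilon>}" for y
      proof -
        have "y < \<eta>1 \<or> y > \<eta>2 + \<epsilon>" "\<eta>1 \<le> \<eta>2" using that \<beta> by (auto simp: defs)
        then show "?b y = 0" "deriv ?b y = 0"
          using plateau_eq_0[OF e(1), of \<eta>1 \<eta>2 y] bump_eq_0[OF e(1), of y \<eta>1] bump_eq_0[OF e(1), of y \<eta>2] e(1)
          unfolding da by auto
      qed
      show "0 < \<xi>1 + \<eta>1" "\<xi>2 + \<epsilon> + (\<eta>2 + \<epsilon>) < 2 * pi"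
        using \<alpha> e by (auto simp: defs)
    qed
    have corners: "(x - \<alpha>) + (t - \<alpha>) = \<xi>1" "(x - \<alpha>) - (t - \<alpha>) = \<eta>1" "x + t = \<xi>2" "x - t = \<eta>1"
      "(x + \<beta>) + (t - \<beta>) = \<xi>2" "(x + \<beta>) - (t - \<beta>) = \<eta>2"
      "(x - \<alpha> + \<beta>) + (t - \<alpha> - \<beta>) = \<xi>1" "(x - \<alpha> + \<beta>) - (t - \<alpha> - \<beta>) = \<eta>2"
      by (auto simp: defs)
    have av: "integrable lborel (\<lambda>z. W z * (bump \<epsilon> p (snd z + fst z) * bump \<epsilon> q (snd z - fst z)))"
        "\<bar>J p q - c / 2\<bar> \<le> \<eta> / 2"
      if "\<And>s y. y + s \<in> {p..p + \<epsilon>} \<Longrightarrow> y - s \<in> {q..q + \<epsilon>} \<Longrightarrow> \<bar>W (s, y) - c\<bar> \<le> \<eta>" for p q c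
      unfolding J_def using corner_average[OF e(1) borel_measurable_W, of p q c \<eta>] that by blast+
    have cW: "integrable lborel (\<lambda>z. W z * (bump \<epsilon> \<xi>1 (snd z + fst z) * bump \<epsilon> \<eta>1 (snd z - fst z)))"
        "\<bar>J \<xi>1 \<eta>1 - W (t - \<alpha>, x - \<alpha>) / 2\<bar> \<le> \<eta> / 2"
      by (rule av, rule nW[unfolded corners], assumption+)+
    have cN: "integrable lborel (\<lambda>z. W z * (bump \<epsilon> \<xi>2 (snd z + fst z) * bump \<epsilon> \<eta>1 (snd z - fst z)))"
        "\<bar>J \<xi>2 \<eta>1 - W (t, x) / 2\<bar> \<le> \<eta> / 2"
      by (rule av, rule nN[unfolded corners], assumption+)+
    have cE: "integrable lborel (\<lambda>z. W z * (bump \<epsilon> \<xi>2 (snd z + fst z) * bump \<epsilon> \<eta>2 (snd z - fst z)))"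
        "\<bar>J \<xi>2 \<eta>2 - W (t - \<beta>, x + \<beta>) / 2\<bar> \<le> \<eta> / 2"
      by (rule av, rule nE[unfolded corners], assumption+)+
    have cS: "integrable lborel (\<lambda>z. W z * (bump \<epsilon> \<xi>1 (snd z + fst z) * bump \<epsilon> \<eta>2 (snd z - fst z)))"
        "\<bar>J \<xi>1 \<eta>2 - W (t - \<alpha> - \<beta>, x - \<alpha> + \<beta>) / 2\<bar> \<le> \<eta> / 2"
      by (rule av, rule nS[unfolded corners], assumption+)+
    have "indicator strip z * (w z * (4 * deriv ?a (snd z + fst z) * deriv ?b (snd z - fst z))) * indicator {0<..} (fst z) =
        4 * (W z * (bump \<epsilon> \<xi>1 (snd z + fst z) * bump \<epsilon> \<eta>1 (snd z - fst z))
         - W z * (bump \<epsilon> \<xi>1 (snd z + fst z) * bump \<epsilon> \<eta>2 (snd z - fst z))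
         - W z * (bump \<epsilon> \<xi>2 (snd z + fst z) * bump \<epsilon> \<eta>1 (snd z - fst z))
         + W z * (bump \<epsilon> \<xi>2 (snd z + fst z) * bump \<epsilon> \<eta>2 (snd z - fst z)))" for z
      by (simp add: da W_def algebra_simps indicator_def)
    then have J: "(\<integral>z. f z \<partial>lborel) = 4 * (J \<xi>1 \<eta>1 - J \<xi>1 \<eta>2 - J \<xi>2 \<eta>1 + J \<xi>2 \<eta>2)"
      unfolding id[symmetric] J_def using cW(1) cN(1) cE(1) cS(1) by simp
    have M0: "M \<epsilon> \<ge> 0" using L \<alpha> \<beta> e by (simp add: M_def)
    have "\<bar>\<integral>z. f z \<partial>lborel\<bar> \<le> L * M \<epsilon>"
    \<comment> \<open>A function that is not integrable has Bochner integral 0 by convention, which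
      settles that case.\<close>
    proof (cases "integrable lborel f")
      case False
      then show ?thesis using L M0 by (simp add: not_integrable_integral_eq)
    next
      case True
      define R where "R = {z :: real \<times> real. snd z + fst z \<in> {\<xi>1..\<xi>2 + \<epsilon>} \<and> snd z - fst z \<in> {\<eta>1..\<eta>2 + \<epsilon>}}"
      let ?h = "\<lambda>z. indicator R z * indicator strip z * indicator {0<..} (fst z) * (exp (l * fst z) / sqrt (bdist (snd z))) :: real"
      have "ennreal \<bar>\<integral>z. f z \<partial>lborel\<bar> \<le> (\<integral>\<^sup>+z. ennreal \<bar>f z\<bar> \<partial>lborel)"
        using integral_norm_bound_ennreal[OF True] by simp
      also have "\<dots> \<le> (\<integral>\<^sup>+z. ennreal L * ennreal (?h z) \<partial>lborel)"
      proof (rule nn_integral_mono)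
        fix z :: "real \<times> real"
        obtain s y where z: "z = (s, y)" by (cases z)
        have "\<bar>f z\<bar> \<le> L * ?h z"
        proof (cases "z \<in> R \<and> z \<in> strip \<and> s > 0")
          case True
          then have "2 * s \<le> \<xi>2 + \<epsilon> - \<eta>1" by (auto simp: R_def z)
          then have "s < T" using e by (simp add: defs)
          have y: "y \<in> {0<..<pi}" using True by (auto simp: z)
          have pa: "0 \<le> ?a (y + s)" "?a (y + s) \<le> 1" "0 \<le> ?b (y - s)" "?b (y - s) \<le> 1"
            using plateau_bounds e \<alpha> \<beta> by (auto simp: defs)
          then have "?a (y + s) * ?b (y - s) \<le> 1" by (simp add: mult_le_one)
          then have "\<bar>F z\<bar> * (?a (y + s) * ?b (y - s)) \<le> \<bar>F z\<bar>" by (simp add: mult_left_le)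
          moreover have "\<bar>F z\<bar> \<le> L * (exp (l * s) / sqrt (bdist y))"
            using F[of s y] True \<open>s < T\<close> y by (simp add: z)
          ultimately have "\<bar>F z\<bar> * (?a (y + s) * ?b (y - s)) \<le> L * (exp (l * s) / sqrt (bdist y))" by linarith
          moreover have "\<bar>f z\<bar> = \<bar>F z\<bar> * (?a (y + s) * ?b (y - s))"
            using True pa unfolding f_def by (simp add: z abs_mult)
          ultimately show ?thesis using True by (simp add: z)
        next
          case False
          then have "f z = 0"
          proof (cases "z \<in> R")
            case True
            then show ?thesis using False unfolding f_def by (auto simp: z)
          next
            case False
            then have "?a (snd z + fst z) = 0 \<or> ?b (snd z - fst z) = 0"
              using plateau_eq_0[of \<epsilon> \<xi>1 \<xi>2 "y + s"] plateau_eq_0[of \<epsilon> \<eta>1 \<eta>2 "y - s"] e \<alpha> \<beta>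
              by (auto simp: R_def z defs)
            then show ?thesis by (auto simp: f_def)
          qed
          then show ?thesis using L by (auto simp: z indicator_def)
        qed
        moreover have "?h z \<ge> 0" by (auto simp: indicator_def z)
        ultimately show "ennreal \<bar>f z\<bar> \<le> ennreal L * ennreal (?h z)"
          using L(1) by (simp only: ennreal_mult[symmetric]) (rule ennreal_leI)
      qed
      also have "\<dots> = ennreal L * (\<integral>\<^sup>+z. ennreal (?h z) \<partial>lborel)"
      proof (rule nn_integral_cmult)
        have "closed R"
          unfolding R_def by (auto simp: atLeastAtMost_iff intro!: closed_Collect_conj closed_Collect_le continuous_intros)
        then have [measurable]: "R \<in> sets borel" "strip \<in> sets borel"
          using open_strip by auto
        have [measurable]: "(\<lambda>z::real \<times> real. indicat_real {0<..} (fst z)) \<in> borel_measurable borel"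
          "(\<lambda>z::real \<times> real. exp (l * fst z) / sqrt (bdist (snd z))) \<in> borel_measurable borel"
          unfolding borel_prod[symmetric] by measurable
        show "(\<lambda>z. ennreal (?h z)) \<in> borel_measurable lborel" by measurable
      qed
      also have "\<dots> \<le> ennreal L * ennreal (exp (l * ((\<xi>2 + \<epsilon> - \<eta>1) / 2)) / l * (4 * sqrt (min (\<xi>2 + \<epsilon> - \<xi>1) (\<eta>2 + \<epsilon> - \<eta>1))))"
        unfolding R_def using e \<alpha> \<beta> L by (intro mult_left_mono nn_integral_majorant_le) (auto simp: defs)
      also have "\<dots> = ennreal L * ennreal (M \<epsilon>)"
      proof -
        have "(\<xi>2 + \<epsilon> - \<eta>1) / 2 = t + \<epsilon> / 2" "\<xi>2 + \<epsilon> - \<xi>1 = 2 * \<alpha> + \<epsilon>" "\<eta>2 + \<epsilon> - \<eta>1 = 2 * \<beta> + \<epsilon>"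
          by (auto simp: defs field_simps)
        then show ?thesis by (simp only: M_def)
      qed
      also have "\<dots> = ennreal (L * M \<epsilon>)" using L(1) M0 by (rule ennreal_mult[symmetric])
      finally show ?thesis using L(1) M0 by (subst (asm) ennreal_le_iff) auto
    qed
    then have "\<bar>4 * (J \<xi>1 \<eta>1 - J \<xi>1 \<eta>2 - J \<xi>2 \<eta>1 + J \<xi>2 \<eta>2)\<bar> \<le> L * M \<epsilon>" by (simp only: J)
    from four_corners_bound[OF this cW(2) cS(2) cN(2) cE(2)] show ?thesis by simp
  qed
  have "\<forall>\<^sub>F \<epsilon> in at_right 0. \<bar>W (t, x)\<bar> \<le> ?S + 4 * \<eta> + L * M \<epsilon> / 2"
  proof -
    have ev: "\<forall>\<^sub>F \<epsilon> in at_right 0. \<epsilon> < c" if "c > 0" for c :: real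
      using that by (auto simp: eventually_at_right_field)
    have x: "x \<in> {0<..<pi}" "x - \<alpha> \<in> {0<..<pi}" "x + \<beta> \<in> {0<..<pi}" "x - \<alpha> + \<beta> \<in> {0<..<pi}"
      using \<alpha> \<beta> by auto
    have pos: "0 < pi - x - \<beta>" "0 < 2 * (T - t)" "0 < 2 * \<alpha>" "0 < 2 * \<beta>"
      using \<alpha> \<beta> t by auto
    show ?thesis
      using W_near[OF x(1) \<eta>, of t] W_near[OF x(2) \<eta>, of "t - \<alpha>"] W_near[OF x(3) \<eta>, of "t - \<beta>"]
        W_near[OF x(4) \<eta>, of "t - \<alpha> - \<beta>"] ev[OF pos(1)] ev[OF pos(2)] ev[OF pos(3)] ev[OF pos(4)]
        eventually_at_right_less[of 0]
    proof eventually_elim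
      case (elim \<epsilon>)
      then show ?case by (intro key) blast+
    qed
  qed
  moreover have "((\<lambda>\<epsilon>. ?S + 4 * \<eta> + L * M \<epsilon> / 2) \<longlongrightarrow> ?S + 4 * \<eta> + L * M 0 / 2) (at_right 0)"
    unfolding M_def using L by (intro tendsto_intros) auto
  ultimately have "\<bar>W (t, x)\<bar> \<le> ?S + 4 * \<eta> + L * M 0 / 2"
    by (intro tendsto_lowerbound[where F="at_right 0"]) auto
  moreover have "L * M 0 / 2 = 2 * L * (exp (l * t) / l) * sqrt (2 * min \<alpha> \<beta>)"
    by (simp add: M_def min_mult_distrib_left)
  ultimately show "\<bar>W (t, x)\<bar> \<le> ?S + 2 * L * (exp (l * t) / l) * sqrt (2 * min \<alpha> \<beta>) + e"
    by (simp add: \<eta>_def)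
qed

text \<open>The rectangle is chosen to reach both sides of the strip, where \<open>w\<close> vanishes; its lower corner
  lies a time \<open>\<pi>\<close> earlier, which the exponential weight turns into a gain.\<close>

lemma halve_bound:
  assumes Q: "Q \<ge> 0" and l: "l \<ge> 1" "l \<ge> 16 * Q" and A: "A \<ge> 0"
    and F: "\<And>s y. 0 < s \<Longrightarrow> s < T \<Longrightarrow> y \<in> {0<..<pi} \<Longrightarrow> \<bar>F (s, y)\<bar> \<le> Q * \<bar>w (s, y)\<bar> / bdist y"
    and bound: "\<And>s y. 0 < s \<Longrightarrow> s < T \<Longrightarrow> y \<in> {0..pi} \<Longrightarrow> \<bar>w (s, y)\<bar> \<le> A * exp (l * s) * sqrt (bdist y)"
    and t: "0 < t" "t < T" and x: "x \<in> {0..pi}"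
  shows "\<bar>w (t, x)\<bar> \<le> A / 2 * exp (l * t) * sqrt (bdist x)"
proof (cases "x = 0 \<or> x = pi")
  case True
  then show ?thesis using boundary by auto
next
  case False
  then have x: "x \<in> {0<..<pi}" using x by auto
  \<comment> \<open>At times s \<le> 0 the left side is 0, so the bound extends to the whole
    past.\<close>
  have Wb: "\<bar>W (s, y)\<bar> \<le> A * exp (l * s) * sqrt (bdist y)" if "s < T" "y \<in> {0<..<pi}" for s y
    using bound[of s y] W_eq[of s y] W_eq_0[of s y] A that by (cases "s > 0") auto
  have FL: "\<bar>F (s, y)\<bar> \<le> (Q * A) * (exp (l * s) / sqrt (bdist y))" if "0 < s" "s < T" "y \<in> {0<..<pi}" for s y
  proof -
    have b: "bdist y > 0" using that by auto
    have "\<bar>F (s, y)\<bar> \<le> Q * \<bar>w (s, y)\<bar> / bdist y" using F[OF that] .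
    also have "\<dots> \<le> Q * (A * exp (l * s) * sqrt (bdist y)) / bdist y"
      using bound[of s y] that b Q by (intro divide_right_mono mult_left_mono) auto
    also have "\<dots> = (Q * A) * (exp (l * s) * (sqrt (bdist y) / bdist y))"
      by simp
    also have "sqrt (bdist y) / bdist y = 1 / sqrt (bdist y)"
      using b by (simp add: real_div_sqrt field_simps del: min_less_iff_conj)
    finally show ?thesis by simp
  qed
  define X where "X = sqrt (bdist x)"
  have X: "X \<ge> 0" using x by (auto simp: X_def)
  let ?E = "exp (l * t)"
  \<comment> \<open>In order: the two side corners, the lower corner, the source. The first summand
    disappears as \<delta> tends to 0.\<close>
  define Y where "Y \<delta> = 2 * (A * ?E * sqrt \<delta>) + A * exp (l * (t - pi + 2 * \<delta>)) * X + 2 * (Q * A) * (?E / l) * (sqrt 2 * X)" for \<delta>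
  have key: "\<bar>w (t, x)\<bar> \<le> Y \<delta>" if d: "0 < \<delta>" "\<delta> < x" "\<delta> < pi - x" for \<delta>
  proof -
    \<comment> \<open>The side corners stop at distance \<delta> from the boundary, since test
      functions live in the open strip.\<close>
    define \<alpha> \<beta> where "\<alpha> = x - \<delta>" and "\<beta> = pi - x - \<delta>"
    have "\<bar>W (t, x)\<bar> \<le> \<bar>W (t - \<alpha>, x - \<alpha>)\<bar> + \<bar>W (t - \<beta>, x + \<beta>)\<bar> + \<bar>W (t - \<alpha> - \<beta>, x - \<alpha> + \<beta>)\<bar>
        + 2 * (Q * A) * (?E / l) * sqrt (2 * min \<alpha> \<beta>)"
      by (rule characteristic_rectangle_inequality[OF _ _ _ _ t(2) _ _ FL])
        (use d x Q A l in \<open>auto simp: \<alpha>_def \<beta>_def\<close>)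
    moreover have "\<bar>W (t - \<alpha>, x - \<alpha>)\<bar> \<le> A * ?E * sqrt \<delta>"
    proof -
      have "\<bar>W (t - \<alpha>, x - \<alpha>)\<bar> \<le> A * exp (l * (t - \<alpha>)) * sqrt (bdist (x - \<alpha>))"
        using d x t by (intro Wb) (auto simp: \<alpha>_def)
      also have "\<dots> \<le> A * ?E * sqrt \<delta>"
        using d x A l by (intro mult_mono mult_left_mono) (auto simp: \<alpha>_def)
      finally show ?thesis .
    qed
    moreover have "\<bar>W (t - \<beta>, x + \<beta>)\<bar> \<le> A * ?E * sqrt \<delta>"
    proof -
      have "\<bar>W (t - \<beta>, x + \<beta>)\<bar> \<le> A * exp (l * (t - \<beta>)) * sqrt (bdist (x + \<beta>))"
        using d x t by (intro Wb) (auto simp: \<beta>_def)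
      also have "\<dots> \<le> A * ?E * sqrt \<delta>"
        using d x A l by (intro mult_mono mult_left_mono) (auto simp: \<beta>_def)
      finally show ?thesis .
    qed
    moreover have "\<bar>W (t - \<alpha> - \<beta>, x - \<alpha> + \<beta>)\<bar> \<le> A * exp (l * (t - pi + 2 * \<delta>)) * X"
    proof -
      \<comment> \<open>The lower corner sits at the mirror point pi - x, which is as far from the
        boundary as x.\<close>
      have eq: "t - \<alpha> - \<beta> = t - pi + 2 * \<delta>" "x - \<alpha> + \<beta> = pi - x" by (auto simp: \<alpha>_def \<beta>_def)
      have "\<bar>W (t - pi + 2 * \<delta>, pi - x)\<bar> \<le> A * exp (l * (t - pi + 2 * \<delta>)) * sqrt (bdist (pi - x))"
        using d x t by (intro Wb) auto
      then show ?thesis unfolding eq X_def by (simp add: min.commute)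
    qed
    moreover have "2 * (Q * A) * (?E / l) * sqrt (2 * min \<alpha> \<beta>) \<le> 2 * (Q * A) * (?E / l) * (sqrt 2 * X)"
      unfolding X_def real_sqrt_mult[symmetric]
      using d x Q A l by (intro mult_left_mono real_sqrt_le_mono) (auto simp: \<alpha>_def \<beta>_def)
    ultimately show ?thesis using W_eq[OF t(1) x] unfolding Y_def by linarith
  qed
  have "\<forall>\<^sub>F \<delta> in at_right 0. \<bar>w (t, x)\<bar> \<le> Y \<delta>"
    unfolding eventually_at_right_field using x key by (intro exI[of _ "bdist x"]) auto
  moreover have "(Y \<longlongrightarrow> Y 0) (at_right 0)"
    unfolding Y_def[abs_def] by (intro tendsto_intros)
  ultimately have "\<bar>w (t, x)\<bar> \<le> Y 0"
    by (intro tendsto_lowerbound[where F="at_right 0"]) auto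
  also have "Y 0 \<le> A / 2 * ?E * X"
  proof -
    \<comment> \<open>First quarter: the delay is pi > 3 and l \<ge> 1, while exp 3 \<ge> 1 +
      3.\<close>
    have "exp (l * (t - pi)) \<le> ?E / 4"
    proof -
      have "4 \<le> exp (3::real)" using exp_ge_add_one_self[of 3] by simp
      also have "\<dots> \<le> exp (l * pi)" using l pi_gt3 mult_mono[of 1 l 3 pi] by simp
      finally show ?thesis by (simp add: right_diff_distrib exp_diff field_simps)
    qed
    then have 1: "A * exp (l * (t - pi)) * X \<le> A * (?E / 4) * X"
      using A X by (intro mult_right_mono mult_left_mono) auto
    \<comment> \<open>Second quarter: replacing sqrt 2 by 2 makes the coefficient 4 Q / l, which is
      at most 1/4 by l \<ge> 16 Q.\<close>
    have "sqrt 2 \<le> 2" by (intro real_le_lsqrt) auto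
    then have "2 * Q * sqrt 2 \<le> 2 * Q * 2" using Q by (intro mult_left_mono) auto
    then have "2 * Q * sqrt 2 / l \<le> 1 / 4" using l by (simp add: field_simps)
    then have "(2 * Q * sqrt 2 / l) * (A * ?E * X) \<le> (1 / 4) * (A * ?E * X)"
      using A X by (intro mult_right_mono) auto
    then have 2: "2 * (Q * A) * (?E / l) * (sqrt 2 * X) \<le> (1 / 4) * (A * ?E * X)"
      by (simp add: algebra_simps)
    show ?thesis using 1 2 unfolding Y_def by simp
  qed
  finally show ?thesis unfolding X_def .
qed

text \<open>Iteration of \<open>halve_bound\<close>: the rate \<open>l\<close> depends on Q alone,
  so it is the same at every stage, and the constants B / 2^n tend to 0.\<close>

lemma vanishes:
  assumes Q: "Q \<ge> 0" and B: "B \<ge> 0"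
    and F: "\<And>s y. 0 < s \<Longrightarrow> s < T \<Longrightarrow> y \<in> {0<..<pi} \<Longrightarrow> \<bar>F (s, y)\<bar> \<le> Q * \<bar>w (s, y)\<bar> / bdist y"
    and bound: "\<And>s y. 0 < s \<Longrightarrow> s < T \<Longrightarrow> y \<in> {0..pi} \<Longrightarrow> \<bar>w (s, y)\<bar> \<le> B * sqrt (bdist y)"
    and t: "0 < t" "t < T" and x: "x \<in> {0..pi}"
  shows "w (t, x) = 0"
proof -
  define l where "l = 1 + 16 * Q"
  have l: "l \<ge> 1" "l \<ge> 16 * Q" using Q by (auto simp: l_def)
  have *: "\<bar>w (s, y)\<bar> \<le> B / 2 ^ n * exp (l * s) * sqrt (bdist y)" if "0 < s" "s < T" "y \<in> {0..pi}" for n s y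
    using that
  proof (induction n arbitrary: s y)
    case 0
    have "B * 1 * sqrt (bdist y) \<le> B * exp (l * s) * sqrt (bdist y)"
      using 0 B l by (intro mult_right_mono mult_left_mono) auto
    then show ?case using bound[of s y] 0 by simp
  next
    case (Suc n)
    have "\<bar>w (s, y)\<bar> \<le> B / 2 ^ n / 2 * exp (l * s) * sqrt (bdist y)"
      by (rule halve_bound[OF Q l _ F Suc.IH]) (use B Suc.prems in auto)
    then show ?case by (simp add: field_simps)
  qed
  have "(\<lambda>n. B * exp (l * t) * sqrt (bdist x) * (1 / 2) ^ n) \<longlonglongrightarrow> B * exp (l * t) * sqrt (bdist x) * 0"
    by (intro tendsto_intros LIMSEQ_power_zero) simp
  moreover have "\<bar>w (t, x)\<bar> \<le> B * exp (l * t) * sqrt (bdist x) * (1 / 2) ^ n" for n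
    using *[OF t x, of n] by (simp add: power_one_over field_simps)
  ultimately have "\<bar>w (t, x)\<bar> \<le> B * exp (l * t) * sqrt (bdist x) * 0"
    by (intro LIMSEQ_le_const) auto
  then show ?thesis by simp
qed

end

section \<open>Uniqueness for the cubic equation\<close>

lemma L1_le_L2_norm:
  assumes "continuous_on {0..pi} g"
  shows "(\<integral>x. indicator {0..pi} x * \<bar>g x\<bar> \<partial>lborel) \<le> sqrt pi * L2_norm g"
proof -
  have c: "continuous_on {0..pi} (\<lambda>x. \<bar>g x\<bar>)" by (intro continuous_intros assms)
  have L1: "in_L2 (\<lambda>x. 1)" by (intro in_L2_continuous continuous_intros)
  have "integrable lborel (\<lambda>x. indicator {0..pi} x *\<^sub>R \<bar>g x\<bar>)"
    by (intro borel_integrable_compact compact_Icc c)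
  then have "(\<integral>x. indicator {0..pi} x * \<bar>g x\<bar> \<partial>lborel) = (LINT x:{0..pi}|lebesgue. \<bar>g x\<bar> * 1)"
    unfolding set_lebesgue_integral_def by (subst integral_completion) auto
  also have "\<dots> \<le> L2_norm (\<lambda>x. \<bar>g x\<bar>) * L2_norm (\<lambda>x. 1)"
    using L2_inner(2)[OF in_L2_continuous[OF c] L1] by (simp add: abs_le_iff)
  also have "L2_norm (\<lambda>x. 1) = sqrt pi"
  proof -
    have "(indicat_real {0..pi} x)\<^sup>2 = indicat_real {0..pi} x" for x
      by (simp split: split_indicator)
    then show ?thesis using lebesgue_indicator_Icc(2)[of 0 pi] by (simp add: L2_norm_eq)
  qed
  also have "L2_norm (\<lambda>x. \<bar>g x\<bar>) = L2_norm g"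
    by (simp add: L2_norm_def)
  finally show ?thesis by (simp add: mult.commute)
qed

text \<open>With m = sin x and d the boundary distance, the factor a^2 + ab + b^2 of the difference
  of cubes is at most 3 B^2 d, and m^2 \<ge> d^2 / 4; hence 12 = 3 * 4 and a single power of d in
  the denominator.\<close>

lemma cubic_difference_bound:
  fixes a b B m d :: real
  assumes "\<bar>a\<bar> \<le> B * sqrt d" "\<bar>b\<bar> \<le> B * sqrt d" "B \<ge> 0" "d > 0" "d \<le> 2 * m"
  shows "\<bar>a ^ 3 / m\<^sup>2 - b ^ 3 / m\<^sup>2\<bar> \<le> 12 * B\<^sup>2 * \<bar>a - b\<bar> / d"
proof -
  have m: "m > 0" using assms by simp
  have "\<bar>a * b\<bar> \<le> (B * sqrt d) * (B * sqrt d)" "\<bar>a * a\<bar> \<le> (B * sqrt d) * (B * sqrt d)" "\<bar>b * b\<bar> \<le> (B * sqrt d) * (B * sqrt d)"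
    unfolding abs_mult by (intro mult_mono assms; use assms in simp)+
  moreover have "(B * sqrt d) * (B * sqrt d) = B\<^sup>2 * d"
    using assms(4) by (simp add: power2_eq_square algebra_simps)
  ultimately have q: "\<bar>a * a + a * b + b * b\<bar> \<le> 3 * (B\<^sup>2 * d)" by (simp only: abs_le_iff) linarith
  have "a ^ 3 / m\<^sup>2 - b ^ 3 / m\<^sup>2 = (a - b) * (a * a + a * b + b * b) / m\<^sup>2"
    by (simp add: diff_divide_distrib[symmetric] power3_eq_cube algebra_simps)
  then have "\<bar>a ^ 3 / m\<^sup>2 - b ^ 3 / m\<^sup>2\<bar> = \<bar>a - b\<bar> * \<bar>a * a + a * b + b * b\<bar> / m\<^sup>2"
    by (simp add: abs_mult)
  also have "\<dots> \<le> \<bar>a - b\<bar> * (3 * (B\<^sup>2 * d)) / (d\<^sup>2 / 4)"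
  proof (intro frac_le mult_left_mono q)
    have "d\<^sup>2 \<le> (2 * m)\<^sup>2" using assms by (intro power_mono) auto
    then show "d\<^sup>2 / 4 \<le> m\<^sup>2" by (simp add: power_mult_distrib)
  qed (use assms in auto)
  also have "\<dots> = 12 * B\<^sup>2 * \<bar>a - b\<bar> / d"
    using assms(4) by (simp add: field_simps power2_eq_square)
  finally show ?thesis .
qed

lemma energy_solution_unique:
  assumes u1: "energy_solution u1 f0 f1" and u2: "energy_solution u2 f0 f1" and x: "x \<in> {0..pi}"
  shows "u1 t x = u2 t x"
proof -
  have H: "continuous_into_H1_0 u1" "continuous_into_H1_0 u2"
    and d: "distributional_solution u1" "distributional_solution u2"
    and i: "\<And>x. x \<in> {0..pi} \<Longrightarrow> u1 0 x = u2 0 x"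
    using u1 u2 by (auto simp: energy_solution_def)
  have H0: "in_H1_0 (u1 s)" "in_H1_0 (u2 s)" for s
    using H by (auto simp: continuous_into_H1_0_def)
  note c = H[THEN continuous_into_H1_0_jointly]
  define w where "w z = u1 (fst z) (snd z) - u2 (fst z) (snd z)" for z
  define F where "F z = (u1 (fst z) (snd z)) ^ 3 / (sin (snd z))\<^sup>2 - (u2 (fst z) (snd z)) ^ 3 / (sin (snd z))\<^sup>2" for z
  have cs: "continuous_on strip (\<lambda>z. u1 (fst z) (snd z))" "continuous_on strip (\<lambda>z. u2 (fst z) (snd z))"
    by (rule continuous_on_subset[OF c(1)] continuous_on_subset[OF c(2)]; auto)+
  have cF': "continuous_on strip (\<lambda>z. (u1 (fst z) (snd z)) ^ 3 / (sin (snd z))\<^sup>2)"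
    "continuous_on strip (\<lambda>z. (u2 (fst z) (snd z)) ^ 3 / (sin (snd z))\<^sup>2)"
    by (intro continuous_intros cs; use sin_gt_zero in force)+
  have cw: "continuous_on (UNIV \<times> {0..pi}) w" unfolding w_def[abs_def] by (intro continuous_intros c)
  have cws: "continuous_on strip w" by (rule continuous_on_subset[OF cw]) auto
  have cF: "continuous_on strip F" unfolding F_def[abs_def] by (intro continuous_on_diff cF')
  have weak: "weak_wave w F"
    unfolding w_def[abs_def] F_def[abs_def]
    using d by (intro weak_wave_diff cs cF') (simp_all add: distributional_solution_lborel c)
  have bdry: "w (s, 0) = 0" "w (s, pi) = 0" for s
    using H0[of s] by (auto simp: w_def in_H1_0_def)
  have init: "w (0, y) = 0" if "y \<in> {0..pi}" for y using i[OF that] by (simp add: w_def)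
  \<comment> \<open>Stated for both signs of s, to serve the difference and its time
    reflection.\<close>
  have small: "\<exists>\<delta>>0. \<forall>s. \<bar>s\<bar> < \<delta> \<longrightarrow> (\<integral>x. indicator {0..pi} x * \<bar>w (s, x)\<bar> \<partial>lborel) \<le> e * \<bar>s\<bar>"
    if e: "e > 0" for e
  proof -
    have "\<forall>\<^sub>F s in at 0. L2_norm (\<lambda>x. u1 s x - u2 s x) / \<bar>s\<bar> < e / sqrt pi"
      using order_tendstoD(2)[OF energy_solutions_diff_small[OF u1 u2]] e by simp
    then obtain \<delta> where \<delta>: "\<delta> > 0" "\<And>s. s \<noteq> 0 \<Longrightarrow> \<bar>s\<bar> < \<delta> \<Longrightarrow> L2_norm (\<lambda>x. u1 s x - u2 s x) / \<bar>s\<bar> < e / sqrt pi"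
      by (auto simp: eventually_at dist_real_def)
    have "(\<integral>x. indicator {0..pi} x * \<bar>w (s, x)\<bar> \<partial>lborel) \<le> e * \<bar>s\<bar>" if s: "\<bar>s\<bar> < \<delta>" for s
    proof (cases "s = 0")
      case True
      then have "indicat_real {0..pi} x * \<bar>w (s, x)\<bar> = 0" for x
        using init by (simp split: split_indicator)
      then show ?thesis using True by (simp only: Bochner_Integration.integral_zero)
    next
      case False
      have "(\<integral>x. indicator {0..pi} x * \<bar>w (s, x)\<bar> \<partial>lborel) \<le> sqrt pi * L2_norm (\<lambda>x. w (s, x))"
        by (rule L1_le_L2_norm) (use H0[of s] in \<open>auto simp: w_def in_H1_0_def intro!: continuous_intros\<close>)
      also have "\<dots> \<le> e * \<bar>s\<bar>" using \<delta>(2)[OF False s] False by (simp add: w_def field_simps)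
      finally show ?thesis .
    qed
    then show ?thesis using \<delta>(1) by blast
  qed
  \<comment> \<open>Strictly beyond |t|, as \<open>vanishes\<close> concerns times below T; the
    constants below belong to this time window.\<close>
  define T where "T = \<bar>t\<bar> + 1"
  obtain B1 B2 where B12: "B1 \<ge> 0" "\<And>s y. s \<in> {-T..T} \<Longrightarrow> y \<in> {0..pi} \<Longrightarrow> \<bar>u1 s y\<bar> \<le> B1 * sqrt (bdist y)"
    "B2 \<ge> 0" "\<And>s y. s \<in> {-T..T} \<Longrightarrow> y \<in> {0..pi} \<Longrightarrow> \<bar>u2 s y\<bar> \<le> B2 * sqrt (bdist y)"
    using continuous_into_H1_0_bounded[OF H(1), of "-T" T] continuous_into_H1_0_bounded[OF H(2), of "-T" T]
    by blast
  define B where "B = B1 + B2"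
  have B: "B \<ge> 0" using B12 by (simp add: B_def)
  have ub: "\<bar>u1 s y\<bar> \<le> B * sqrt (bdist y)" "\<bar>u2 s y\<bar> \<le> B * sqrt (bdist y)"
    if "s \<in> {-T..T}" "y \<in> {0..pi}" for s y
  proof -
    have "sqrt (bdist y) \<ge> 0" using that by auto
    then have "B1 * sqrt (bdist y) \<ge> 0" "B2 * sqrt (bdist y) \<ge> 0" using B12 by simp_all
    then show "\<bar>u1 s y\<bar> \<le> B * sqrt (bdist y)" "\<bar>u2 s y\<bar> \<le> B * sqrt (bdist y)"
      using B12(2)[OF that] B12(4)[OF that] unfolding B_def distrib_right by linarith+
  qed
  have Fb: "\<bar>F (s, y)\<bar> \<le> 12 * B\<^sup>2 * \<bar>w (s, y)\<bar> / bdist y" if "s \<in> {-T..T}" "y \<in> {0<..<pi}" for s y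
    unfolding F_def w_def fst_conv snd_conv
    by (rule cubic_difference_bound) (use ub[OF that(1)] that(2) B bdist_le_two_sin[of y] in auto)
  have wb: "\<bar>w (s, y)\<bar> \<le> 2 * B * sqrt (bdist y)" if "s \<in> {-T..T}" "y \<in> {0..pi}" for s y
    using ub[OF that] unfolding w_def fst_conv snd_conv by linarith
  interpret fwd: vanishing_data_wave w F
  proof
    show "\<exists>\<delta>>0. \<forall>s. 0 \<le> s \<and> s < \<delta> \<longrightarrow> (\<integral>x. indicator {0..pi} x * \<bar>w (s, x)\<bar> \<partial>lborel) \<le> c * s" if "c > 0" for c
    proof -
      obtain \<delta> where \<delta>: "\<delta> > 0" "\<And>s. \<bar>s\<bar> < \<delta> \<Longrightarrow> (\<integral>x. indicator {0..pi} x * \<bar>w (s, x)\<bar> \<partial>lborel) \<le> c * \<bar>s\<bar>"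
        using small[OF \<open>c > 0\<close>] by blast
      show ?thesis
      proof (intro exI[of _ \<delta>] conjI allI impI \<delta>(1))
        fix s assume "0 \<le> s \<and> s < \<delta>"
        then show "(\<integral>x. indicator {0..pi} x * \<bar>w (s, x)\<bar> \<partial>lborel) \<le> c * s" using \<delta>(2)[of s] by simp
      qed
    qed
  qed (use weak cw cF bdry init in auto)
  \<comment> \<open>Negative times are positive times of the reflected difference.\<close>
  interpret bwd: vanishing_data_wave "\<lambda>z. w (- fst z, snd z)" "\<lambda>z. F (- fst z, snd z)"
  proof
    show "weak_wave (\<lambda>z. w (- fst z, snd z)) (\<lambda>z. F (- fst z, snd z))"
      by (rule weak_wave_reflect[OF weak cws cF])
    show "continuous_on (UNIV \<times> {0..pi}) (\<lambda>z. w (- fst z, snd z))"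
      by (rule continuous_on_compose2[OF cw]) (auto intro!: continuous_intros)
    show "continuous_on strip (\<lambda>z. F (- fst z, snd z))"
      by (rule continuous_on_compose2[OF cF]) (auto intro!: continuous_intros)
    show "\<exists>\<delta>>0. \<forall>s. 0 \<le> s \<and> s < \<delta> \<longrightarrow>
        (\<integral>x. indicator {0..pi} x * \<bar>w (- fst (s, x), snd (s, x))\<bar> \<partial>lborel) \<le> c * s" if "c > 0" for c
    proof -
      obtain \<delta> where \<delta>: "\<delta> > 0" "\<And>s. \<bar>s\<bar> < \<delta> \<Longrightarrow> (\<integral>x. indicator {0..pi} x * \<bar>w (s, x)\<bar> \<partial>lborel) \<le> c * \<bar>s\<bar>"
        using small[OF \<open>c > 0\<close>] by blast
      show ?thesis
      proof (intro exI[of _ \<delta>] conjI allI impI \<delta>(1))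
        fix s assume "0 \<le> s \<and> s < \<delta>"
        then show "(\<integral>x. indicator {0..pi} x * \<bar>w (- fst (s, x), snd (s, x))\<bar> \<partial>lborel) \<le> c * s"
          using \<delta>(2)[of "- s"] by simp
      qed
    qed
  qed (use bdry init in auto)
  have "w (t, x) = 0"
  proof (cases "t = 0")
    case True
    then show ?thesis using init x by simp
  next
    case False
    then consider "t > 0" | "t < 0" by linarith
    then show ?thesis
    proof cases
      case 1
      show ?thesis
        by (rule fwd.vanishes[of "12 * B\<^sup>2" "2 * B" T])
          (use 1 B Fb wb x in \<open>auto simp: T_def\<close>)
    next
      case 2
      have "w (- fst (- t, x), snd (- t, x)) = 0"
        by (rule bwd.vanishes[of "12 * B\<^sup>2" "2 * B" T])
          (use 2 B Fb wb x in \<open>auto simp: T_def\<close>)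
      then show ?thesis by simp
    qed
  qed
  then show ?thesis by (simp add: w_def)
qed

section \<open>The standing wave\<close>

text \<open>Conservation of \<open>G'\<^sup>2 + G\<^sup>2 + G\<^sup>4 / 2\<close> suggests \<open>G = G0 cos \<theta>\<close> with
  \<open>\<theta>' = sqrt (1 + G0\<^sup>2 (1 + cos\<^sup>2 \<theta>) / 2)\<close>, an autonomous equation solved by inverting
  the elapsed time as a function of \<open>\<theta>\<close>.\<close>

lemma duffing_periodic_solution:
  fixes G0 :: real
  obtains G G' T where "\<And>t. (G has_real_derivative G' t) (at t)"
    "\<And>t. (G' has_real_derivative - G t - G t ^ 3) (at t)"
    "G 0 = G0" "G' 0 = 0" "T > 0" "\<And>t. G (t + T) = G t"
proof -
  define k where "k = G0\<^sup>2"
  have k: "k \<ge> 0" by (simp add: k_def)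
  \<comment> \<open>Conservation reads G0^2 sin^2 \<theta> \<theta>'^2 = G0^2 (1 - cos^2 \<theta>) +
    G0^4 (1 - cos^4 \<theta>) / 2; cancelling G0^2 sin^2 \<theta> leaves the square of
    \<open>v\<close>. As v \<ge> 1, the angle keeps moving even at turning points of G, where
    inverting G itself would degenerate.\<close>
  define v where "v x = sqrt (1 + k * (1 + (cos x)\<^sup>2) / 2)" for x
  define V where "V = sqrt (1 + k)"
  have pos: "1 + k * (1 + (cos x)\<^sup>2) / 2 \<ge> 1" for x using k by simp
  have v1: "v x \<ge> 1" for x unfolding v_def using pos[of x] by simp
  have vV: "v x \<le> V" for x
  proof -
    have "(cos x)\<^sup>2 \<le> 1" by (simp add: abs_square_le_1)
    then have "k * (1 + (cos x)\<^sup>2) \<le> k * 2" using k by (intro mult_left_mono) auto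
    then show ?thesis unfolding v_def V_def by (intro real_sqrt_le_mono) simp
  qed
  have v2: "v x * v x = 1 + k * (1 + (cos x)\<^sup>2) / 2" for x
    unfolding v_def using pos[of x] by simp
  have dv: "(v has_real_derivative - k * cos x * sin x / (2 * v x)) (at x)" for x
    unfolding v_def using pos[of x]
    by (auto intro!: derivative_eq_intros simp: field_simps)
  have vper: "v (x + 2 * pi) = v x" for x by (simp add: v_def)
  have cont: "continuous_on S (\<lambda>x. 1 / v x)" for S
  proof -
    have "continuous_on S v" by (intro continuous_at_imp_continuous_on ballI DERIV_isCont[OF dv])
    moreover have "v x \<noteq> 0" for x using v1[of x] by auto
    ultimately show ?thesis by (intro continuous_intros) auto
  qed
  \<comment> \<open>The elapsed time as a signed interval integral, so that negative angles are
    included.\<close>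
  define \<tau> where "\<tau> u = (LBINT y=0..ereal u. 1 / v y)" for u
  have d\<tau>: "(\<tau> has_real_derivative 1 / v x) (at x)" for x
  proof -
    have "(\<tau> has_vector_derivative 1 / v x) (at x within {-\<bar>x\<bar> - 1..\<bar>x\<bar> + 1})"
      unfolding \<tau>_def zero_ereal_def by (rule interval_integral_FTC2) (auto intro: cont)
    then have "(\<tau> has_real_derivative 1 / v x) (at x within {-\<bar>x\<bar> - 1..\<bar>x\<bar> + 1})"
      by (simp add: has_real_derivative_iff_has_vector_derivative)
    then show ?thesis using at_within_Icc_at[of "-\<bar>x\<bar> - 1" x "\<bar>x\<bar> + 1"] by simp
  qed
  have \<tau>0: "\<tau> 0 = 0" by (simp add: \<tau>_def zero_ereal_def[symmetric])
  have \<tau>_mono: "\<tau> x < \<tau> y" if "x < y" for x y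
    using that DERIV_pos_imp_increasing[of x y \<tau>] d\<tau> v1 by (meson less_le_trans zero_less_divide_1_iff zero_less_one)
  have \<tau>_inj: "\<tau> x = \<tau> y \<longleftrightarrow> x = y" for x y
    using \<tau>_mono[of x y] \<tau>_mono[of y x] by (cases x y rule: linorder_cases) auto
  have "V \<ge> 1" using k by (simp add: V_def)
  \<comment> \<open>The slope of \<open>\<tau>\<close> is at least 1 / V, so it is unbounded in both
    directions and therefore onto; this makes \<theta> exist for all times.\<close>
  have growth: "\<tau> x - x / V \<le> \<tau> y - y / V" if "x \<le> y" for x y
  proof (rule DERIV_nonneg_imp_nondecreasing[OF that])
    fix z
    have "((\<lambda>x. \<tau> x - x / V) has_real_derivative 1 / v z - 1 / V) (at z)"
      using d\<tau> \<open>V \<ge> 1\<close> by (auto intro!: derivative_eq_intros)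
    moreover have "1 / v z - 1 / V \<ge> 0"
      using vV[of z] v1[of z] by (simp add: frac_le)
    ultimately show "\<exists>d. ((\<lambda>x. \<tau> x - x / V) has_real_derivative d) (at z) \<and> 0 \<le> d" by blast
  qed
  have \<tau>_surj: "\<exists>x. \<tau> x = t" for t
  proof -
    let ?b = "V * \<bar>t\<bar>"
    have b: "?b \<ge> 0" using \<open>V \<ge> 1\<close> by simp
    have "\<tau> ?b \<ge> \<bar>t\<bar>" using growth[OF b] \<tau>0 \<open>V \<ge> 1\<close> by simp
    moreover have "\<tau> (- ?b) \<le> - \<bar>t\<bar>" using growth[of "- ?b" 0] b \<tau>0 \<open>V \<ge> 1\<close> by simp
    ultimately have "\<exists>x. - ?b \<le> x \<and> x \<le> ?b \<and> \<tau> x = t"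
      using b DERIV_isCont[OF d\<tau>] by (intro IVT) auto
    then show ?thesis by blast
  qed
  define \<theta> where "\<theta> t = (THE x. \<tau> x = t)" for t
  have \<tau>\<theta>: "\<tau> (\<theta> t) = t" for t
    unfolding \<theta>_def by (rule theI') (use \<tau>_surj \<tau>_inj in metis)
  have \<theta>\<tau>: "\<theta> (\<tau> x) = x" for x using \<tau>\<theta>[of "\<tau> x"] \<tau>_inj by simp
  have cont\<theta>: "isCont \<theta> t" for t
    using isCont_inverse_function[of 1 "\<theta> t" \<theta> \<tau>] \<theta>\<tau> DERIV_isCont[OF d\<tau>] \<tau>\<theta>[of t] by simp
  have d\<theta>: "(\<theta> has_real_derivative v (\<theta> t)) (at t)" for t
  proof -
    have "(\<theta> has_real_derivative inverse (1 / v (\<theta> t))) (at t)"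
    proof (rule DERIV_inverse_function[where a="t - 1" and b="t + 1"])
      show "(\<tau> has_real_derivative 1 / v (\<theta> t)) (at (\<theta> t))" by (rule d\<tau>)
      show "1 / v (\<theta> t) \<noteq> 0" using v1[of "\<theta> t"] by simp
    qed (use \<tau>\<theta> cont\<theta> in auto)
    then show ?thesis by simp
  qed
  \<comment> \<open>The time of one full turn; 2 pi-periodicity of \<open>v\<close> makes all turns
    equally long.\<close>
  define T where "T = \<tau> (2 * pi)"
  have T: "T > 0" using \<tau>_mono[of 0 "2 * pi"] \<tau>0 by (simp add: T_def)
  have \<tau>per: "\<tau> (x + 2 * pi) = \<tau> x + T" for x
  proof -
    have "((\<lambda>x. \<tau> (x + 2 * pi) - \<tau> x) has_real_derivative 1 / v (x + 2 * pi) * 1 - 1 / v x) (at x)" for x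
      by (intro DERIV_diff d\<tau> DERIV_chain2[OF d\<tau>]) (auto intro!: derivative_eq_intros)
    then have "\<forall>x. ((\<lambda>x. \<tau> (x + 2 * pi) - \<tau> x) has_real_derivative 0) (at x)" by (simp add: vper)
    from DERIV_isconst_all[OF this, of x 0] show ?thesis by (simp add: \<tau>0 T_def)
  qed
  have \<theta>per: "\<theta> (t + T) = \<theta> t + 2 * pi" for t
    using \<theta>\<tau>[of "\<theta> t + 2 * pi"] by (simp add: \<tau>per \<tau>\<theta>)
  define G where "G t = G0 * cos (\<theta> t)" for t
  define G' where "G' t = - G0 * sin (\<theta> t) * v (\<theta> t)" for t
  show ?thesis
  proof (rule that[of G G' T])
    show "(G has_real_derivative G' t) (at t)" for t
      unfolding G_def[abs_def] G'_def by (auto intro!: derivative_eq_intros d\<theta>)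
    show "(G' has_real_derivative - G t - G t ^ 3) (at t)" for t
    proof -
      let ?c = "cos (\<theta> t)" and ?s = "sin (\<theta> t)" and ?v = "v (\<theta> t)"
      have "(G' has_real_derivative - G0 * (?c * ?v) * ?v + (- k * ?c * ?s / (2 * ?v) * ?v) * (- G0 * ?s)) (at t)"
        unfolding G'_def[abs_def]
        by (rule DERIV_mult[OF DERIV_cmult[OF DERIV_chain2[OF DERIV_sin d\<theta>]] DERIV_chain2[OF dv d\<theta>]])
      \<comment> \<open>After inserting v^2 and sin^2 = 1 - cos^2, the terms k G0 cos / 2 cancel and
        the two halves of k G0 cos^3 add up; k = G0^2 makes this G^3.\<close>
      moreover have "- G0 * (?c * ?v) * ?v + (- k * ?c * ?s / (2 * ?v) * ?v) * (- G0 * ?s) = - G t - G t ^ 3"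
      proof -
        have nz: "?v \<noteq> 0" using v1[of "\<theta> t"] by auto
        have "- G0 * (?c * ?v) * ?v + (- k * ?c * ?s / (2 * ?v) * ?v) * (- G0 * ?s)
            = - G0 * ?c * (?v * ?v) + k * G0 * ?c * ?s\<^sup>2 / 2"
          using nz by (simp add: power2_eq_square)
        also have "\<dots> = - G t - G t ^ 3"
          unfolding v2 G_def sin_squared_eq k_def
          by (simp add: power2_eq_square power3_eq_cube field_simps)
        finally show ?thesis .
      qed
      ultimately show ?thesis by (simp only:)
    qed
    have "\<theta> 0 = 0" using \<theta>\<tau>[of 0] \<tau>0 by simp
    then show "G 0 = G0" "G' 0 = 0" by (simp_all add: G_def G'_def)
    show "T > 0" by (rule T)
    show "G (t + T) = G t" for t by (simp add: G_def \<theta>per)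
  qed
qed

section \<open>Integration by parts and the standing wave\<close>

lemma integral_deriv_compact_support:
  fixes h h' :: "real \<Rightarrow> real"
  assumes d: "\<And>x. (h has_real_derivative h' x) (at x)" and c: "continuous_on UNIV h'"
    and z: "\<And>x. \<bar>x\<bar> > R \<Longrightarrow> h x = 0" "\<And>x. \<bar>x\<bar> > R \<Longrightarrow> h' x = 0"
  shows "(\<integral>x. h' x \<partial>lborel) = 0"
proof -
  define r where "r = \<bar>R\<bar> + 1"
  have "(\<integral>x. h' x \<partial>lborel) = (\<integral>x. h' x * indicator {-r..r} x \<partial>lborel)"
  proof (intro Bochner_Integration.integral_cong refl)
    fix x
    have "\<bar>x\<bar> > R" if "x \<notin> {-r..r}" using that by (simp add: r_def) linarith
    then show "h' x = h' x * indicator {-r..r} x" using z(2)[of x] by (cases "x \<in> {-r..r}") simp_all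
  qed
  also have "\<dots> = h r - h (- r)"
    using c d by (intro integral_FTC_Icc_real) (auto simp: r_def continuous_on_eq_continuous_at)
  also have "\<dots> = 0" using z(1)[of r] z(1)[of "- r"] by (simp add: r_def)
  finally show ?thesis .
qed

lemma
  fixes X X' :: "real \<times> real \<Rightarrow> real"
  assumes c: "continuous_on UNIV X'" and K: "compact K"
    and z: "\<And>z. z \<notin> K \<Longrightarrow> X z = 0" "\<And>z. z \<notin> K \<Longrightarrow> X' z = 0"
  shows integrable_compact_support: "integrable lborel X'"
    and integral_space_derivative: "(\<And>t x. ((\<lambda>y. X (t, y)) has_real_derivative X' (t, x)) (at x)) \<Longrightarrow> (\<integral>z. X' z \<partial>lborel) = 0"
    and integral_time_derivative: "(\<And>t x. ((\<lambda>s. X (s, x)) has_real_derivative X' (t, x)) (at t)) \<Longrightarrow> (\<integral>z. X' z \<partial>lborel) = 0"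
proof -
  obtain R where R: "\<And>z. z \<in> K \<Longrightarrow> norm z \<le> R"
    using compact_imp_bounded[OF K] unfolding bounded_iff by blast
  have out: "(t, x) \<notin> K" if "\<bar>t\<bar> > R \<or> \<bar>x\<bar> > R" for t x
    using R[of "(t, x)"] norm_fst_le[of t x] norm_snd_le[of x t] that by auto
  have "X' = (\<lambda>z. indicator K z *\<^sub>R X' z)" using z(2) by (auto simp: fun_eq_iff indicator_def)
  moreover have "integrable lborel (\<lambda>z. indicator K z *\<^sub>R X' z)"
    by (intro borel_integrable_compact K continuous_on_subset[OF c]) simp
  ultimately show int: "integrable lborel X'" by metis
  then have int': "integrable (lborel \<Otimes>\<^sub>M lborel) X'" by (simp add: lborel_prod)
  have cs: "continuous_on UNIV (\<lambda>x. X' (t, x))" "continuous_on UNIV (\<lambda>t. X' (t, x))" for t x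
    by (rule continuous_on_compose2[OF c]; auto intro!: continuous_intros)+
  show "(\<integral>z. X' z \<partial>lborel) = 0"
    if d: "\<And>t x. ((\<lambda>y. X (t, y)) has_real_derivative X' (t, x)) (at x)"
  proof -
    have "(\<integral>x. X' (t, x) \<partial>lborel) = 0" for t
      by (rule integral_deriv_compact_support[OF d cs(1), of R]) (use out z in auto)
    then show ?thesis using lborel_pair.integral_fst'[OF int'] by (simp add: lborel_prod)
  qed
  show "(\<integral>z. X' z \<partial>lborel) = 0"
    if d: "\<And>t x. ((\<lambda>s. X (s, x)) has_real_derivative X' (t, x)) (at t)"
  proof -
    have "(\<integral>t. X' (t, x) \<partial>lborel) = 0" for x
      by (rule integral_deriv_compact_support[OF d cs(2), of R]) (use out z in auto)
    then show ?thesis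
      using lborel_pair.integral_snd[of "\<lambda>t x. X' (t, x)"] int' by (simp add: lborel_prod case_prod_unfold)
  qed
qed

lemma has_weak_deriv_sin: "has_weak_deriv (\<lambda>x. c * sin x) (\<lambda>x. c * cos x)"
  unfolding has_weak_deriv_def
proof (intro allI impI)
  fix \<phi> assume t: "test_function {0<..<pi} \<phi>"
  then have sm: "smooth \<phi>" by (simp add: test_function_def)
  have cd: "continuous_on S (deriv \<phi>)" "continuous_on S \<phi>" for S
    using smooth_continuous_on[OF smooth_deriv(2)[OF sm]] smooth_continuous_on[OF sm] .
  let ?f = "\<lambda>x. c * sin x * deriv \<phi> x" and ?g = "\<lambda>x. c * cos x * \<phi> x"
  have int: "set_integrable lborel {0..pi} ?f" "set_integrable lborel {0..pi} ?g"
    by (intro borel_integrable_atLeastAtMost' continuous_intros cd)+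
  have eq: "(LINT x:{0..pi}|lebesgue. h x) = (LINT x:{0..pi}|lborel. h x)"
    if "set_integrable lborel {0..pi} h" for h :: "real \<Rightarrow> real"
    using borel_measurable_integrable[OF that[unfolded set_integrable_def]]
    unfolding set_lebesgue_integral_def by (intro integral_completion)
  have "(LINT x:{0..pi}|lborel. ?f x) + (LINT x:{0..pi}|lborel. ?g x) = (LINT x:{0..pi}|lborel. ?f x + ?g x)"
    using set_integral_add(2)[OF int] by simp
  also have "\<dots> = (\<integral>x. (?f x + ?g x) * indicator {0..pi} x \<partial>lborel)"
    by (simp add: set_lebesgue_integral_def mult.commute)
  also have "\<dots> = c * sin pi * \<phi> pi - c * sin 0 * \<phi> 0"
  proof (rule integral_FTC_Icc_real)
    show "((\<lambda>x. c * sin x * \<phi> x) has_real_derivative ?f x + ?g x) (at x)" for x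
      by (auto intro!: derivative_eq_intros smooth_deriv(1)[OF sm])
    have "continuous_on UNIV (\<lambda>x. ?f x + ?g x)" by (intro continuous_intros cd)
    then show "isCont (\<lambda>x. ?f x + ?g x) x" for x by (simp add: continuous_on_eq_continuous_at)
  qed simp
  finally show "(LINT x:{0..pi}|lebesgue. ?f x) = - (LINT x:{0..pi}|lebesgue. ?g x)"
    by (simp add: eq[OF int(1)] eq[OF int(2)])
qed

lemma in_L2_sin_cos: "in_L2 (\<lambda>x. c * sin x)" "in_L2 (\<lambda>x. c * cos x)"
  by (intro in_L2_continuous continuous_intros)+

lemma in_H1_sin: "in_H1 (\<lambda>x. c * sin x)"
  unfolding in_H1_def using in_L2_sin_cos has_weak_deriv_sin by blast

text \<open>\<open>weak_deriv\<close> is chosen by Hilbert's operator, so its value on c sin is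
  known only through the defining property; the fundamental lemma identifies it with c cos almost
  everywhere, which is enough for the norm.\<close>

lemma H1_norm_sin: "H1_norm (\<lambda>x. c * sin x) = \<bar>c\<bar> * sqrt ((L2_norm sin)\<^sup>2 + (L2_norm cos)\<^sup>2)"
proof -
  note wd = weak_deriv[OF in_H1_sin, of c]
  let ?h = "weak_deriv (\<lambda>x. c * sin x)"
  have "has_weak_deriv (\<lambda>x. c * sin x - c * sin x) (\<lambda>x. ?h x - c * cos x)"
    by (intro has_weak_deriv_diff wd has_weak_deriv_sin in_L2_sin_cos)
  then have "AE x in lebesgue. x \<in> {0..pi} \<longrightarrow> ?h x - c * cos x = 0"
    by (intro AE_eq_0_if_orthogonal_to_test_functions in_L2_diff wd in_L2_sin_cos)
      (simp add: has_weak_deriv_def)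
  then have "AE x in lebesgue. x \<in> {0..pi} \<longrightarrow> ?h x = c * cos x"
    by eventually_elim auto
  then have "L2_norm ?h = L2_norm (\<lambda>x. c * cos x)"
    by (rule L2_norm_cong_AE[OF _ wd(1) in_L2_sin_cos(2)])
  then have "H1_norm (\<lambda>x. c * sin x) = sqrt (c\<^sup>2 * ((L2_norm sin)\<^sup>2 + (L2_norm cos)\<^sup>2))"
    by (simp add: H1_norm_def L2_norm_cmult power_mult_distrib distrib_left)
  then show ?thesis by (simp add: real_sqrt_mult)
qed

text \<open>On the strip the singular weight cancels, (G sin)^3 / sin^2 = G^3 sin, so the weak
  equation reduces to an integration by parts with smooth coefficients in space and the two
  derivatives of G in time.\<close>

lemma standing_wave_energy_solution:
  fixes G G' :: "real \<Rightarrow> real"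
  assumes dG: "\<And>t. (G has_real_derivative G' t) (at t)"
    and dG': "\<And>t. (G' has_real_derivative - G t - G t ^ 3) (at t)"
    and G'0: "G' 0 = 0"
  shows "energy_solution (\<lambda>t x. G t * sin x) (\<lambda>x. G 0 * sin x) (\<lambda>x. 0)"
proof -
  have cG: "continuous_on S G" "continuous_on S G'" for S
    using DERIV_isCont[OF dG] DERIV_isCont[OF dG'] by (auto intro: continuous_at_imp_continuous_on)
  have H: "continuous_into_H1_0 (\<lambda>t x. G t * sin x)"
    unfolding continuous_into_H1_0_def
  proof (intro conjI allI)
    show "in_H1_0 (\<lambda>x. G t * sin x)" for t
      by (auto simp: in_H1_0_def in_H1_sin intro!: continuous_intros)
    fix t
    have "((\<lambda>s. \<bar>G s - G t\<bar> * sqrt ((L2_norm sin)\<^sup>2 + (L2_norm cos)\<^sup>2)) \<longlongrightarrow>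
        \<bar>G t - G t\<bar> * sqrt ((L2_norm sin)\<^sup>2 + (L2_norm cos)\<^sup>2)) (at t)"
      using DERIV_isCont[OF dG, of t] unfolding isCont_def by (intro tendsto_intros)
    then show "((\<lambda>s. H1_norm (\<lambda>x. G s * sin x - G t * sin x)) \<longlongrightarrow> 0) (at t)"
      by (simp add: left_diff_distrib[symmetric] H1_norm_sin)
  qed
  have td: "has_time_deriv_L2 (\<lambda>t x. G t * sin x) (\<lambda>t x. G' t * sin x)"
    unfolding has_time_deriv_L2_def
  proof
    fix t
    have eq: "(G s * sin x - G t * sin x) / (s - t) - G' t * sin x = ((G s - G t) / (s - t) - G' t) * sin x" for s x
      by (simp add: left_diff_distrib diff_divide_distrib)
    have "((\<lambda>s. \<bar>(G s - G t) / (s - t) - G' t\<bar> * L2_norm sin) \<longlongrightarrow> \<bar>G' t - G' t\<bar> * L2_norm sin) (at t)"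
      using dG[of t] unfolding has_field_derivative_iff by (intro tendsto_intros)
    then show "((\<lambda>s. L2_norm (\<lambda>x. (G s * sin x - G t * sin x) / (s - t) - G' t * sin x)) \<longlongrightarrow> 0) (at t)"
      unfolding eq L2_norm_cmult by simp
  qed
  have cL: "continuous_into_L2 (\<lambda>t x. G' t * sin x)"
    unfolding continuous_into_L2_def
  proof (intro conjI allI in_L2_sin_cos)
    fix t
    have "((\<lambda>s. \<bar>G' s - G' t\<bar> * L2_norm sin) \<longlongrightarrow> \<bar>G' t - G' t\<bar> * L2_norm sin) (at t)"
      using DERIV_isCont[OF dG', of t] unfolding isCont_def by (intro tendsto_intros)
    then show "((\<lambda>s. L2_norm (\<lambda>x. G' s * sin x - G' t * sin x)) \<longlongrightarrow> 0) (at t)"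
      by (simp add: left_diff_distrib[symmetric] L2_norm_cmult)
  qed
  have "weak_wave (\<lambda>z. G (fst z) * sin (snd z)) (\<lambda>z. (G (fst z) * sin (snd z)) ^ 3 / (sin (snd z))\<^sup>2)"
    unfolding weak_wave_def
  proof (intro allI impI)
    fix \<phi> assume t: "test_function strip \<phi>"
    let ?K = "closure {z. \<phi> z \<noteq> 0}"
    let ?w = "\<lambda>z::real \<times> real. G (fst z) * sin (snd z)"
    have sm: "smooth \<phi>" and K: "compact ?K" "?K \<subseteq> strip" using t by (auto simp: test_function_def)
    note st = smooth_d_time(2)[OF sm] and ss = smooth_d_space(2)[OF sm]
    have sub: "closure {z. d_time \<phi> z \<noteq> 0} \<subseteq> ?K" "closure {z. d_space \<phi> z \<noteq> 0} \<subseteq> ?K"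
      by (intro closure_minimal; use d_time_eq_0_outside_support d_space_eq_0_outside_support in blast)+
    have z: "\<phi> z = 0" "d_time \<phi> z = 0" "d_space \<phi> z = 0" "d_time (d_time \<phi>) z = 0" "d_space (d_space \<phi>) z = 0"
      if "z \<notin> ?K" for z
    proof -
      have "z \<notin> closure {z. d_time \<phi> z \<noteq> 0}" "z \<notin> closure {z. d_space \<phi> z \<noteq> 0}" using that sub by blast+
      then show "d_time (d_time \<phi>) z = 0" "d_space (d_space \<phi>) z = 0"
        by (simp_all add: d_time_eq_0_outside_support d_space_eq_0_outside_support)
      show "\<phi> z = 0" using that closure_subset[of "{z. \<phi> z \<noteq> 0}"] by blast
    qed (use that in \<open>simp_all add: d_time_eq_0_outside_support d_space_eq_0_outside_support\<close>)
    \<comment> \<open>Green's identity for w = G sin and \<phi>: X is w times the space derivative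
      of \<phi> minus that of w times \<phi>, and Y is the same in time. The space derivative X' and
      the time derivative Y' each integrate to 0, and X' - Y' is the left integrand minus the right
      one.\<close>
    define X where "X z = ?w z * d_space \<phi> z - G (fst z) * cos (snd z) * \<phi> z" for z
    define X' where "X' z = ?w z * d_space (d_space \<phi>) z + ?w z * \<phi> z" for z
    define Y where "Y z = ?w z * d_time \<phi> z - G' (fst z) * sin (snd z) * \<phi> z" for z
    define Y' where "Y' z = ?w z * d_time (d_time \<phi>) z + (G (fst z) + G (fst z) ^ 3) * sin (snd z) * \<phi> z" for z
    have cGf: "continuous_on S (\<lambda>z::real \<times> real. G (fst z))" for S
      by (rule continuous_on_compose2[OF cG(1)]) (auto intro: continuous_intros)
    have cont: "continuous_on UNIV X'" "continuous_on UNIV Y'"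
      unfolding X'_def[abs_def] Y'_def[abs_def]
      by (intro continuous_intros cGf smooth_continuous_on sm smooth_d_space(2) smooth_d_time(2))+
    have dX: "((\<lambda>y. X (t, y)) has_real_derivative X' (t, x)) (at x)" for t x
      unfolding X_def X'_def
      by (auto intro!: derivative_eq_intros smooth_d_space(1)[OF sm] smooth_d_space(1)[OF ss] simp: algebra_simps)
    have dY: "((\<lambda>s. Y (s, x)) has_real_derivative Y' (t, x)) (at t)" for t x
      unfolding Y_def Y'_def
      by (auto intro!: derivative_eq_intros smooth_d_time(1)[OF sm] smooth_d_time(1)[OF st] dG dG' simp: algebra_simps)
    have X0: "X z = 0" "X' z = 0" and Y0: "Y z = 0" "Y' z = 0" if "z \<notin> ?K" for z
      using z[OF that] by (auto simp: X_def X'_def Y_def Y'_def)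
    have intX: "integrable lborel X'" "(\<integral>z. X' z \<partial>lborel) = 0"
      by (rule integrable_compact_support[of X' ?K X] integral_space_derivative[of X' ?K X];
          fact cont K(1) X0 dX)+
    have intY: "integrable lborel Y'" "(\<integral>z. Y' z \<partial>lborel) = 0"
      by (rule integrable_compact_support[of Y' ?K Y] integral_time_derivative[of Y' ?K Y];
          fact cont K(1) Y0 dY)+
    have cw: "continuous_on strip ?w"
      by (intro continuous_intros cGf)
    have cF: "continuous_on strip (\<lambda>z. ?w z ^ 3 / (sin (snd z))\<^sup>2)"
      by (intro continuous_intros cGf) (use sin_gt_zero in force)
    let ?l = "\<lambda>z. indicator strip z * (?w z * (d_space (d_space \<phi>) z - d_time (d_time \<phi>) z))"
    let ?r = "\<lambda>z. indicator strip z * (?w z ^ 3 / (sin (snd z))\<^sup>2 * \<phi> z)"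
    have "?l z - ?r z = X' z - Y' z" for z
    proof (cases "z \<in> ?K")
      case True
      then have z: "z \<in> strip" using K by auto
      then have "sin (snd z) \<noteq> 0" using sin_gt_zero[of "snd z"] by auto
      then have "?w z ^ 3 / (sin (snd z))\<^sup>2 = G (fst z) ^ 3 * sin (snd z)"
        by (simp add: power_mult_distrib power3_eq_cube power2_eq_square)
      then show ?thesis using z by (simp add: X'_def Y'_def algebra_simps)
    next
      case False
      then show ?thesis
        using X0(2)[OF False] Y0(2)[OF False] z(1)[OF False] z(4)[OF False] z(5)[OF False] by simp
    qed
    then have "(\<integral>z. ?l z \<partial>lborel) - (\<integral>z. ?r z \<partial>lborel) = (\<integral>z. X' z - Y' z \<partial>lborel)"
      by (subst Bochner_Integration.integral_diff[OF test_function_integrands(1)[OF t cw] test_function_integrands(2)[OF t cF], symmetric])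
        (simp only:)
    also have "\<dots> = 0" using intX intY by simp
    finally show "(\<integral>z. ?l z \<partial>lborel) = (\<integral>z. ?r z \<partial>lborel)" by simp
  qed
  then have "distributional_solution (\<lambda>t x. G t * sin x)"
    by (subst distributional_solution_lborel[OF continuous_into_H1_0_jointly[OF H]])
  then show ?thesis
    unfolding energy_solution_def using H td cL G'0 by (auto intro!: exI[of _ "\<lambda>t x. G' t * sin x"])
qed

text \<open>The uniqueness clause is what makes the periodic \<open>f\<close> the solution with
  these data and not merely one of them. It compares values on [0, pi], the only ones that matter
  for representatives.\<close>

theorem theorem1p2:
  fixes G0 :: real
  shows "\<exists>f. energy_solution f (\<lambda>x. G0 * sin x) (\<lambda>x. 0) \<and>
             (\<forall>g. energy_solution g (\<lambda>x. G0 * sin x) (\<lambda>x. 0) \<longrightarrow>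
                  (\<forall>t. \<forall>x\<in>{0..pi}. g t x = f t x)) \<and>
             (\<exists>T>0. \<forall>t. \<forall>x\<in>{0..pi}. f (t + T) x = f t x)"
proof -
  obtain G G' T where G: "\<And>t. (G has_real_derivative G' t) (at t)"
    "\<And>t. (G' has_real_derivative - G t - G t ^ 3) (at t)"
    "G 0 = G0" "G' 0 = 0" "T > 0" "\<And>t. G (t + T) = G t"
    using duffing_periodic_solution by blast
  have sol: "energy_solution (\<lambda>t x. G t * sin x) (\<lambda>x. G0 * sin x) (\<lambda>x. 0)"
    using standing_wave_energy_solution[OF G(1,2,4)] G(3) by simp
  show ?thesis
  proof (intro exI[of _ "\<lambda>t x. G t * sin x"] conjI allI impI ballI)
    show "g t x = G t * sin x" if "energy_solution g (\<lambda>x. G0 * sin x) (\<lambda>x. 0)" "x \<in> {0..pi}" for g t x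
      by (rule energy_solution_unique[OF that(1) sol that(2)])
    show "\<exists>T>0. \<forall>t. \<forall>x\<in>{0..pi}. G (t + T) * sin x = G t * sin x"
      using G(5,6) by auto
  qed (rule sol)
qed

end
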